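(* Let $\boldsymbol{\sigma}=(\sigma_n)_{n\in\mathbb N}$ be a primitive encoding directive sequence, and let $\mathsf V$ be a pseudovariety of semigroups containing $\mathsf{LSl}$. Assume that the language $\mathrm{Im}(\sigma_{0,n})$ is $\mathsf V$-recognizable for every $n\in\mathbb N$. If $\boldsymbol{\sigma}$ is $\mathsf V$-saturating and eventually recognizable, then $\boldsymbol{\sigma}$ is recognizable.
   Context: For a finite alphabet $A$, $A^+$ is the free semigroup on $A$, $|w|$ is the length of $w$, and $\mathrm{fac}(w)$ is the set of nonempty factors of $w$. A directive sequence is a sequence $\boldsymbol{\sigma}=(\sigma_n)_{n\in\mathbb N}$ of homomorphisms $\sigma_n\colon A_{n+1}^+\to A_n^+$, each $A_n$ a finite nonempty alphabet; it is encoding if every $\sigma_n$ is injective. Put $\sigma_{n,m}=\sigma_n\circ\cdots\circ\sigma_{m-1}$ for $n\le m$ (identity if $n=m$) and $\boldsymbol{\sigma}^{(k)}=(\sigma_{n+k})_{n\in\mathbb N}$. Put $L(\boldsymbol{\sigma})=\bigcup_{n\ge 0}\bigcup_{a\in A_n}\mathrm{fac}(\sigma_{0,n}(a))$, and let $X(\boldsymbol{\sigma})$ be the set of $x\in A_0^{\mathbb Z}$ all of whose nonempty finite factors lie in $L(\boldsymbol{\sigma})$. A homomorphism $\varphi\colon A^+\to B^+$ is positive if for every $a\in A$ one has $|\varphi(a)|\ge 2$ and every letter of $B$ occurs in $\varphi(a)$; $\boldsymbol{\sigma}$ is primitive if for every $n$ there is $m>n$ with $\sigma_{n,m}$ positive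 (then $X(\boldsymbol{\sigma})$ is a minimal shift space with language $L(\boldsymbol{\sigma})$). Let $T$ be the shift map, $T(x)[i]=x[i+1]$, and let $\sigma(x)=\cdots\sigma(x[-1])\cdot\sigma(x[0])\sigma(x[1])\cdots$. A homomorphism $\sigma\colon A^+\to B^+$ is recognizable in $X\subseteq A^{\mathbb Z}$ if every $y\in B^{\mathbb Z}$ has at most one pair $(k,x)$ with $x\in X$, $0\le k<|\sigma(x[0])|$ and $T^k\sigma(x)=y$. $\boldsymbol{\sigma}$ is recognizable if $\sigma_n$ is recognizable in $X(\boldsymbol{\sigma}^{(n+1)})$ for every $n$, and eventually recognizable if this holds for all but finitely many $n$. A pseudovariety of semigroups is a class of finite semigroups closed under subsemigroups, homomorphic images and finite direct products. $\mathsf{LSl}$ is the pseudovariety of finite semigroups $S$ such that $eSe$ is a semilattice for every idempotent $e\in S$. A language $L\subseteq A^+$ is $\mathsf V$-recognizable if there are $S\in\mathsf V$ and a homomorphism $\varphi\colon A^+\to S$ with $L=\varphi^{-1}(\varphi(L))$. $\overline{\Omega}_A\mathsf V$ is the free pro-$\mathsf V$ semigroup on $A$ (pro-$\mathsf V$: inverse limit of members of $\mathsf V$ with discrete topologies); for the $\mathsf V$ considered it contains $A^+$ as a dense subsemigroup, and each homomorphism $\varphi\colon A^+\to B^+$ extends uniquely to a continuous homomorphism $\varphi^{\mathsf V}\colon\overline{\Omega}_A\mathsf V\to\overline{\Omega}_B\mathsf V$. The set $\overline{L(\boldsymbol{\sigma})}\setminus L(\boldsymbol{\sigma})$ (closure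 in $\overline{\Omega}_{A_0}\mathsf V$) lies in a single regular $\mathcal J$-class of $\overline{\Omega}_{A_0}\mathsf V$, denoted $J_{\mathsf V}(\boldsymbol{\sigma})$. Put $\mathrm{Im}_{\mathsf V}(\boldsymbol{\sigma})=\bigcap_{n}\mathrm{Im}(\sigma_{0,n}^{\mathsf V})$. A primitive directive sequence $\boldsymbol{\sigma}$ is $\mathsf V$-saturating if $\mathrm{Im}_{\mathsf V}(\boldsymbol{\sigma})$ contains a maximal subgroup of $\overline{\Omega}_{A_0}\mathsf V$ contained in $J_{\mathsf V}(\boldsymbol{\sigma})$. *)

theory Defs
  imports "HOL-Analysis.Function_Topology" "HOL-Algebra.Group" "HOL-Library.Sublist"
begin

section \<open>Semigroups\<close>

record 'a sgp = "'a partial_object" +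
  times :: "'a \<Rightarrow> 'a \<Rightarrow> 'a" (infixl \<open>\<cdot>\<index>\<close> 70)

definition is_semigroup :: "'a sgp \<Rightarrow> bool" where
  "is_semigroup S \<longleftrightarrow> carrier S \<noteq> {} \<and>
     (\<forall>x\<in>carrier S. \<forall>y\<in>carrier S. x \<cdot>\<^bsub>S\<^esub> y \<in> carrier S) \<and>
     (\<forall>x\<in>carrier S. \<forall>y\<in>carrier S. \<forall>z\<in>carrier S.
        (x \<cdot>\<^bsub>S\<^esub> y) \<cdot>\<^bsub>S\<^esub> z = x \<cdot>\<^bsub>S\<^esub> (y \<cdot>\<^bsub>S\<^esub> z))"

definition sgp_hom :: "'a sgp \<Rightarrow> 'b sgp \<Rightarrow> ('a \<Rightarrow> 'b) set" where
  "sgp_hom S T = {f \<in> carrier S \<rightarrow> carrier T.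
     \<forall>x\<in>carrier S. \<forall>y\<in>carrier S. f (x \<cdot>\<^bsub>S\<^esub> y) = f x \<cdot>\<^bsub>T\<^esub> f y}"

definition sgp_iso :: "'a sgp \<Rightarrow> 'b sgp \<Rightarrow> ('a \<Rightarrow> 'b) set" where
  "sgp_iso S T = {f \<in> sgp_hom S T. bij_betw f (carrier S) (carrier T)}"

definition prod_sgp :: "'i set \<Rightarrow> ('i \<Rightarrow> 'a sgp) \<Rightarrow> ('i \<Rightarrow> 'a) sgp" where
  "prod_sgp I S = \<lparr>carrier = (\<Pi>\<^sub>E i\<in>I. carrier (S i)),
     times = (\<lambda>x y. \<lambda>i\<in>I. x i \<cdot>\<^bsub>S i\<^esub> y i)\<rparr>"

definition idempotents :: "'a sgp \<Rightarrow> 'a set" where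
  "idempotents S = {e \<in> carrier S. e \<cdot>\<^bsub>S\<^esub> e = e}"

definition sgp_ideal :: "'a sgp \<Rightarrow> 'a \<Rightarrow> 'a set" where
  "sgp_ideal S x = {x} \<union> {s \<cdot>\<^bsub>S\<^esub> x |s. s \<in> carrier S} \<union> {x \<cdot>\<^bsub>S\<^esub> t |t. t \<in> carrier S}
     \<union> {s \<cdot>\<^bsub>S\<^esub> x \<cdot>\<^bsub>S\<^esub> t |s t. s \<in> carrier S \<and> t \<in> carrier S}"

text \<open>The classes of Green's relation J.\<close>
definition J_classes :: "'a sgp \<Rightarrow> 'a set set" where
  "J_classes S = {{y \<in> carrier S. sgp_ideal S y = sgp_ideal S x} |x. x \<in> carrier S}"

text \<open>Regular elements are defined by \<open>x \<in> xSx\<close>; a J-class is regular if all its elements are.\<close>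
definition regular_class :: "'a sgp \<Rightarrow> 'a set \<Rightarrow> bool" where
  "regular_class S J \<longleftrightarrow> (\<forall>x\<in>J. \<exists>s\<in>carrier S. x = x \<cdot>\<^bsub>S\<^esub> s \<cdot>\<^bsub>S\<^esub> x)"

text \<open>A subgroup of a semigroup may have any idempotent as its identity.\<close>
definition is_subgroup :: "'a sgp \<Rightarrow> 'a set \<Rightarrow> bool" where
  "is_subgroup S H \<longleftrightarrow> H \<subseteq> carrier S \<and>
     (\<exists>e. group \<lparr>carrier = H, mult = (\<lambda>x y. x \<cdot>\<^bsub>S\<^esub> y), one = e\<rparr>)"

definition maximal_subgroup :: "'a sgp \<Rightarrow> 'a set \<Rightarrow> bool" where
  "maximal_subgroup S H \<longleftrightarrow> is_subgroup S H \<and>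
     (\<forall>K. is_subgroup S K \<and> H \<subseteq> K \<longrightarrow> K = H)"

section \<open>Pseudovarieties\<close>

text \<open>Every finite semigroup is isomorphic to one carried by a set of natural numbers, and
  pseudovarieties are closed under isomorphism, so a class of finite semigroups is represented by
  its members of type \<^typ>\<open>nat sgp\<close>. A direct product has another type, and is represented by its
  isomorphic copies. The index set may be empty; the product is then the trivial semigroup.\<close>
definition pseudovariety :: "nat sgp set \<Rightarrow> bool" where
  "pseudovariety V \<longleftrightarrow>
     (\<forall>S\<in>V. is_semigroup S \<and> finite (carrier S)) \<and>
     (\<forall>S\<in>V. \<forall>H. H \<subseteq> carrier S \<and> is_semigroup (S\<lparr>carrier := H\<rparr>) \<longrightarrow> S\<lparr>carrier := H\<rparr> \<in> V) \<and>
     (\<forall>S\<in>V. \<forall>T :: nat sgp. \<forall>f. is_semigroup T \<and> f \<in> sgp_hom S T \<and> f ` carrier S = carrier T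
        \<longrightarrow> T \<in> V) \<and>
     (\<forall>I :: nat set. \<forall>S. \<forall>T :: nat sgp. finite I \<and> (\<forall>i\<in>I. S i \<in> V) \<and> is_semigroup T \<and>
        sgp_iso (prod_sgp I S) T \<noteq> {} \<longrightarrow> T \<in> V)"

definition is_semilattice :: "'a sgp \<Rightarrow> bool" where
  "is_semilattice S \<longleftrightarrow> is_semigroup S \<and> (\<forall>x\<in>carrier S. x \<cdot>\<^bsub>S\<^esub> x = x) \<and>
     (\<forall>x\<in>carrier S. \<forall>y\<in>carrier S. x \<cdot>\<^bsub>S\<^esub> y = y \<cdot>\<^bsub>S\<^esub> x)"

definition LSl :: "nat sgp set" where
  "LSl = {S. is_semigroup S \<and> finite (carrier S) \<and>
     (\<forall>e\<in>idempotents S. is_semilattice (S\<lparr>carrier := {e \<cdot>\<^bsub>S\<^esub> s \<cdot>\<^bsub>S\<^esub> e |s. s \<in> carrier S}\<rparr>))}"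

section \<open>Words\<close>

definition free_sgp :: "'a set \<Rightarrow> 'a list sgp" where
  "free_sgp A = \<lparr>carrier = {w. w \<noteq> [] \<and> set w \<subseteq> A}, times = (@)\<rparr>"

abbreviation words :: "'a set \<Rightarrow> 'a list set" where
  "words A \<equiv> carrier (free_sgp A)"

definition fac :: "'a list \<Rightarrow> 'a list set" where
  "fac w = {v. v \<noteq> [] \<and> sublist v w}"

definition V_recognizable :: "nat sgp set \<Rightarrow> 'a set \<Rightarrow> 'a list set \<Rightarrow> bool" where
  "V_recognizable V A L \<longleftrightarrow> L \<subseteq> words A \<and>
     (\<exists>S\<in>V. \<exists>\<phi>\<in>sgp_hom (free_sgp A) S. L = {w \<in> words A. \<phi> w \<in> \<phi> ` L})"

section \<open>Free pro-V semigroups\<close>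

text \<open>The inverse limit of all A-generated members of V: the index \<open>(S, \<phi>)\<close> is a semigroup \<open>S\<close> in V
  together with a homomorphism \<open>\<phi>\<close> from the free semigroup onto it, and the transition maps are the
  homomorphisms which commute with these.\<close>
definition proV_index :: "nat sgp set \<Rightarrow> 'a set \<Rightarrow> (nat sgp \<times> ('a list \<Rightarrow> nat)) set" where
  "proV_index V A = {(S, \<phi>). S \<in> V \<and> \<phi> \<in> sgp_hom (free_sgp A) S \<and>
     \<phi> \<in> extensional (words A) \<and> \<phi> ` words A = carrier S}"

definition proV_carrier ::
    "nat sgp set \<Rightarrow> 'a set \<Rightarrow> (nat sgp \<times> ('a list \<Rightarrow> nat) \<Rightarrow> nat) set" where
  "proV_carrier V A = {x \<in> (\<Pi>\<^sub>E i\<in>proV_index V A. carrier (fst i)).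
     \<forall>(S, \<phi>)\<in>proV_index V A. \<forall>(T, \<psi>)\<in>proV_index V A. \<forall>f\<in>sgp_hom S T.
       (\<forall>w\<in>words A. f (\<phi> w) = \<psi> w) \<longrightarrow> f (x (S, \<phi>)) = x (T, \<psi>)}"

definition proV :: "nat sgp set \<Rightarrow> 'a set \<Rightarrow> (nat sgp \<times> ('a list \<Rightarrow> nat) \<Rightarrow> nat) sgp" where
  "proV V A = (prod_sgp (proV_index V A) fst)\<lparr>carrier := proV_carrier V A\<rparr>"

definition proV_top ::
    "nat sgp set \<Rightarrow> 'a set \<Rightarrow> (nat sgp \<times> ('a list \<Rightarrow> nat) \<Rightarrow> nat) topology" where
  "proV_top V A = subtopology
     (product_topology (\<lambda>i. discrete_topology (carrier (fst i))) (proV_index V A))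
     (proV_carrier V A)"

text \<open>The canonical map of the free semigroup into the inverse limit.\<close>
definition proV_word ::
    "nat sgp set \<Rightarrow> 'a set \<Rightarrow> 'a list \<Rightarrow> (nat sgp \<times> ('a list \<Rightarrow> nat) \<Rightarrow> nat)" where
  "proV_word V A w = (\<lambda>i\<in>proV_index V A. snd i w)"

text \<open>The unique continuous homomorphism extending a homomorphism of free semigroups.\<close>
definition proV_ext :: "nat sgp set \<Rightarrow> 'a set \<Rightarrow> 'b set \<Rightarrow> ('a list \<Rightarrow> 'b list) \<Rightarrow>
    (nat sgp \<times> ('a list \<Rightarrow> nat) \<Rightarrow> nat) \<Rightarrow> (nat sgp \<times> ('b list \<Rightarrow> nat) \<Rightarrow> nat)" where
  "proV_ext V A B \<phi> = (THE f. f \<in> extensional (proV_carrier V A) \<and>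
     f \<in> sgp_hom (proV V A) (proV V B) \<and> continuous_map (proV_top V A) (proV_top V B) f \<and>
     (\<forall>w\<in>words A. f (proV_word V A w) = proV_word V B (\<phi> w)))"

section \<open>Directive sequences\<close>

text \<open>All alphabets are subsets of one type of letters; only the values of \<open>\<sigma> n\<close> on the nonempty
  words over \<open>A (n + 1)\<close> matter.\<close>
definition directive_sequence :: "(nat \<Rightarrow> 'a set) \<Rightarrow> (nat \<Rightarrow> 'a list \<Rightarrow> 'a list) \<Rightarrow> bool" where
  "directive_sequence A \<sigma> \<longleftrightarrow> (\<forall>n. finite (A n) \<and> A n \<noteq> {} \<and>
     \<sigma> n \<in> sgp_hom (free_sgp (A (Suc n))) (free_sgp (A n)))"

definition encoding :: "(nat \<Rightarrow> 'a set) \<Rightarrow> (nat \<Rightarrow> 'a list \<Rightarrow> 'a list) \<Rightarrow> bool" where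
  "encoding A \<sigma> \<longleftrightarrow> (\<forall>n. inj_on (\<sigma> n) (words (A (Suc n))))"

text \<open>\<open>\<sigma>\<^sub>n \<circ> \<dots> \<circ> \<sigma>\<^sub>m\<^sub>-\<^sub>1\<close>, used for \<open>n \<le> m\<close>.\<close>
definition seq_comp :: "(nat \<Rightarrow> 'a list \<Rightarrow> 'a list) \<Rightarrow> nat \<Rightarrow> nat \<Rightarrow> 'a list \<Rightarrow> 'a list" where
  "seq_comp \<sigma> n m = foldr (\<circ>) (map \<sigma> [n..<m]) id"

definition seq_shift :: "nat \<Rightarrow> (nat \<Rightarrow> 'c) \<Rightarrow> nat \<Rightarrow> 'c" where
  "seq_shift k s = (\<lambda>n. s (n + k))"

definition seq_lang :: "(nat \<Rightarrow> 'a set) \<Rightarrow> (nat \<Rightarrow> 'a list \<Rightarrow> 'a list) \<Rightarrow> 'a list set" where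
  "seq_lang A \<sigma> = (\<Union>n. \<Union>a\<in>A n. fac (seq_comp \<sigma> 0 n [a]))"

definition seq_space :: "(nat \<Rightarrow> 'a set) \<Rightarrow> (nat \<Rightarrow> 'a list \<Rightarrow> 'a list) \<Rightarrow> (int \<Rightarrow> 'a) set" where
  "seq_space A \<sigma> = {x. range x \<subseteq> A 0 \<and> (\<forall>i j. i \<le> j \<longrightarrow> map x [i..j] \<in> seq_lang A \<sigma>)}"

definition positive :: "'a set \<Rightarrow> 'b set \<Rightarrow> ('a list \<Rightarrow> 'b list) \<Rightarrow> bool" where
  "positive A B \<phi> \<longleftrightarrow> (\<forall>a\<in>A. length (\<phi> [a]) \<ge> 2 \<and> B \<subseteq> set (\<phi> [a]))"

definition primitive :: "(nat \<Rightarrow> 'a set) \<Rightarrow> (nat \<Rightarrow> 'a list \<Rightarrow> 'a list) \<Rightarrow> bool" where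
  "primitive A \<sigma> \<longleftrightarrow> (\<forall>n. \<exists>m>n. positive (A m) (A n) (seq_comp \<sigma> n m))"

section \<open>Recognizability\<close>

definition shift :: "(int \<Rightarrow> 'a) \<Rightarrow> int \<Rightarrow> 'a" where
  "shift x = (\<lambda>i. x (i + 1))"

text \<open>The image of \<open>x\<close> with the first letter of \<open>\<phi>(x[0])\<close> at position 0. Letters have nonempty
  images, so for \<open>n \<ge> 0\<close> position \<open>n\<close> lies in the prefix \<open>\<phi>(x[0] \<dots> x[n])\<close> of the right half, and
  for \<open>n < 0\<close> it lies in the suffix \<open>\<phi>(x[n] \<dots> x[-1])\<close> of the left half, whose last letter is at
  position -1.\<close>
definition bi_image :: "('a list \<Rightarrow> 'b list) \<Rightarrow> (int \<Rightarrow> 'a) \<Rightarrow> int \<Rightarrow> 'b" where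
  "bi_image \<phi> x = (\<lambda>n. if n \<ge> 0 then \<phi> (map x [0..n]) ! nat n
     else rev (\<phi> (map x [n..-1])) ! nat (- n - 1))"

definition recognizable_in :: "'b set \<Rightarrow> ('a list \<Rightarrow> 'b list) \<Rightarrow> (int \<Rightarrow> 'a) set \<Rightarrow> bool" where
  "recognizable_in B \<phi> X \<longleftrightarrow> (\<forall>y. range y \<subseteq> B \<longrightarrow>
     (\<forall>k x k' x'.
        x \<in> X \<and> k < length (\<phi> [x 0]) \<and> (shift ^^ k) (bi_image \<phi> x) = y \<and>
        x' \<in> X \<and> k' < length (\<phi> [x' 0]) \<and> (shift ^^ k') (bi_image \<phi> x') = y
        \<longrightarrow> k = k' \<and> x = x'))"

definition level_recognizable ::
    "(nat \<Rightarrow> 'a set) \<Rightarrow> (nat \<Rightarrow> 'a list \<Rightarrow> 'a list) \<Rightarrow> nat \<Rightarrow> bool" where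
  "level_recognizable A \<sigma> n \<longleftrightarrow>
     recognizable_in (A n) (\<sigma> n) (seq_space (seq_shift (n + 1) A) (seq_shift (n + 1) \<sigma>))"

definition recognizable :: "(nat \<Rightarrow> 'a set) \<Rightarrow> (nat \<Rightarrow> 'a list \<Rightarrow> 'a list) \<Rightarrow> bool" where
  "recognizable A \<sigma> \<longleftrightarrow> (\<forall>n. level_recognizable A \<sigma> n)"

definition eventually_recognizable ::
    "(nat \<Rightarrow> 'a set) \<Rightarrow> (nat \<Rightarrow> 'a list \<Rightarrow> 'a list) \<Rightarrow> bool" where
  "eventually_recognizable A \<sigma> \<longleftrightarrow> finite {n. \<not> level_recognizable A \<sigma> n}"

section \<open>Saturating directive sequences\<close>

definition J_V :: "nat sgp set \<Rightarrow> (nat \<Rightarrow> 'a set) \<Rightarrow> (nat \<Rightarrow> 'a list \<Rightarrow> 'a list) \<Rightarrow>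
    (nat sgp \<times> ('a list \<Rightarrow> nat) \<Rightarrow> nat) set" where
  "J_V V A \<sigma> = (let L = proV_word V (A 0) ` seq_lang A \<sigma> in
     (THE J. J \<in> J_classes (proV V (A 0)) \<and> regular_class (proV V (A 0)) J \<and>
        (proV_top V (A 0) closure_of L) - L \<subseteq> J))"

definition Im_V :: "nat sgp set \<Rightarrow> (nat \<Rightarrow> 'a set) \<Rightarrow> (nat \<Rightarrow> 'a list \<Rightarrow> 'a list) \<Rightarrow>
    (nat sgp \<times> ('a list \<Rightarrow> nat) \<Rightarrow> nat) set" where
  "Im_V V A \<sigma> = (\<Inter>n. proV_ext V (A n) (A 0) (seq_comp \<sigma> 0 n) ` proV_carrier V (A n))"

definition saturating ::
    "nat sgp set \<Rightarrow> (nat \<Rightarrow> 'a set) \<Rightarrow> (nat \<Rightarrow> 'a list \<Rightarrow> 'a list) \<Rightarrow> bool" where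
  "saturating V A \<sigma> \<longleftrightarrow>
     (\<exists>H. maximal_subgroup (proV V (A 0)) H \<and> H \<subseteq> J_V V A \<sigma> \<and> H \<subseteq> Im_V V A \<sigma>)"

end

theory Submission
  imports Defs "HOL-Analysis.Abstract_Topological_Spaces"
begin

text \<open>
  A maximal subgroup \<open>H\<close> in the J-class has an identity \<open>e\<close>. Write \<open>v\<^sub>m\<close> and \<open>u\<^sub>m\<close> for the prefix and the
  suffix of length \<open>m\<close> of \<open>e\<close>. By compactness and stability, every limit of words of the language
  which begin with \<open>v\<^sub>m\<close> and end with \<open>u\<^sub>m\<close> for larger and larger \<open>m\<close> is H-equivalent to \<open>e\<close>, hence
  lies in \<open>H\<close>. If \<open>H\<close> is contained in the image of \<open>\<sigma>\<^sub>0\<^sub>,\<^sub>n\<close>, whose trace on words is clopen, then for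
  some \<open>m\<close> all words of the language which begin with \<open>v\<^sub>m\<close> and end with \<open>u\<^sub>m\<close> are images of words
  under \<open>\<sigma>\<^sub>0\<^sub>,\<^sub>n\<close>. So each occurrence of \<open>u\<^sub>m v\<^sub>m\<close> should be a cut. By taking \<open>r\<close> so large that
  \<open>u\<^sub>m v\<^sub>m\<close> occurs in every \<open>\<sigma>\<^sub>0\<^sub>,\<^sub>r(a)\<close> and applying this at level \<open>r\<close>, one finds one occurrence in
  an image \<open>\<sigma>\<^sub>0\<^sub>,\<^sub>n(b)\<close>, \<open>b\<close> in the language of level \<open>n\<close>, which is indeed a cut; comparing any other
  occurrence with recurrences of this one on both sides shows that it is a cut too, because
  \<open>\<sigma>\<^sub>0\<^sub>,\<^sub>n\<close> is injective. Hence the cuts of a bi-infinite word at all occurrences of \<open>u\<^sub>m v\<^sub>m\<close> are forced,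
  and injectivity forces the rest.
\<close>

text \<open>Synchronization only says that a word from \<open>v m\<close> to \<open>u m\<close> is
  the image of some word over \<open>A n\<close>; this preimage need not lie in the language of
  level \<open>n\<close>, nor fit the blocks of a surrounding word. Injectivity can compare two
  factorizations only between positions already known to be block boundaries of both. Hence one
  certified cut is needed first; finding it inside a single block
  \<open>seq_comp \<sigma> 0 r [a]\<close> places its preimage in the language of level
  \<open>n\<close>.

  The hypothesis on LSl makes prefixes, suffixes and factors of bounded length visible in one finite
  quotient, so that it makes sense to speak of prefixes and suffixes of pseudowords. Limits are
  taken along one fixed ultrafilter, so that splitting approximating words passes to factorizations
  of their limits.

  Recognizability of \<open>\<sigma> n\<close> comes from uniqueness of parsings under
  \<open>seq_comp \<sigma> 0 (Suc n)\<close>: both parsings of \<open>y\<close> are pushed down to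
  level 0 through one common parsing of the image of \<open>y\<close>.\<close>

section \<open>Homomorphisms of free semigroups\<close>

text \<open>The value of a homomorphism at the empty word is unspecified; this extension sends it to the
  empty word.\<close>
definition hat :: "('a list \<Rightarrow> 'b list) \<Rightarrow> 'a list \<Rightarrow> 'b list" where
  "hat \<phi> w = concat (map (\<lambda>a. \<phi> [a]) w)"

lemma hat_simps [simp]:
  "hat \<phi> [] = []" "hat \<phi> (a # w) = \<phi> [a] @ hat \<phi> w" "hat \<phi> (v @ w) = hat \<phi> v @ hat \<phi> w"
  by (simp_all add: hat_def)

lemma words_iff: "w \<in> words A \<longleftrightarrow> w \<noteq> [] \<and> set w \<subseteq> A"
  by (simp add: free_sgp_def)

lemma free_times [simp]: "v \<cdot>\<^bsub>free_sgp A\<^esub> w = v @ w"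
  by (simp add: free_sgp_def)

lemma free_hom_append:
  assumes "\<phi> \<in> sgp_hom (free_sgp A) S" "v \<in> words A" "w \<in> words A"
  shows "\<phi> (v @ w) = \<phi> v \<cdot>\<^bsub>S\<^esub> \<phi> w"
  using assms by (auto simp: sgp_hom_def)

lemma free_hom_hat:
  assumes "\<phi> \<in> sgp_hom (free_sgp A) (free_sgp B)" "w \<in> words A"
  shows "\<phi> w = hat \<phi> w"
proof -
  from assms(2) have "w \<noteq> []" "set w \<subseteq> A"
    by (auto simp: words_iff)
  then show ?thesis
  proof (induction w rule: list_nonempty_induct)
    case (single x)
    then show ?case by simp
  next
    case (cons x xs)
    then have "\<phi> ([x] @ xs) = \<phi> [x] @ \<phi> xs"
      using free_hom_append[OF assms(1), of "[x]" xs] by (simp add: words_iff)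
    with cons show ?case by simp
  qed
qed

lemma free_hom_letter:
  assumes "\<phi> \<in> sgp_hom (free_sgp A) (free_sgp B)" "a \<in> A"
  shows "\<phi> [a] \<noteq> []" "set (\<phi> [a]) \<subseteq> B"
  using assms by (auto simp: sgp_hom_def words_iff Pi_iff)

lemma set_hat:
  assumes "\<phi> \<in> sgp_hom (free_sgp A) (free_sgp B)" "set w \<subseteq> A"
  shows "set (hat \<phi> w) \<subseteq> B"
  using assms(2) free_hom_letter(2)[OF assms(1)] by (induction w) auto

lemma length_hat_ge:
  assumes "\<And>a. a \<in> set w \<Longrightarrow> \<phi> [a] \<noteq> []"
  shows "length w \<le> length (hat \<phi> w)"
  using assms
proof (induction w)
  case (Cons a w)
  then have "length (\<phi> [a]) \<ge> 1"
    by (simp add: Suc_le_eq)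
  moreover have "length w \<le> length (hat \<phi> w)"
    using Cons by simp
  ultimately show ?case by simp
qed simp

lemma length_hat_ge_mult:
  assumes "\<And>a. a \<in> set w \<Longrightarrow> K \<le> length (\<phi> [a])"
  shows "length w * K \<le> length (hat \<phi> w)"
  using assms by (induction w) (auto simp: add_mono)

text \<open>Compares two cuts of a word by their positions in the image. If \<open>h1\<close>
  extended beyond \<open>x1\<close>, the surplus would have an empty image, hence be empty.\<close>

lemma append_split_if_hat_le:
  assumes "h1 @ h2 = x1 @ x2" "length (hat \<phi> h1) \<le> length (hat \<phi> x1)"
    and "\<And>a. a \<in> set h1 \<Longrightarrow> \<phi> [a] \<noteq> []"
  shows "\<exists>z. x1 = h1 @ z \<and> h2 = z @ x2"
proof -
  from assms(1) obtain z where
    z: "h1 = x1 @ z \<and> z @ h2 = x2 \<or> h1 @ z = x1 \<and> h2 = z @ x2"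
    by (auto simp: append_eq_append_conv2)
  then show ?thesis
  proof
    assume a: "h1 = x1 @ z \<and> z @ h2 = x2"
    then have "length (hat \<phi> z) = 0"
      using assms(2) by simp
    moreover have "length z \<le> length (hat \<phi> z)"
      by (rule length_hat_ge) (use a assms(3) in auto)
    ultimately have "z = []" by simp
    with a show ?thesis by auto
  qed auto
qed

lemma append_eq_append_split:
  assumes "xs @ ys = zs @ ts" "length zs \<le> length xs"
  shows "\<exists>z. xs = zs @ z \<and> ts = z @ ys"
  using assms by (auto simp: append_eq_append_conv2)

text \<open>The induction discards the blocks before \<open>w\<close>. The block in which
  \<open>w\<close> starts contributes at most \<open>M\<close> letters and the next one has at most
  \<open>M\<close>; as \<open>2 * M < length w\<close>, that next block lies inside \<open>w\<close>
  with room on both sides.\<close>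

lemma hat_factor_letter:
  assumes "hat \<phi> g = p @ w @ q" "\<And>a. a \<in> set g \<Longrightarrow> length (\<phi> [a]) \<le> M" "2 * M < length w"
  shows "\<exists>b\<in>set g. \<exists>s t. w = s @ \<phi> [b] @ t \<and> s \<noteq> [] \<and> t \<noteq> []"
  using assms
proof (induction g arbitrary: p)
  case (Cons a g)
  have eq: "\<phi> [a] @ hat \<phi> g = p @ w @ q"
    using Cons.prems(1) by simp
  have M: "length (\<phi> [a]) \<le> M"
    using Cons.prems(2) by simp
  show ?case
  proof (cases "length (\<phi> [a]) \<le> length p")
    case True
    then obtain p' where "p = \<phi> [a] @ p'" "hat \<phi> g = p' @ w @ q"
      using append_eq_append_split[OF eq[symmetric]] by auto
    with Cons show ?thesis by auto
  next
    case False
    then obtain s where s: "\<phi> [a] = p @ s" "s @ hat \<phi> g = w @ q" "s \<noteq> []"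
      using append_eq_append_split[OF eq] by auto
    then have ls: "length s \<le> M"
      using M by simp
    then obtain w' where w': "w = s @ w'" "hat \<phi> g = w' @ q"
      using append_eq_append_split[OF s(2)[symmetric]] Cons.prems(3) by auto
    have lw': "M < length w'"
      using w' ls Cons.prems(3) by simp
    then obtain b g' where g: "g = b # g'"
      using w' by (cases g) auto
    have "length (\<phi> [b]) \<le> M"
      using Cons.prems(2) g by simp
    then obtain t where "w' = \<phi> [b] @ t" "t \<noteq> []"
      using append_eq_append_split[of w' q "\<phi> [b]" "hat \<phi> g'"] lw' w' g by fastforce
    then show ?thesis
      using s w' g by auto
  qed
qed simp

section \<open>Primitive directive sequences\<close>

lemma foldr_comp: "foldr (\<circ>) xs f = foldr (\<circ>) xs id \<circ> f"
  by (induction xs) (auto simp: comp_assoc)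

lemma seq_comp_refl [simp]: "seq_comp \<sigma> n n = id"
  by (simp add: seq_comp_def)

lemma seq_comp_Suc: "n \<le> m \<Longrightarrow> seq_comp \<sigma> n (Suc m) = seq_comp \<sigma> n m \<circ> \<sigma> m"
  by (simp add: seq_comp_def) (rule foldr_comp)

lemma seq_comp_trans:
  assumes "n \<le> m" "m \<le> r"
  shows "seq_comp \<sigma> n r = seq_comp \<sigma> n m \<circ> seq_comp \<sigma> m r"
  using assms(2)
proof (induction r rule: dec_induct)
  case (step r)
  with assms(1) show ?case
    by (simp add: seq_comp_Suc comp_assoc)
qed simp

lemma seq_comp_shift: "seq_comp (seq_shift k \<sigma>) n m = seq_comp \<sigma> (n + k) (m + k)"
proof -
  have "map (seq_shift k \<sigma>) [n..<m] = map \<sigma> [n + k..<m + k]"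
    by (rule nth_equalityI) (auto simp: seq_shift_def ac_simps)
  then show ?thesis
    by (simp only: seq_comp_def)
qed

lemma directive_seq_comp_hom:
  assumes "directive_sequence A \<sigma>" "n \<le> m"
  shows "seq_comp \<sigma> n m \<in> sgp_hom (free_sgp (A m)) (free_sgp (A n))"
  using assms(2)
proof (induction m rule: dec_induct)
  case base
  then show ?case by (auto simp: sgp_hom_def)
next
  case (step m)
  have "\<sigma> m \<in> sgp_hom (free_sgp (A (Suc m))) (free_sgp (A m))"
    using assms(1) by (auto simp: directive_sequence_def)
  with step show ?case
    by (auto simp: sgp_hom_def seq_comp_Suc Pi_iff)
qed

lemma encoding_inj_seq_comp:
  assumes "directive_sequence A \<sigma>" "encoding A \<sigma>" "n \<le> m"
  shows "inj_on (seq_comp \<sigma> n m) (words (A m))"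
  using assms(3)
proof (induction m rule: dec_induct)
  case (step m)
  have "\<sigma> m ` words (A (Suc m)) \<subseteq> words (A m)"
    using assms(1) by (fastforce simp: directive_sequence_def sgp_hom_def)
  moreover have "inj_on (\<sigma> m) (words (A (Suc m)))"
    using assms(2) by (auto simp: encoding_def)
  ultimately show ?case
    using comp_inj_on[of "\<sigma> m" "words (A (Suc m))" "seq_comp \<sigma> n m"]
      inj_on_subset[OF step.IH] step.hyps by (simp only: seq_comp_Suc)
qed simp

lemma finite_length_bound:
  assumes "finite X"
  shows "\<exists>M. \<forall>x\<in>X. length (f x) \<le> M"
  using finite_imageI[OF assms, of "\<lambda>x. length (f x)"] by (auto simp: finite_nat_set_iff_bounded_le)

locale primitive_sequence =
  fixes A :: "nat \<Rightarrow> 'a set" and \<sigma> :: "nat \<Rightarrow> 'a list \<Rightarrow> 'a list"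
  assumes dir: "directive_sequence A \<sigma>" and prim: "primitive A \<sigma>"
begin

abbreviation L :: "'a list set" where "L \<equiv> seq_lang A \<sigma>"

lemma fin: "finite (A n)" and ne: "A n \<noteq> {}"
  using dir by (auto simp: directive_sequence_def)

lemmas comp_hom = directive_seq_comp_hom[OF dir]

lemmas comp_hat = free_hom_hat[OF comp_hom]

lemma comp_letter:
  assumes "n \<le> m" "a \<in> A m"
  shows "seq_comp \<sigma> n m [a] \<noteq> []" "set (seq_comp \<sigma> n m [a]) \<subseteq> A n"
    "seq_comp \<sigma> n m [a] \<in> words (A n)"
  using free_hom_letter[OF comp_hom] assms by (auto simp: words_iff)

lemma comp_comp_letter:
  assumes "n \<le> m" "m \<le> r" "a \<in> A r"
  shows "seq_comp \<sigma> n r [a] = hat (seq_comp \<sigma> n m) (seq_comp \<sigma> m r [a])"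
  using comp_hat[OF assms(1) comp_letter(3)[OF assms(2,3)]] seq_comp_trans[OF assms(1,2), of \<sigma>]
  by simp

lemma comp_comp_hat:
  assumes "n \<le> m" "m \<le> r" "set w \<subseteq> A r"
  shows "hat (seq_comp \<sigma> n r) w = hat (seq_comp \<sigma> n m) (hat (seq_comp \<sigma> m r) w)"
  using assms(3) by (induction w) (auto simp: comp_comp_letter[OF assms(1,2)])

section \<open>Factors and recurrence in the language\<close>

lemma lang_iff: "x \<in> L \<longleftrightarrow> x \<noteq> [] \<and> (\<exists>n. \<exists>a\<in>A n. sublist x (seq_comp \<sigma> 0 n [a]))"
  by (auto simp: seq_lang_def fac_def)

lemma lang_words: "L \<subseteq> words (A 0)"
proof
  fix x assume "x \<in> L"
  then obtain n a where "x \<noteq> []" "a \<in> A n" "sublist x (seq_comp \<sigma> 0 n [a])"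
    by (auto simp: lang_iff)
  then show "x \<in> words (A 0)"
    using comp_letter(2)[of 0 n a] set_mono_sublist by (fastforce simp: words_iff)
qed

lemma lang_factor: "x \<in> L \<Longrightarrow> x = p @ y @ q \<Longrightarrow> y \<noteq> [] \<Longrightarrow> y \<in> L"
  unfolding lang_iff using sublist_order.order_trans[of y x] by (metis sublist_appendI)

lemma comp_letter_lang: "a \<in> A n \<Longrightarrow> seq_comp \<sigma> 0 n [a] \<in> L"
  using comp_letter(1)[of 0 n a] by (auto simp: lang_iff)

text \<open>If \<open>x\<close> occurs in the image of \<open>a\<close>, and positivity puts
  \<open>a\<close> into the image of every letter of level \<open>m\<close>, then \<open>x\<close>
  occurs in all blocks of level \<open>m\<close>. Blocks of higher levels begin with a block of
  level \<open>m\<close>, so the level can be moved beyond any \<open>N\<close>.\<close>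

lemma lang_occurs_in_letters:
  assumes "x \<in> L"
  shows "\<exists>r\<ge>N. \<forall>b\<in>A r. sublist x (seq_comp \<sigma> 0 r [b])"
proof -
  obtain n a where x: "a \<in> A n" "sublist x (seq_comp \<sigma> 0 n [a])"
    using assms by (auto simp: lang_iff)
  obtain m where m: "m > n" "positive (A m) (A n) (seq_comp \<sigma> n m)"
    using prim by (auto simp: primitive_def)
  have *: "sublist x (seq_comp \<sigma> 0 m [b])" if b: "b \<in> A m" for b
  proof -
    have "a \<in> set (seq_comp \<sigma> n m [b])"
      using m b x by (auto simp: positive_def)
    then obtain g h where "seq_comp \<sigma> n m [b] = g @ a # h"
      by (auto simp: in_set_conv_decomp)
    then have "seq_comp \<sigma> 0 m [b] = hat (seq_comp \<sigma> 0 n) g @ seq_comp \<sigma> 0 n [a] @ hat (seq_comp \<sigma> 0 n) h"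
      using comp_comp_letter[of 0 n m b] m b by simp
    then show ?thesis
      using x(2) by (metis sublist_appendI sublist_order.order_trans)
  qed
  have "sublist x (seq_comp \<sigma> 0 (max N m) [b])" if b: "b \<in> A (max N m)" for b
  proof -
    obtain c h where c: "seq_comp \<sigma> m (max N m) [b] = c # h" "c \<in> A m"
      using comp_letter[of m "max N m" b] b by (cases "seq_comp \<sigma> m (max N m) [b]") auto
    then have "seq_comp \<sigma> 0 (max N m) [b] = [] @ seq_comp \<sigma> 0 m [c] @ hat (seq_comp \<sigma> 0 m) h"
      using comp_comp_letter[of 0 m "max N m" b] b by simp
    then show ?thesis
      using *[OF c(2)] by (metis sublist_appendI sublist_order.order_trans)
  qed
  then show ?thesis by (intro exI[of _ "max N m"]) auto
qed

lemma comp_letter_unbounded: "\<exists>n. \<forall>b\<in>A n. K \<le> length (seq_comp \<sigma> 0 n [b])"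
proof (induction K)
  case (Suc K)
  then obtain n where n: "\<forall>b\<in>A n. K \<le> length (seq_comp \<sigma> 0 n [b])"
    by auto
  obtain m where m: "m > n" "positive (A m) (A n) (seq_comp \<sigma> n m)"
    using prim by (auto simp: primitive_def)
  have "Suc K \<le> length (seq_comp \<sigma> 0 m [b])" if b: "b \<in> A m" for b
  proof -
    let ?g = "seq_comp \<sigma> n m [b]"
    have eq: "seq_comp \<sigma> 0 m [b] = hat (seq_comp \<sigma> 0 n) ?g"
      using comp_comp_letter[of 0 n m b] m b by simp
    have "set ?g \<subseteq> A n" "2 \<le> length ?g"
      using comp_letter[of n m b] m b by (auto simp: positive_def)
    \<comment> \<open>\<open>max 1 K\<close> instead of \<open>K\<close> makes doubling a strict
      increase also for \<open>K = 0\<close>.\<close>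
    moreover have "length ?g * max 1 K \<le> length (hat (seq_comp \<sigma> 0 n) ?g)"
      by (rule length_hat_ge_mult) (use calculation n comp_letter(1)[of 0 n] in \<open>auto simp: Suc_le_eq\<close>)
    moreover have "2 * max 1 K \<le> length ?g * max 1 K"
      using calculation by (intro mult_right_mono) auto
    moreover have "Suc K \<le> 2 * max 1 K"
      by simp
    ultimately show ?thesis
      unfolding eq by linarith
  qed
  then show ?case by blast
qed simp

lemma lang_unbounded: "\<exists>w\<in>L. K \<le> length w"
proof -
  obtain n where "\<forall>b\<in>A n. K \<le> length (seq_comp \<sigma> 0 n [b])"
    using comp_letter_unbounded by blast
  moreover obtain b where "b \<in> A n"
    using ne by blast
  ultimately show ?thesis
    using comp_letter_lang by blast
qed

text \<open>A word longer than all blocks of level at most \<open>m\<close> comes from a higher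
  level, hence is a factor of a concatenation of blocks of level \<open>m\<close>. Once longer than
  two of them it contains a whole block, and with it \<open>x\<close>.\<close>

lemma lang_uniformly_recurrent:
  assumes "x \<in> L"
  shows "\<exists>K. \<forall>w\<in>L. K \<le> length w \<longrightarrow> (\<exists>s t. w = s @ x @ t \<and> s \<noteq> [] \<and> t \<noteq> [])"
proof -
  obtain m where m: "\<And>b. b \<in> A m \<Longrightarrow> sublist x (seq_comp \<sigma> 0 m [b])"
    using lang_occurs_in_letters[OF assms, of 0] by auto
  have "finite (SIGMA r:{..m}. A r)"
    using fin by simp
  from finite_length_bound[OF this, of "\<lambda>(r, a). seq_comp \<sigma> 0 r [a]"]
  obtain M where "\<forall>x\<in>Sigma {..m} A. length (case x of (r, a) \<Rightarrow> seq_comp \<sigma> 0 r [a]) \<le> M" ..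
  then have M: "\<And>r a. r \<le> m \<Longrightarrow> a \<in> A r \<Longrightarrow> length (seq_comp \<sigma> 0 r [a]) \<le> M"
    by fastforce
  show ?thesis
  proof (intro exI[of _ "2 * M + 1"] ballI impI)
    fix w assume w: "w \<in> L" "2 * M + 1 \<le> length w"
    then obtain r c where r: "c \<in> A r" "sublist w (seq_comp \<sigma> 0 r [c])"
      by (auto simp: lang_iff)
    then have "length w \<le> length (seq_comp \<sigma> 0 r [c])"
      by (simp add: sublist_length_le)
    then have "m \<le> r"
      using M[of r c] w r by linarith
    obtain p q where "hat (seq_comp \<sigma> 0 m) (seq_comp \<sigma> m r [c]) = p @ w @ q"
      using r comp_comp_letter[of 0 m r c] \<open>m \<le> r\<close> by (auto simp: sublist_def)
    moreover have sub: "set (seq_comp \<sigma> m r [c]) \<subseteq> A m"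
      using comp_letter r \<open>m \<le> r\<close> by auto
    ultimately obtain b s t where b: "b \<in> set (seq_comp \<sigma> m r [c])"
      "w = s @ seq_comp \<sigma> 0 m [b] @ t" "s \<noteq> []" "t \<noteq> []"
      using hat_factor_letter[of "seq_comp \<sigma> 0 m" _ p w q M] M[of m] w by fastforce
    moreover obtain s' t' where "seq_comp \<sigma> 0 m [b] = s' @ x @ t'"
      using m[of b] b(1) sub by (auto simp: sublist_def)
    ultimately have "w = (s @ s') @ x @ (t' @ t) \<and> s @ s' \<noteq> [] \<and> t' @ t \<noteq> []"
      by simp
    then show "\<exists>s t. w = s @ x @ t \<and> s \<noteq> [] \<and> t \<noteq> []" by blast
  qed
qed

text \<open>A long word of the language is cut in two; \<open>x\<close> is found in the first part,
  \<open>y\<close> in the second, and what lies between them is the connecting word.\<close>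

lemma lang_two:
  assumes "x \<in> L" "y \<in> L"
  shows "\<exists>t. t \<noteq> [] \<and> x @ t @ y \<in> L"
proof -
  obtain K1 where K1: "\<And>w. w \<in> L \<Longrightarrow> K1 \<le> length w \<Longrightarrow> \<exists>s t. w = s @ x @ t \<and> s \<noteq> [] \<and> t \<noteq> []"
    using lang_uniformly_recurrent[OF assms(1)] by blast
  obtain K2 where K2: "\<And>w. w \<in> L \<Longrightarrow> K2 \<le> length w \<Longrightarrow> \<exists>s t. w = s @ y @ t \<and> s \<noteq> [] \<and> t \<noteq> []"
    using lang_uniformly_recurrent[OF assms(2)] by blast
  \<comment> \<open>The successors keep both parts nonempty, so that they belong to
    \<open>L\<close>.\<close>
  obtain w where w: "w \<in> L" "Suc K1 + Suc K2 \<le> length w"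
    using lang_unbounded by blast
  have d: "drop (Suc K1) w \<in> L"
    by (rule lang_factor[OF w(1), of "take (Suc K1) w" _ "[]"]) (use w(2) in auto)
  have t: "take (Suc K1) w \<in> L"
    by (rule lang_factor[OF w(1), of "[]" _ "drop (Suc K1) w"]) (use w(2) in auto)
  obtain s1 t1 where 1: "take (Suc K1) w = s1 @ x @ t1" "t1 \<noteq> []"
    using K1[OF t] w by auto
  obtain s2 t2 where 2: "drop (Suc K1) w = s2 @ y @ t2"
    using K2[OF d] w by fastforce
  have "w = s1 @ (x @ (t1 @ s2) @ y) @ t2"
    using append_take_drop_id[of "Suc K1" w] unfolding 1 2 by simp
  from lang_factor[OF w(1) this] 1 show ?thesis
    by (intro exI[of _ "t1 @ s2"]) auto
qed

section \<open>Languages of the higher levels\<close>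

lemma shift_primitive_sequence: "primitive_sequence (seq_shift k A) (seq_shift k \<sigma>)"
proof
  show "directive_sequence (seq_shift k A) (seq_shift k \<sigma>)"
    using dir by (auto simp: directive_sequence_def seq_shift_def)
  show "primitive (seq_shift k A) (seq_shift k \<sigma>)"
    unfolding primitive_def
  proof
    fix n
    obtain m where "m > n + k" "positive (A m) (A (n + k)) (seq_comp \<sigma> (n + k) m)"
      using prim by (auto simp: primitive_def)
    then show "\<exists>m>n. positive (seq_shift k A m) (seq_shift k A n) (seq_comp (seq_shift k \<sigma>) n m)"
      by (intro exI[of _ "m - k"]) (auto simp: seq_comp_shift, auto simp: seq_shift_def)
  qed
qed

abbreviation L_at :: "nat \<Rightarrow> 'a list set" where "L_at k \<equiv> seq_lang (seq_shift k A) (seq_shift k \<sigma>)"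

lemma letter_L_at: "k \<le> r \<Longrightarrow> a \<in> A r \<Longrightarrow> seq_comp \<sigma> k r [a] \<in> L_at k"
  using primitive_sequence.comp_letter_lang[OF shift_primitive_sequence, of a k "r - k"]
  by (simp add: seq_comp_shift) (simp add: seq_shift_def)

lemma L_at_words: "L_at k \<subseteq> words (A k)"
  using primitive_sequence.lang_words[OF shift_primitive_sequence, of k] by (simp add: seq_shift_def)

lemma hat_L_at:
  assumes "b \<in> L_at k"
  shows "hat (seq_comp \<sigma> 0 k) b \<in> L"
proof -
  obtain n a where *: "b \<noteq> []" "a \<in> A (n + k)" "sublist b (seq_comp \<sigma> k (n + k) [a])"
    using assms primitive_sequence.lang_iff[OF shift_primitive_sequence, of b k]
    by (auto simp: seq_comp_shift) (auto simp: seq_shift_def)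
  then obtain p q where "seq_comp \<sigma> k (n + k) [a] = p @ b @ q"
    by (auto simp: sublist_def)
  then have "seq_comp \<sigma> 0 (n + k) [a] =
      hat (seq_comp \<sigma> 0 k) p @ hat (seq_comp \<sigma> 0 k) b @ hat (seq_comp \<sigma> 0 k) q"
    using comp_comp_letter[of 0 k "n + k" a] * by simp
  moreover have "length b \<le> length (hat (seq_comp \<sigma> 0 k) b)"
    using subsetD[OF L_at_words assms] comp_letter(1)[of 0 k] by (intro length_hat_ge) (auto simp: words_iff)
  ultimately show ?thesis
    using lang_factor[OF comp_letter_lang[OF *(2)], of "hat (seq_comp \<sigma> 0 k) p" "hat (seq_comp \<sigma> 0 k) b"] *(1)
    by (cases "hat (seq_comp \<sigma> 0 k) b = []") auto
qed

end

section \<open>Synchronizing words\<close>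

text \<open>The interface to the topological part, where \<open>u m\<close> and \<open>v m\<close>
  are suffixes and prefixes of an idempotent. Equal lengths ensure that if a word starting with
  \<open>v m\<close> is cut after an occurrence of \<open>u m\<close>, the left part still starts
  with \<open>v m\<close>; symmetrically on the right.\<close>

locale synchronizing_sequence = primitive_sequence +
  fixes u v :: "nat \<Rightarrow> 'a list"
  assumes enc: "encoding A \<sigma>"
    and uv_ne: "u m \<noteq> []" "v m \<noteq> []"
    and uv_length: "length (u m) = length (v m)"
    and uv_lang: "u m @ v m \<in> L"
    and u_suffix: "m \<le> m' \<Longrightarrow> suffix (u m) (u m')"
    and v_prefix: "m \<le> m' \<Longrightarrow> prefix (v m) (v m')"
    and sync: "\<exists>m. \<forall>w\<in>L. prefix (v m) w \<longrightarrow> suffix (u m) w \<longrightarrow> w \<in> seq_comp \<sigma> 0 n ` words (A n)"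
begin

lemma hat_inj:
  assumes "hat (seq_comp \<sigma> 0 n) x = hat (seq_comp \<sigma> 0 n) y" "set x \<subseteq> A n" "set y \<subseteq> A n"
  shows "x = y"
proof -
  have l: "length w \<le> length (hat (seq_comp \<sigma> 0 n) w)" if "set w \<subseteq> A n" for w
    using that comp_letter(1)[of 0 n] by (intro length_hat_ge) auto
  show ?thesis
  proof (cases "x = [] \<or> y = []")
    case True
    then show ?thesis using l[of x] l[of y] assms by auto
  next
    case False
    then have "x \<in> words (A n)" "y \<in> words (A n)"
      using assms by (auto simp: words_iff)
    then show ?thesis
      using inj_onD[OF encoding_inj_seq_comp[OF dir enc, of 0 n]] assms(1) comp_hat[of 0 n] by simp
  qed
qed

lemma sync_hat:
  obtains m where "\<And>w. w \<in> L \<Longrightarrow> prefix (v m) w \<Longrightarrow> suffix (u m) w \<Longrightarrow>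
    \<exists>g. g \<noteq> [] \<and> set g \<subseteq> A n \<and> w = hat (seq_comp \<sigma> 0 n) g"
proof -
  obtain m where m: "\<And>w. w \<in> L \<Longrightarrow> prefix (v m) w \<Longrightarrow> suffix (u m) w \<Longrightarrow> w \<in> seq_comp \<sigma> 0 n ` words (A n)"
    using sync by blast
  show ?thesis
  proof (rule that[of m])
    fix w assume "w \<in> L" "prefix (v m) w" "suffix (u m) w"
    from m[OF this] show "\<exists>g. g \<noteq> [] \<and> set g \<subseteq> A n \<and> w = hat (seq_comp \<sigma> 0 n) g"
      using comp_hat[of 0 n] by (auto simp: words_iff)
  qed
qed

text \<open>A word \<open>w\<close> synchronized for level \<open>r\<close> starts with a block
  \<open>seq_comp \<sigma> 0 r [a]\<close>, which contains \<open>u m @ v m\<close>. The two parts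
  of \<open>w\<close> around this occurrence are synchronized for level \<open>n\<close>; together
  they have the same image as the word of level \<open>n\<close> obtained from \<open>g\<close>, so
  injectivity turns the occurrence into a cut.\<close>

lemma aligned_occurrence:
  assumes sy: "\<And>w. w \<in> L \<Longrightarrow> prefix (v m) w \<Longrightarrow> suffix (u m) w \<Longrightarrow>
    \<exists>g. g \<noteq> [] \<and> set g \<subseteq> A n \<and> w = hat (seq_comp \<sigma> 0 n) g"
  shows "\<exists>b1 b2. b1 @ b2 \<in> L_at n \<and> suffix (u m) (hat (seq_comp \<sigma> 0 n) b1) \<and>
    prefix (v m) (hat (seq_comp \<sigma> 0 n) b2)"
proof -
  let ?\<phi> = "seq_comp \<sigma> 0 n"
  obtain r where r: "r \<ge> n" "\<And>b. b \<in> A r \<Longrightarrow> sublist (u m @ v m) (seq_comp \<sigma> 0 r [b])"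
    using lang_occurs_in_letters[OF uv_lang] by blast
  obtain M0 where M0: "\<And>w. w \<in> L \<Longrightarrow> prefix (v M0) w \<Longrightarrow> suffix (u M0) w \<Longrightarrow>
    \<exists>g. g \<noteq> [] \<and> set g \<subseteq> A r \<and> w = hat (seq_comp \<sigma> 0 r) g"
    using sync_hat by blast
  \<comment> \<open>Words from \<open>v M\<close> to \<open>u M\<close> are synchronized for level
    \<open>r\<close> and also begin with \<open>v m\<close> and end with \<open>u m\<close>.\<close>
  define M where "M = max m M0"
  obtain t where t: "(u M @ v M) @ t @ (u M @ v M) \<in> L"
    using lang_two uv_lang by blast
  define w where "w = v M @ t @ u M"
  have w: "w \<in> L"
    by (rule lang_factor[OF t, of "u M" _ "v M"]) (use uv_ne in \<open>auto simp: w_def\<close>)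
  have M: "prefix (v m) (v M)" "suffix (u m) (u M)" "prefix (v M0) (v M)" "suffix (u M0) (u M)"
    by (simp_all add: v_prefix u_suffix M_def)
  then have wm: "prefix (v m) w" "suffix (u m) w" "prefix (v M0) w" "suffix (u M0) w"
    by (auto simp: w_def intro!: prefix_prefix suffix_appendI)
  then obtain g where g: "g \<noteq> []" "set g \<subseteq> A r" "w = hat (seq_comp \<sigma> 0 r) g"
    using M0[OF w] by blast
  then obtain a g' where ga: "g = a # g'" "a \<in> A r"
    by (cases g) auto
  obtain s t where st: "seq_comp \<sigma> 0 r [a] = s @ u m @ v m @ t"
    using r(2)[OF ga(2)] by (auto simp: sublist_def)
  define w2 where "w2 = v m @ t @ hat (seq_comp \<sigma> 0 r) g'"
  have weq: "w = (s @ u m) @ w2"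
    using g ga st by (simp add: w2_def)
  have w2: "w2 \<noteq> []" "prefix (v m) w2"
    using uv_ne by (auto simp: w2_def prefix_def)
  have "suffix w2 w" "suffix (s @ u m) (s @ u m)" "prefix (s @ u m) w"
    using weq by (auto simp: suffix_def prefix_def)
  then have "suffix (u m) w2" "prefix (v m) (s @ u m)"
    using wm w2_def uv_length suffix_length_suffix[of "u m" w w2] prefix_length_prefix[of "v m" w "s @ u m"]
    by auto
  moreover have "w2 \<in> L"
    using lang_factor[OF w, of "s @ u m" w2 "[]"] weq w2 by simp
  moreover have "s @ u m \<in> L"
    using lang_factor[OF w, of "[]" "s @ u m" w2] weq uv_ne by simp
  ultimately obtain h1 h2 where h: "set h1 \<subseteq> A n" "s @ u m = hat ?\<phi> h1" "set h2 \<subseteq> A n" "w2 = hat ?\<phi> h2"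
    using sy[of "s @ u m"] sy[of w2] w2 by (auto simp: suffix_def)
  let ?a = "seq_comp \<sigma> n r [a]" and ?g = "hat (seq_comp \<sigma> n r) g'"
  have sub: "set ?a \<subseteq> A n" "set ?g \<subseteq> A n"
    using comp_letter(2)[OF r(1)] ga g set_hat[OF comp_hom[OF r(1)], of g'] by auto
  \<comment> \<open>Both sides are the whole of \<open>w\<close>, so injectivity applies although
    the inner cut is not yet known to be common.\<close>
  have "hat ?\<phi> (h1 @ h2) = hat ?\<phi> (?a @ ?g)"
    using h weq g ga comp_comp_letter[of 0 n r a] comp_comp_hat[of 0 n r g'] r by auto
  then have "h1 @ h2 = ?a @ ?g"
    by (rule hat_inj) (use h sub in auto)
  moreover have a: "hat ?\<phi> ?a = s @ u m @ v m @ t"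
    using st comp_comp_letter[of 0 n r a] r ga by simp
  \<comment> \<open>The occurrence lies within the block of \<open>a\<close>, so \<open>h1\<close>
    does not end after \<open>?a\<close>, and the cut stays inside a word known to be in
    \<open>L_at n\<close>.\<close>
  then have "length (hat ?\<phi> h1) \<le> length (hat ?\<phi> ?a)"
    using h(2) by (metis append_assoc length_append le_add1)
  ultimately obtain z where z: "?a = h1 @ z"
    using append_split_if_hat_le[of h1 h2 ?a ?g ?\<phi>] h(1) comp_letter(1)[of 0 n] by auto
  then have "hat ?\<phi> z = v m @ t"
    using a h(2)[symmetric] by simp
  then show ?thesis
    using z letter_L_at[OF r(1) ga(2)] h(2) by (intro exI[of _ h1] exI[of _ z]) (auto simp flip: h(2) simp: suffix_def)
qed

text \<open>\<open>b\<close> is put between two copies of a certified word \<open>b1 @ b2\<close>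
  inside one word of \<open>L_at n\<close>. The stretches from the left certified cut to the given
  occurrence, and from there to the right certified cut, both run from \<open>v m\<close> to
  \<open>u m\<close> and are images. Together they fill the distance between two cuts, where
  injectivity forces agreement with the true factorization.\<close>

lemma all_occurrences_aligned:
  assumes sy: "\<And>w. w \<in> L \<Longrightarrow> prefix (v m) w \<Longrightarrow> suffix (u m) w \<Longrightarrow>
    \<exists>g. g \<noteq> [] \<and> set g \<subseteq> A n \<and> w = hat (seq_comp \<sigma> 0 n) g"
    and b: "b \<in> L_at n" "hat (seq_comp \<sigma> 0 n) b = s @ u m @ v m @ t"
  shows "\<exists>b1 b2. b = b1 @ b2 \<and> hat (seq_comp \<sigma> 0 n) b1 = s @ u m"
proof -
  let ?\<phi> = "seq_comp \<sigma> 0 n"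
  interpret sh: primitive_sequence "seq_shift n A" "seq_shift n \<sigma>"
    by (rule shift_primitive_sequence)
  obtain b1 b2 where g: "b1 @ b2 \<in> L_at n" "suffix (u m) (hat ?\<phi> b1)" "prefix (v m) (hat ?\<phi> b2)"
    using aligned_occurrence[OF sy] by blast
  obtain t1 where t1: "(b1 @ b2) @ t1 @ b \<in> L_at n"
    using sh.lang_two[OF g(1) b(1)] by blast
  obtain t2 where t2: "((b1 @ b2) @ t1 @ b) @ t2 @ (b1 @ b2) \<in> L_at n"
    using sh.lang_two[OF t1 g(1)] by blast
  let ?h = "hat ?\<phi>"
  define l where "l = ?h b2 @ ?h t1 @ s @ u m"
  define r where "r = v m @ t @ ?h t2 @ ?h b1"
  have eq: "?h (((b1 @ b2) @ t1 @ b) @ t2 @ (b1 @ b2)) = ?h b1 @ (l @ r) @ ?h b2"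
    by (simp add: l_def r_def b(2))
  have lr: "?h b1 @ (l @ r) @ ?h b2 \<in> L"
    using hat_L_at[OF t2] unfolding eq .
  have "l \<in> L" "r \<in> L"
    using lang_factor[OF lr, of "?h b1" l "r @ ?h b2"] lang_factor[OF lr, of "?h b1 @ l" r "?h b2"] uv_ne
    by (auto simp: l_def r_def)
  moreover have "prefix (v m) l" "suffix (u m) l" "prefix (v m) r" "suffix (u m) r"
    using g by (auto simp: l_def r_def suffix_def prefix_def)
  ultimately obtain h1 h2 where h: "set h1 \<subseteq> A n" "l = ?h h1" "set h2 \<subseteq> A n" "r = ?h h2"
    using sy by metis
  have sub: "set b1 \<subseteq> A n" "set b2 \<subseteq> A n" "set b \<subseteq> A n" "set t1 \<subseteq> A n" "set t2 \<subseteq> A n"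
    using t2 L_at_words[of n] by (fastforce simp: words_iff)+
  have "?h (h1 @ h2) = ?h ((b2 @ t1) @ b @ t2 @ b1)"
    using h b(2) by (simp add: l_def r_def)
  then have e: "h1 @ h2 = (b2 @ t1) @ b @ t2 @ b1"
    by (rule hat_inj) (use h sub in auto)
  \<comment> \<open>Comparing image lengths twice places the end of \<open>h1\<close> first not
    before the end of \<open>b2 @ t1\<close>, then not beyond \<open>b\<close>.\<close>
  have e': "\<exists>z. h1 = (b2 @ t1) @ z \<and> b @ t2 @ b1 = z @ h2"
    by (rule append_split_if_hat_le[OF e[symmetric], of ?\<phi>])
      (use h(2) sub comp_letter(1)[of 0 n] in \<open>auto simp flip: h(2) simp: l_def\<close>)
  then obtain z where z: "h1 = (b2 @ t1) @ z" "z @ h2 = b @ t2 @ b1"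
    by auto
  have hz: "?h z = s @ u m"
    using h(2) z(1) by (simp add: l_def)
  have "\<exists>y. b = z @ y \<and> h2 = y @ t2 @ b1"
    by (rule append_split_if_hat_le[OF z(2), of ?\<phi>])
      (use hz b(2) z h(1) comp_letter(1)[of 0 n] in auto)
  with hz show ?thesis by blast
qed

end

section \<open>Parsing bi-infinite words\<close>

definition slice :: "(int \<Rightarrow> 'a) \<Rightarrow> int \<Rightarrow> int \<Rightarrow> 'a list" where
  "slice x i j = map x [i..j - 1]"

lemma length_slice [simp]: "length (slice x i j) = nat (j - i)"
  by (simp add: slice_def)

lemma slice_Nil [simp]: "j \<le> i \<Longrightarrow> slice x i j = []"
  by (simp add: slice_def)

lemma slice_append: "i \<le> j \<Longrightarrow> j \<le> k \<Longrightarrow> slice x i j @ slice x j k = slice x i k"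
  using upto_split1[of i j "k - 1"] by (cases "j = k") (auto simp: slice_def simp flip: map_append)

lemma slice_single [simp]: "slice x i (i + 1) = [x i]"
  by (simp add: slice_def)

lemma nth_slice: "int k < j - i \<Longrightarrow> slice x i j ! k = x (i + int k)"
  by (simp add: slice_def)

lemma slice_eq_iff:
  "slice x i j = w \<longleftrightarrow> length w = nat (j - i) \<and> (\<forall>k<length w. x (i + int k) = w ! k)"
  by (auto simp: list_eq_iff_nth_eq nth_slice)

lemma slice_split:
  assumes "slice x i j = v @ w" "i \<le> j"
  shows "slice x i (i + int (length v)) = v" "slice x (i + int (length v)) j = w"
proof -
  have "nat (j - i) = length v + length w"
    using assms(1) length_slice[of x i j] by simp
  then have l: "j = i + int (length v) + int (length w)"
    using assms(2) by simp
  with slice_append[of i "i + int (length v)" j x] assms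
  show "slice x i (i + int (length v)) = v" "slice x (i + int (length v)) j = w"
    by (auto simp: append_eq_append_conv)
qed

text \<open>\<open>c i\<close> is the position in \<open>y\<close> of the first letter of the block \<open>\<phi> (x i)\<close>.\<close>
definition parse :: "('a list \<Rightarrow> 'b list) \<Rightarrow> (int \<Rightarrow> 'a) \<Rightarrow> (int \<Rightarrow> int) \<Rightarrow> (int \<Rightarrow> 'b) \<Rightarrow> bool" where
  "parse \<phi> x c y \<longleftrightarrow> (\<forall>i. c i < c (i + 1) \<and> slice y (c i) (c (i + 1)) = \<phi> [x i])"

lemma parse_mono:
  assumes "parse \<phi> x c y" "i \<le> j"
  shows "c i + (j - i) \<le> c j"
  using assms(2)
proof (induction j rule: int_ge_induct)
  case (step j)
  moreover have "c j < c (j + 1)"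
    using assms(1) by (auto simp: parse_def)
  ultimately show ?case by linarith
qed simp

lemma parse_less_iff:
  assumes "parse \<phi> x c y"
  shows "c i < c j \<longleftrightarrow> i < j"
  using parse_mono[OF assms, of i j] parse_mono[OF assms, of j i] by linarith

lemma parse_slice:
  assumes "parse \<phi> x c y" "i \<le> j"
  shows "slice y (c i) (c j) = hat \<phi> (slice x i j)"
  using assms(2)
proof (induction j rule: int_ge_induct)
  case (step j)
  have "c i \<le> c j" "c j < c (j + 1)" "slice y (c j) (c (j + 1)) = \<phi> [x j]"
    using parse_mono[OF assms(1) step(1)] step(1) assms(1) by (auto simp: parse_def)
  then have "slice y (c i) (c (j + 1)) = hat \<phi> (slice x i j) @ \<phi> [x j]"
    using step slice_append[of "c i" "c j" "c (j + 1)" y] by simp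
  also have "\<dots> = hat \<phi> (slice x i (j + 1))"
    using slice_append[of i j "j + 1" x] step by (metis hat_simps(1-3) append_Nil2 slice_single zle_add1_eq_le order.refl less_imp_le)
  finally show ?case .
qed simp

lemma parse_length:
  assumes "parse \<phi> x c y" "i \<le> j"
  shows "c j = c i + int (length (hat \<phi> (slice x i j)))"
  using parse_mono[OF assms] assms(2) arg_cong[OF parse_slice[OF assms], of length] by simp

lemma parse_unbounded:
  assumes "parse \<phi> x c y"
  shows "\<exists>i. c i \<le> p" "\<exists>i. p \<le> c i"
proof -
  show "\<exists>i. c i \<le> p"
    using parse_mono[OF assms, of "- \<bar>c 0 - p\<bar>" 0] by (intro exI[of _ "- \<bar>c 0 - p\<bar>"]) linarith
  show "\<exists>i. p \<le> c i"
    using parse_mono[OF assms, of 0 "\<bar>c 0 - p\<bar>"] by (intro exI[of _ "\<bar>c 0 - p\<bar>"]) linarith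
qed

text \<open>\<open>d\<close> sends boundaries in \<open>y\<close> to boundaries in \<open>z\<close>,
  so the coarse boundaries in \<open>z\<close> are the \<open>d (c i)\<close>.\<close>

lemma parse_comp:
  assumes "parse \<phi> x c y" "parse \<psi> y d z" "\<And>i. \<theta> [x i] = hat \<psi> (\<phi> [x i])"
  shows "parse \<theta> x (\<lambda>i. d (c i)) z"
  unfolding parse_def
proof (intro allI conjI)
  fix i
  have *: "c i < c (i + 1)" "slice y (c i) (c (i + 1)) = \<phi> [x i]"
    using assms(1) by (auto simp: parse_def)
  then show "d (c i) < d (c (i + 1))"
    using parse_less_iff[OF assms(2)] by simp
  show "slice z (d (c i)) (d (c (i + 1))) = \<theta> [x i]"
    using parse_slice[OF assms(2), of "c i" "c (i + 1)"] * assms(3) by simp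
qed

lemma shift_funpow: "(shift ^^ k) y = (\<lambda>i. y (i + int k))"
  by (induction k) (auto simp: shift_def algebra_simps)

lemma parse_shift:
  assumes "parse \<phi> x c y"
  shows "parse \<phi> x (\<lambda>i. c i - int k) ((shift ^^ k) y)"
proof -
  have "slice (\<lambda>i. y (i + int k)) (a - int k) (b - int k) = slice y a b" for a b
    by (auto simp: slice_eq_iff nth_slice algebra_simps)
  then show ?thesis
    using assms by (auto simp: parse_def shift_funpow)
qed

text \<open>Replaces the letterwise formula of \<open>bi_image\<close> by block boundaries, the form
  used from here on. Boundaries are image lengths counted from the origin, negative to the
  left.\<close>

lemma parse_bi_image:
  assumes hom: "\<phi> \<in> sgp_hom (free_sgp A) (free_sgp B)" and x: "range x \<subseteq> A"
  shows "\<exists>c. c 0 = 0 \<and> parse \<phi> x c (bi_image \<phi> x)"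
proof -
  define h where "h i j = hat \<phi> (slice x i j)" for i j
  define c where "c i = (if 0 \<le> i then int (length (h 0 i)) else - int (length (h i 0)))" for i
  have xs: "set (slice x i j) \<subseteq> A" for i j
    using x by (auto simp: slice_def)
  have ge: "nat (j - i) \<le> length (h i j)" for i j
    using length_hat_ge[of "slice x i j" \<phi>] xs[of i j] free_hom_letter(1)[OF hom] by (auto simp: h_def)
  have app: "h i k = h i j @ h j k" if "i \<le> j" "j \<le> k" for i j k
    using slice_append[OF that, of x] by (metis h_def hat_simps(3))
  have h1: "h i (i + 1) = \<phi> [x i]" for i
    by (simp add: h_def)
  have \<phi>h: "\<phi> (slice x i j) = h i j" if "i < j" for i j
    unfolding h_def by (rule free_hom_hat[OF hom]) (use that xs in \<open>auto simp: words_iff simp flip: length_0_conv\<close>)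
  have ne: "\<phi> [x i] \<noteq> []" for i
    using free_hom_letter(1)[OF hom] x by auto
  have cS: "c (i + 1) = c i + int (length (\<phi> [x i]))" for i
  proof (cases "0 \<le> i")
    case True
    then show ?thesis using app[of 0 i "i + 1"] by (simp add: c_def h1)
  next
    case False
    then show ?thesis
      using app[of i "i + 1" 0] h1[of i] by (cases "i = -1") (auto simp: c_def h_def)
  qed
  have img: "bi_image \<phi> x (c i + int k) = \<phi> [x i] ! k" if k: "k < length (\<phi> [x i])" for i k
  proof (cases "0 \<le> i")
    case True
    define n where "n = c i + int k"
    have n: "i \<le> n" "0 \<le> n"
      using ge[of i 0] True by (auto simp: n_def c_def)
    have "\<phi> (map x [0..n]) = h 0 (n + 1)"
      using \<phi>h[of 0 "n + 1"] n by (simp add: slice_def)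
    also have "\<dots> = h 0 i @ \<phi> [x i] @ h (i + 1) (n + 1)"
      using app[of 0 i "n + 1"] app[of i "i + 1" "n + 1"] n True by (simp add: h1)
    finally show ?thesis
      using n k True by (simp add: bi_image_def flip: n_def) (simp add: n_def c_def nth_append nat_add_distrib)
  next
    case False
    define n where "n = c i + int k"
    have "n < c (i + 1)"
      using k by (simp add: cS n_def)
    \<comment> \<open>Blocks are nonempty, so left of the origin a boundary is at most its index;
      hence the segment of \<open>x\<close> used for position \<open>n\<close> reaches back to block
      \<open>i\<close>.\<close>
    moreover have "c (i + 1) \<le> i + 1"
      using ge[of 0 "i + 1"] False by (auto simp: c_def h_def)
    ultimately have n: "n \<le> i" "n < 0"
      using False by auto
    have "\<phi> (map x [n..-1]) = h n 0"
      using \<phi>h[of n 0] n by (simp add: slice_def)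
    also have hn: "h n 0 = h n i @ h i 0"
      using app[of n i 0] n False by simp
    finally have e: "\<phi> (map x [n..-1]) = h n i @ h i 0" .
    have hi: "h i 0 = \<phi> [x i] @ h (i + 1) 0"
      using app[of i "i + 1" 0] False by (simp add: h1)
    have ci: "c i = - int (length (h i 0))"
      using False by (simp add: c_def)
    have l: "nat (- n - 1) < length (h i 0)" "length (h i 0) - Suc (nat (- n - 1)) = k"
      using n k by (auto simp: n_def ci)
    \<comment> \<open>\<open>bi_image\<close> counts from the right end here, so the surplus
      \<open>h n i\<close> on the left is harmless.\<close>
    have "rev (h n i @ h i 0) ! nat (- n - 1) = h i 0 ! k"
      using l by (simp add: nth_append rev_nth)
    also have "\<dots> = \<phi> [x i] ! k"
      using k by (simp add: hi nth_append)
    finally show ?thesis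
      using n e by (simp add: bi_image_def flip: n_def)
  qed
  have "parse \<phi> x c (bi_image \<phi> x)"
    unfolding parse_def using cS ne img by (auto simp: slice_eq_iff)
  moreover have "c 0 = 0"
    by (simp add: c_def h_def)
  ultimately show ?thesis by blast
qed

lemma parse_range:
  assumes "parse \<phi> x c y" "range x \<subseteq> A" "\<phi> \<in> sgp_hom (free_sgp A) (free_sgp B)"
  shows "range y \<subseteq> B"
proof
  fix b assume "b \<in> range y"
  then obtain p where p: "b = y p" by blast
  obtain i j where ij: "c i \<le> p" "p + 1 \<le> c j"
    using parse_unbounded[OF assms(1)] by metis
  then have "i \<le> j"
    using parse_less_iff[OF assms(1), of i j] by linarith
  then have "set (slice y (c i) (c j)) \<subseteq> B"
    using parse_slice[OF assms(1), of i j] set_hat[OF assms(3), of "slice x i j"] subset_trans[OF _ assms(2)]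
    by (auto simp: slice_def)
  then show "b \<in> B"
    using ij p by (auto simp: slice_def)
qed

section \<open>Synchronization implies recognizability\<close>

context synchronizing_sequence
begin

text \<open>Each occurrence of \<open>u m @ v m\<close> in \<open>y\<close> has its centre at a
  boundary of both parsings, and such occurrences recur in both directions; between two of them
  injectivity makes the parsings equal.\<close>

lemma parse_unique:
  assumes x: "\<And>i j. i < j \<Longrightarrow> slice x i j \<in> L_at n" "\<And>i j. i < j \<Longrightarrow> slice x' i j \<in> L_at n"
    and p: "parse (seq_comp \<sigma> 0 n) x c y" "parse (seq_comp \<sigma> 0 n) x' c' y"
  shows "\<exists>k. \<forall>i. c' i = c (i + k) \<and> x' i = x (i + k)"
proof -
  let ?\<phi> = "seq_comp \<sigma> 0 n"
  interpret sh: primitive_sequence "seq_shift n A" "seq_shift n \<sigma>"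
    by (rule shift_primitive_sequence)
  obtain m where sy: "\<And>w. w \<in> L \<Longrightarrow> prefix (v m) w \<Longrightarrow> suffix (u m) w \<Longrightarrow>
    \<exists>g. g \<noteq> [] \<and> set g \<subseteq> A n \<and> w = hat ?\<phi> g"
    using sync_hat by blast
  define P where "P q \<longleftrightarrow> slice y (q - int (length (u m))) (q + int (length (v m))) = u m @ v m" for q
  have P_cut: "q \<in> range c" if "P q" "\<And>i j. i < j \<Longrightarrow> slice x i j \<in> L_at n" "parse ?\<phi> x c y" for q c x
  proof -
    note pc = that(3) and pL = that(2) and pP = that(1)
    obtain i j where ij: "c i \<le> q - int (length (u m))" "q + int (length (v m)) \<le> c j"
      using parse_unbounded[OF pc] by metis
    moreover have "0 < length (u m)"
      using uv_ne(1)[of m] by simp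
    ultimately have "c i < c j"
      by linarith
    then have "i < j"
      using parse_less_iff[OF pc] by blast
    let ?s = "slice y (c i) (q - int (length (u m)))" and ?t = "slice y (q + int (length (v m))) (c j)"
    have "hat ?\<phi> (slice x i j) = slice y (c i) (c j)"
      using parse_slice[OF pc, of i j] \<open>i < j\<close> by simp
    also have "\<dots> = ?s @ slice y (q - int (length (u m))) (q + int (length (v m))) @ ?t"
      using ij by (simp add: slice_append)
    finally have "hat ?\<phi> (slice x i j) = ?s @ u m @ v m @ ?t"
      using pP by (simp add: P_def)
    then obtain b1 b2 where b: "slice x i j = b1 @ b2" "hat ?\<phi> b1 = ?s @ u m"
      using all_occurrences_aligned[OF sy pL[OF \<open>i < j\<close>]] by blast
    have "slice x i (i + int (length b1)) = b1"
      using slice_split[OF b(1)] \<open>i < j\<close> by simp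
    then have "c (i + int (length b1)) = c i + int (length (?s @ u m))"
      using parse_length[OF pc, of i "i + int (length b1)"] b(2) by simp
    also have "\<dots> = q"
      using ij by simp
    finally show ?thesis by blast
  qed
  have P_ex: "\<exists>q. P q \<and> c a \<le> q \<and> q \<le> c (a + int K)"
    if K: "\<And>w. w \<in> L_at n \<Longrightarrow> K \<le> length w \<Longrightarrow> \<exists>s b t. w = s @ b @ t \<and> sublist (u m @ v m) (hat ?\<phi> b)"
      and "0 < K" for a K
  proof -
    have "slice x a (a + int K) \<in> L_at n"
      using x(1) \<open>0 < K\<close> by simp
    then obtain s b t where sbt: "slice x a (a + int K) = s @ b @ t" "sublist (u m @ v m) (hat ?\<phi> b)"
      using K[of "slice x a (a + int K)"] by auto
    then obtain s' t' where b: "hat ?\<phi> b = s' @ (u m @ v m) @ t'"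
      by (auto simp: sublist_def)
    have "slice y (c a) (c (a + int K)) = (hat ?\<phi> s @ s') @ (u m @ v m) @ (t' @ hat ?\<phi> t)"
      using parse_slice[OF p(1), of a "a + int K"] sbt b by simp
    moreover have le: "c a \<le> c (a + int K)"
      using parse_mono[OF p(1), of a "a + int K"] by simp
    ultimately have 1: "slice y (c a + int (length (hat ?\<phi> s @ s'))) (c (a + int K)) = (u m @ v m) @ (t' @ hat ?\<phi> t)"
      by (rule slice_split)
    define q0 where "q0 = c a + int (length (hat ?\<phi> s @ s'))"
    have "length ((u m @ v m) @ (t' @ hat ?\<phi> t)) = nat (c (a + int K) - q0)"
      using 1 length_slice unfolding q0_def by metis
    then have 3: "q0 + int (length (u m @ v m)) \<le> c (a + int K)"
      using uv_ne(1)[of m] by (simp only: length_append) (cases "u m"; simp)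
    then have 2: "slice y q0 (q0 + int (length (u m @ v m))) = u m @ v m"
      using slice_split(1)[OF 1[folded q0_def]] by simp
    have "c a \<le> q0" by (simp add: q0_def)
    then show ?thesis
      using 2 3 by (intro exI[of _ "q0 + int (length (u m))"]) (auto simp: P_def ac_simps)
  qed
  obtain b1 b2 where b: "b1 @ b2 \<in> L_at n" "suffix (u m) (hat ?\<phi> b1)" "prefix (v m) (hat ?\<phi> b2)"
    using aligned_occurrence[OF sy] by blast
  obtain K where K: "\<And>w. w \<in> L_at n \<Longrightarrow> K \<le> length w \<Longrightarrow> \<exists>s t. w = s @ (b1 @ b2) @ t \<and> s \<noteq> [] \<and> t \<noteq> []"
    using sh.lang_uniformly_recurrent[OF b(1)] by blast
  obtain z1 z2 where "hat ?\<phi> b1 = z1 @ u m" "hat ?\<phi> b2 = v m @ z2"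
    using b(2,3) by (auto simp: suffix_def prefix_def)
  then have "hat ?\<phi> (b1 @ b2) = z1 @ (u m @ v m) @ z2"
    by simp
  then have "sublist (u m @ v m) (hat ?\<phi> (b1 @ b2))"
    by (simp only: sublist_appendI)
  then have K': "\<And>w. w \<in> L_at n \<Longrightarrow> Suc K \<le> length w \<Longrightarrow>
      \<exists>s b t. w = s @ b @ t \<and> sublist (u m @ v m) (hat ?\<phi> b)"
    using K by (meson Suc_leD)
  have PK: "\<exists>q. P q \<and> c a \<le> q \<and> q \<le> c (a + int (Suc K))" for a
    by (rule P_ex) (use K' in auto)
  have P_right: "\<exists>q\<ge>r. P q" and P_left: "\<exists>q\<le>r. P q" for r
  proof -
    obtain a where "r \<le> c a" using parse_unbounded[OF p(1)] by blast
    then show "\<exists>q\<ge>r. P q" using PK[of a] by (meson order_trans)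
    obtain a' where "c a' \<le> r" using parse_unbounded[OF p(1)] by blast
    moreover obtain q where "P q" "q \<le> c (a' - int (Suc K) + int (Suc K))"
      using PK by blast
    ultimately show "\<exists>q\<le>r. P q"
      by (intro exI[of _ q]) simp
  qed
  have xA: "set (slice x i j) \<subseteq> A n" "set (slice x' i j) \<subseteq> A n" for i j
    using x[of i j] L_at_words[of n] by (cases "i < j"; force simp: words_iff)+
  \<comment> \<open>Two common boundaries enclose the same word over \<open>A n\<close> by
    injectivity, so the parsings agree block by block in between.\<close>
  have sync_len: "c' (i' + int k) = c (i + int k) \<and> (k > 0 \<longrightarrow> x' i' = x i)"
    if "c i = c' i'" "c j = c' j'" "i + int k \<le> j" for i i' j j' k
  proof -
    have le: "i \<le> j" "i' \<le> j'"
      using that parse_less_iff[OF p(1), of j i] parse_less_iff[OF p(2), of j' i'] by auto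
    have "hat ?\<phi> (slice x i j) = hat ?\<phi> (slice x' i' j')"
      using parse_slice[OF p(1) le(1)] parse_slice[OF p(2) le(2)] that by simp
    then have eq: "slice x i j = slice x' i' j'"
      by (rule hat_inj) (use xA in auto)
    then have "nat (j - i) = nat (j' - i')"
      by (metis length_slice)
    then have l: "j - i = j' - i'"
      using le by simp
    have eq': "slice x i (i + int k) = slice x' i' (i' + int k)"
      using eq l that(3) by (auto simp: slice_eq_iff nth_slice)
    then have "c' (i' + int k) = c (i + int k)"
      using parse_length[OF p(1), of i "i + int k"] parse_length[OF p(2), of i' "i' + int k"] that by simp
    moreover have "x' i' = x i" if "k > 0"
      using that arg_cong[OF eq', of "\<lambda>w. w ! 0"] nth_slice[of 0 "i + int k" i x] nth_slice[of 0 "i' + int k" i' x'] by simp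
    ultimately show ?thesis by simp
  qed
  obtain q0 where q0: "P q0" using P_right by blast
  obtain i0 i0' where i0: "c i0 = q0" "c' i0' = q0"
    using P_cut[OF q0 x(1) p(1)] P_cut[OF q0 x(2) p(2)] by auto
  \<comment> \<open>The index offset is the same at all these common boundaries, since both parsings
    have equally many blocks between two of them; the mark \<open>q0\<close> fixes it.\<close>
  have common: "\<exists>i i'. i \<le> j \<and> c i = c' i' \<and> i - i' = i0 - i0'"
    "\<exists>i i'. j \<le> i \<and> c i = c' i' \<and> i - i' = i0 - i0'" for j
  proof -
    obtain q where q: "q \<le> min (c j) (c i0)" "P q" using P_left by blast
    obtain i i' where i: "c i = q" "c' i' = q"
      using P_cut[OF q(2) x(1) p(1)] P_cut[OF q(2) x(2) p(2)] by auto
    have "i \<le> j" "i \<le> i0"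
      using parse_less_iff[OF p(1), of j i] parse_less_iff[OF p(1), of i0 i] q i by linarith+
    have "c' (i' + int (nat (i0 - i))) = c (i + int (nat (i0 - i)))"
      using sync_len[of i i' i0 i0' "nat (i0 - i)"] i i0 \<open>i \<le> i0\<close> by simp
    then have "c' (i' + (i0 - i)) = c' i0'"
      using \<open>i \<le> i0\<close> i0 by simp
    then have "i' + (i0 - i) = i0'"
      using parse_less_iff[OF p(2), of "i' + (i0 - i)" i0'] parse_less_iff[OF p(2), of i0' "i' + (i0 - i)"] by linarith
    then show "\<exists>i i'. i \<le> j \<and> c i = c' i' \<and> i - i' = i0 - i0'"
      using \<open>i \<le> j\<close> i by (intro exI[of _ i] exI[of _ i']) auto
  next
    obtain q where q: "q \<ge> max (c j) (c i0)" "P q" using P_right by blast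
    obtain i i' where i: "c i = q" "c' i' = q"
      using P_cut[OF q(2) x(1) p(1)] P_cut[OF q(2) x(2) p(2)] by auto
    have "j \<le> i" "i0 \<le> i"
      using parse_less_iff[OF p(1), of i j] parse_less_iff[OF p(1), of i i0] q i by linarith+
    have "c' (i0' + int (nat (i - i0))) = c (i0 + int (nat (i - i0)))"
      using sync_len[of i0 i0' i i' "nat (i - i0)"] i i0 \<open>i0 \<le> i\<close> by simp
    then have "c' (i0' + (i - i0)) = c' i'"
      using \<open>i0 \<le> i\<close> i by simp
    then have "i0' + (i - i0) = i'"
      using parse_less_iff[OF p(2), of "i0' + (i - i0)" i'] parse_less_iff[OF p(2), of i' "i0' + (i - i0)"] by linarith
    then show "\<exists>i i'. j \<le> i \<and> c i = c' i' \<and> i - i' = i0 - i0'"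
      using \<open>j \<le> i\<close> i by (intro exI[of _ i] exI[of _ i']) auto
  qed
  have "c' i = c (i + (i0 - i0')) \<and> x' i = x (i + (i0 - i0'))" for i
  proof -
    define j where "j = i + (i0 - i0')"
    obtain a a' where a: "a \<le> j" "c a = c' a'" "a - a' = i0 - i0'"
      using common by blast
    obtain b b' where b: "j + 1 \<le> b" "c b = c' b'" "b - b' = i0 - i0'"
      using common by blast
    have "c' (a' + int (nat (j - a))) = c (a + int (nat (j - a)))"
      using sync_len[of a a' b b' "nat (j - a)"] a b by simp
    moreover have "a + int (nat (j - a)) = j" "a' + int (nat (j - a)) = i"
      using a by (auto simp: j_def)
    ultimately have "c' i = c j"
      by (simp only:)
    moreover have "x' i = x j"
      using sync_len[of j i b b' 1] b \<open>c' i = c j\<close> by (simp add: j_def)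
    ultimately show ?thesis by (simp add: j_def)
  qed
  then show ?thesis by blast
qed

lemma recognizable: "recognizable A \<sigma>"
  unfolding recognizable_def level_recognizable_def recognizable_in_def
proof (intro allI impI, elim conjE)
  fix n y k x k' x'
  let ?X = "seq_space (seq_shift (n + 1) A) (seq_shift (n + 1) \<sigma>)"
  assume x: "x \<in> ?X" "k < length (\<sigma> n [x 0])" "(shift ^^ k) (bi_image (\<sigma> n) x) = y"
    and x': "x' \<in> ?X" "k' < length (\<sigma> n [x' 0])" "(shift ^^ k') (bi_image (\<sigma> n) x') = y"
  have X: "range x \<subseteq> A (Suc n)" "\<And>i j. i < j \<Longrightarrow> slice x i j \<in> L_at (Suc n)" if "x \<in> ?X" for x :: "int \<Rightarrow> 'a"
    using that by (auto simp: seq_space_def slice_def seq_shift_def)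
  have hom: "\<sigma> n \<in> sgp_hom (free_sgp (A (Suc n))) (free_sgp (A n))"
    using dir by (auto simp: directive_sequence_def)
  have pos: "\<exists>c. c 0 = - int k \<and> 0 < c 1 \<and> parse (\<sigma> n) x c y"
    if "x \<in> ?X" "k < length (\<sigma> n [x 0])" "(shift ^^ k) (bi_image (\<sigma> n) x) = y"
    for k and x :: "int \<Rightarrow> 'a"
  proof -
    note z = that
    obtain c where c: "c 0 = 0" "parse (\<sigma> n) x c (bi_image (\<sigma> n) x)"
      using parse_bi_image[OF hom X(1)[OF z(1)]] by blast
    have "c 1 = int (length (\<sigma> n [x 0]))"
      using parse_length[OF c(2), of 0 1] c(1) slice_single[of x 0] by simp
    then show ?thesis
      using parse_shift[OF c(2), of k] c(1) that by (intro exI[of _ "\<lambda>i. c i - int k"]) auto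
  qed
  obtain c where c: "c 0 = - int k" "0 < c 1" "parse (\<sigma> n) x c y"
    using pos[OF x] by blast
  obtain c' where c': "c' 0 = - int k'" "0 < c' 1" "parse (\<sigma> n) x' c' y"
    using pos[OF x'] by blast
  have "range y \<subseteq> A n"
    using parse_range[OF c(3) X(1)[OF x(1)] hom] .
  then obtain d where d: "parse (seq_comp \<sigma> 0 n) y d (bi_image (seq_comp \<sigma> 0 n) y)"
    using parse_bi_image[OF comp_hom[of 0 n]] by blast
  have \<theta>: "seq_comp \<sigma> 0 (Suc n) [z i] = hat (seq_comp \<sigma> 0 n) (\<sigma> n [z i])" if "range z \<subseteq> A (Suc n)" for z i
    using comp_comp_letter[of 0 n "Suc n" "z i"] that seq_comp_Suc[of n n \<sigma>] by auto
  have "parse (seq_comp \<sigma> 0 (Suc n)) x (\<lambda>i. d (c i)) (bi_image (seq_comp \<sigma> 0 n) y)"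
    "parse (seq_comp \<sigma> 0 (Suc n)) x' (\<lambda>i. d (c' i)) (bi_image (seq_comp \<sigma> 0 n) y)"
    by (rule parse_comp[OF c(3) d \<theta>[OF X(1)[OF x(1)]]], rule parse_comp[OF c'(3) d \<theta>[OF X(1)[OF x'(1)]]])
  from parse_unique[OF X(2)[OF x(1)] X(2)[OF x'(1)] this]
  obtain j where j: "\<And>i. d (c' i) = d (c (i + j))" "\<And>i. x' i = x (i + j)"
    by blast
  have cc: "c' i = c (i + j)" for i
    using j(1)[of i] parse_less_iff[OF d, of "c' i" "c (i + j)"] parse_less_iff[OF d, of "c (i + j)" "c' i"]
    by linarith
  \<comment> \<open>In both parsings the origin lies in block 0, by the bounds on \<open>k\<close>
    and \<open>k'\<close>; this pins the shift \<open>j\<close> to 0.\<close>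
  have "c j < c 1" "c 0 < c (1 + j)"
    using cc[of 0] cc[of 1] c c' by auto
  then have "j = 0"
    using parse_less_iff[OF c(3)] by auto
  then show "k = k' \<and> x = x'"
    using cc[of 0] c c' j(2) by auto
qed

end

section \<open>Ultrafilters\<close>

definition is_ultrafilter :: "'a filter \<Rightarrow> bool" where
  "is_ultrafilter U \<longleftrightarrow> U \<noteq> bot \<and> (\<forall>P. eventually P U \<or> eventually (\<lambda>x. \<not> P x) U)"

text \<open>Zorn's lemma for the reversed order of filters, where smaller means finer. A chain has a
  proper infimum because whatever is eventual for the infimum is eventual for a member. A minimal
  proper filter decides \<open>P\<close>: unless \<open>P\<close> is eventual, restricting the
  filter to the complement of \<open>P\<close> stays proper, hence changes nothing.\<close>

lemma ex_ultrafilter_le: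
  assumes "F \<noteq> bot"
  shows "\<exists>U\<le>F. is_ultrafilter U"
proof -
  let ?A = "{G. G \<le> F \<and> G \<noteq> bot}"
  have "\<exists>U\<in>?A. \<forall>G\<in>?A. G \<le> U \<longrightarrow> G = U"
  proof (rule predicate_Zorn)
    show "partial_order_on ?A (relation_of (\<lambda>G H. H \<le> G) ?A)"
      by (rule partial_order_on_relation_ofI) auto
    fix C assume C: "C \<in> Chains (relation_of (\<lambda>G H. H \<le> G) ?A)"
    then have sub: "C \<subseteq> ?A"
      by (rule Chains_relation_of)
    show "\<exists>U\<in>?A. \<forall>G\<in>C. U \<le> G"
    proof (cases "C = {}")
      case False
      have "\<exists>x\<in>C. x \<le> inf G H" if "G \<in> C" "H \<in> C" for G H
        using that C by (auto simp: Chains_def relation_of_def)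
      then have "eventually P (Inf C) \<longleftrightarrow> (\<exists>b\<in>C. eventually P b)" for P
        by (rule eventually_Inf_base[OF False])
      then have "Inf C \<noteq> bot"
        using sub by (auto simp: trivial_limit_def)
      moreover have "Inf C \<le> F"
        using False sub by (auto intro: Inf_lower2)
      ultimately show ?thesis
        by (auto intro: Inf_lower)
    qed (use assms in auto)
  qed
  then obtain U where U: "U \<le> F" "U \<noteq> bot" and max: "\<And>G. G \<le> U \<Longrightarrow> G \<noteq> bot \<Longrightarrow> G = U"
    by (auto intro: order_trans)
  have "eventually (\<lambda>x. \<not> P x) U" if P: "\<not> eventually P U" for P
  proof -
    let ?G = "inf U (principal {x. \<not> P x})"
    have "?G \<noteq> bot"
      using P by (simp add: trivial_limit_def eventually_inf_principal)
    then have "?G = U"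
      by (rule max[OF inf_le1])
    then show ?thesis
      using eventually_inf_principal[of "\<lambda>x. \<not> P x" U "{x. \<not> P x}"] by simp
  qed
  with U show ?thesis
    by (auto simp: is_ultrafilter_def)
qed

text \<open>Pigeonhole: this is convergence along an ultrafilter in a finite discrete space, the
  source of the limits taken below.\<close>

lemma ultrafilter_finite:
  assumes U: "is_ultrafilter U" and "finite B" "\<forall>\<^sub>F p in U. f p \<in> B"
  shows "\<exists>b\<in>B. \<forall>\<^sub>F p in U. f p = b"
proof (rule ccontr)
  assume "\<not> ?thesis"
  then have "\<forall>b\<in>B. \<forall>\<^sub>F p in U. f p \<noteq> b"
    using U by (auto simp: is_ultrafilter_def)
  then have "\<forall>\<^sub>F p in U. \<forall>b\<in>B. f p \<noteq> b"
    by (rule eventually_ball_finite[OF assms(2)])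
  with assms(3) have "\<forall>\<^sub>F p in U. False"
    by eventually_elim auto
  with U show False
    by (auto simp: is_ultrafilter_def trivial_limit_def)
qed

section \<open>Finite quotients of free semigroups\<close>

lemma semigroup_closed: "is_semigroup S \<Longrightarrow> x \<in> carrier S \<Longrightarrow> y \<in> carrier S \<Longrightarrow> x \<cdot>\<^bsub>S\<^esub> y \<in> carrier S"
  by (auto simp: is_semigroup_def)

lemma semigroup_assoc:
  "is_semigroup S \<Longrightarrow> x \<in> carrier S \<Longrightarrow> y \<in> carrier S \<Longrightarrow> z \<in> carrier S \<Longrightarrow>
    x \<cdot>\<^bsub>S\<^esub> y \<cdot>\<^bsub>S\<^esub> z = x \<cdot>\<^bsub>S\<^esub> (y \<cdot>\<^bsub>S\<^esub> z)"
  by (auto simp: is_semigroup_def)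

lemma free_hom_closed: "\<phi> \<in> sgp_hom (free_sgp A) S \<Longrightarrow> w \<in> words A \<Longrightarrow> \<phi> w \<in> carrier S"
  by (auto simp: sgp_hom_def)

lemma words_append: "v \<in> words A \<Longrightarrow> w \<in> words A \<Longrightarrow> v @ w \<in> words A"
  by (auto simp: words_iff)

lemma words_nonempty: "A \<noteq> {} \<Longrightarrow> \<exists>w. w \<in> words A"
proof -
  assume "A \<noteq> {}"
  then obtain a where "a \<in> A" by blast
  then have "[a] \<in> words A" by (simp add: words_iff)
  then show ?thesis ..
qed

lemma is_semigroup_hom_image:
  assumes "is_semigroup S" "\<phi> \<in> sgp_hom (free_sgp A) S" "A \<noteq> {}"
  shows "is_semigroup (S\<lparr>carrier := \<phi> ` words A\<rparr>)"
proof -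
  have "\<phi> v \<cdot>\<^bsub>S\<^esub> \<phi> w \<in> \<phi> ` words A" if "v \<in> words A" "w \<in> words A" for v w
    using free_hom_append[OF assms(2) that] words_append[OF that] by (metis imageI)
  then show ?thesis
    using assms words_nonempty[OF assms(3)] free_hom_closed[OF assms(2)]
    by (auto simp: is_semigroup_def[of "S\<lparr>carrier := \<phi> ` words A\<rparr>"] semigroup_assoc)
qed

lemma is_semigroup_prod_sgp:
  assumes "\<And>i. i \<in> I \<Longrightarrow> is_semigroup (S i)"
  shows "is_semigroup (prod_sgp I S)"
  using assms by (auto simp: is_semigroup_def prod_sgp_def PiE_eq_empty_iff PiE_iff intro!: restrict_ext)

text \<open>\<open>pseudovariety\<close> and \<open>LSl\<close> speak of semigroups on
  \<open>nat\<close> only, so quotients and products built on other types enter through such a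
  copy.\<close>

lemma nat_copy:
  fixes R :: "'b sgp"
  assumes "is_semigroup R" "finite (carrier R)"
  shows "\<exists>(T :: nat sgp) f. is_semigroup T \<and> finite (carrier T) \<and> f \<in> sgp_iso R T"
proof -
  obtain f :: "'b \<Rightarrow> nat" where f: "inj_on f (carrier R)"
    using finite_imp_inj_to_nat_seg[OF assms(2)] by auto
  define g where "g = inv_into (carrier R) f"
  define T where "T = \<lparr>carrier = f ` carrier R, times = (\<lambda>x y. f (g x \<cdot>\<^bsub>R\<^esub> g y))\<rparr>"
  have g: "g (f x) = x" if "x \<in> carrier R" for x
    using f that by (simp add: g_def)
  have T: "carrier T = f ` carrier R" and m: "\<And>x y. x \<in> carrier R \<Longrightarrow> y \<in> carrier R \<Longrightarrow> f x \<cdot>\<^bsub>T\<^esub> f y = f (x \<cdot>\<^bsub>R\<^esub> y)"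
    by (simp_all add: T_def g)
  have "carrier T \<noteq> {}"
    using assms(1) by (simp add: T is_semigroup_def)
  then have "is_semigroup T"
    unfolding is_semigroup_def[of T] T
    by (auto simp: m semigroup_closed[OF assms(1)] semigroup_assoc[OF assms(1)])
  moreover have "f \<in> sgp_iso R T"
    using f by (simp add: sgp_iso_def sgp_hom_def m T bij_betw_def)
  moreover have "finite (carrier T)"
    using assms(2) by (simp add: T)
  ultimately show ?thesis
    by (intro exI conjI)
qed

text \<open>An idempotent is \<open>\<phi> w\<close> with \<open>\<phi> (w @ w) = \<phi> w\<close>,
  and its local submonoid consists of the values at the words \<open>w @ s @ w\<close>; the
  semilattice laws can therefore be tested on words.\<close>

lemma LSl_I:
  assumes "is_semigroup T" "finite (carrier T)"
    and hom: "\<phi> \<in> sgp_hom (free_sgp A) T" and surj: "\<phi> ` words A = carrier T"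
    and idem: "\<And>w s t. w \<in> words A \<Longrightarrow> \<phi> (w @ w) = \<phi> w \<Longrightarrow> s \<in> words A \<Longrightarrow> t \<in> words A \<Longrightarrow>
      \<phi> ((w @ s @ w) @ (w @ s @ w)) = \<phi> (w @ s @ w) \<and>
      \<phi> ((w @ s @ w) @ (w @ t @ w)) = \<phi> ((w @ t @ w) @ (w @ s @ w))"
  shows "T \<in> LSl"
proof -
  have "is_semilattice (T\<lparr>carrier := {e \<cdot>\<^bsub>T\<^esub> s \<cdot>\<^bsub>T\<^esub> e |s. s \<in> carrier T}\<rparr>)" (is "is_semilattice ?E")
    if e: "e \<in> idempotents T" for e
  proof -
    from e obtain w where w: "w \<in> words A" "e = \<phi> w"
      using surj by (auto simp: idempotents_def)
    have ww: "\<phi> (w @ w) = \<phi> w"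
      using e free_hom_append[OF hom w(1) w(1)] by (auto simp: idempotents_def w)
    have E: "carrier ?E = (\<lambda>s. \<phi> (w @ s @ w)) ` words A"
    proof -
      have "e \<cdot>\<^bsub>T\<^esub> \<phi> s \<cdot>\<^bsub>T\<^esub> e = \<phi> (w @ s @ w)" if "s \<in> words A" for s
        using that w free_hom_append[OF hom, of w s] free_hom_append[OF hom, of "w @ s" w]
        by (simp add: words_append)
      then show ?thesis
        unfolding surj[symmetric] by (simp add: setcompr_eq_image image_image)
    qed
    have mult: "\<phi> (w @ s @ w) \<cdot>\<^bsub>T\<^esub> \<phi> (w @ t @ w) = \<phi> ((w @ s @ w) @ (w @ t @ w))"
      if "s \<in> words A" "t \<in> words A" for s t
      using free_hom_append[OF hom, of "w @ s @ w" "w @ t @ w"] that w by (simp add: words_append)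
    have clos: "\<phi> ((w @ s @ w) @ (w @ t @ w)) \<in> carrier ?E" if "s \<in> words A" "t \<in> words A" for s t
    proof -
      have "(w @ s @ w) @ (w @ t @ w) = w @ (s @ w @ w @ t) @ w" by simp
      moreover have "s @ w @ w @ t \<in> words A"
        using that w by (simp add: words_append)
      ultimately show ?thesis
        unfolding E by (metis imageI)
    qed
    have sub: "carrier ?E \<subseteq> carrier T"
      unfolding E using free_hom_closed[OF hom] w by (auto simp: words_append)
    have ne: "carrier ?E \<noteq> {}"
      unfolding E using w(1) by blast
    have sg: "is_semigroup ?E"
      unfolding is_semigroup_def[of ?E]
    proof (intro conjI ballI ne)
      fix x y assume xy: "x \<in> carrier ?E" "y \<in> carrier ?E"
      then obtain s t where st: "s \<in> words A" "x = \<phi> (w @ s @ w)" "t \<in> words A" "y = \<phi> (w @ t @ w)"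
        unfolding E by blast
      have "x \<cdot>\<^bsub>T\<^esub> y \<in> carrier ?E"
        unfolding st(2,4) mult[OF st(1,3)] by (rule clos[OF st(1,3)])
      then show "x \<cdot>\<^bsub>?E\<^esub> y \<in> carrier ?E"
        by simp
      fix z assume z: "z \<in> carrier ?E"
      have "x \<in> carrier T" "y \<in> carrier T" "z \<in> carrier T"
        using sub xy z by blast+
      from semigroup_assoc[OF assms(1) this]
      show "x \<cdot>\<^bsub>?E\<^esub> y \<cdot>\<^bsub>?E\<^esub> z = x \<cdot>\<^bsub>?E\<^esub> (y \<cdot>\<^bsub>?E\<^esub> z)"
        by simp
    qed
    have id: "x \<cdot>\<^bsub>?E\<^esub> x = x" if "x \<in> carrier ?E" for x
    proof -
      obtain s where s: "s \<in> words A" "x = \<phi> (w @ s @ w)"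
        using \<open>x \<in> carrier ?E\<close> unfolding E by blast
      have "x \<cdot>\<^bsub>T\<^esub> x = x"
        unfolding s(2) mult[OF s(1) s(1)] by (rule conjunct1[OF idem[OF w(1) ww s(1) s(1)]])
      then show ?thesis by simp
    qed
    have cm: "x \<cdot>\<^bsub>?E\<^esub> y = y \<cdot>\<^bsub>?E\<^esub> x" if "x \<in> carrier ?E" "y \<in> carrier ?E" for x y
    proof -
      obtain s t where st: "s \<in> words A" "x = \<phi> (w @ s @ w)" "t \<in> words A" "y = \<phi> (w @ t @ w)"
        using \<open>x \<in> carrier ?E\<close> \<open>y \<in> carrier ?E\<close> unfolding E by blast
      have comm: "x \<cdot>\<^bsub>T\<^esub> y = y \<cdot>\<^bsub>T\<^esub> x"
        unfolding st(2,4) mult[OF st(1,3)] mult[OF st(3,1)] by (rule conjunct2[OF idem[OF w(1) ww st(1,3)]])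
      show ?thesis by (simp (no_asm)) (rule comm)
    qed
    show ?thesis
      unfolding is_semilattice_def by (intro conjI ballI sg id cm)
  qed
  with assms(1,2) show ?thesis
    by (auto simp: LSl_def)
qed

text \<open>The quotient of the free semigroup by the kernel of \<open>k_test k\<close> is in LSl.\<close>
definition k_test :: "nat \<Rightarrow> 'a list \<Rightarrow> 'a list \<times> 'a list \<times> 'a list set" where
  "k_test k w = (take k w, take k (rev w), {x. length x \<le> k \<and> sublist x w})"

lemma take_append_take: "take k (a @ b) = take k a @ take (k - length (take k a)) (take k b)"
  by (cases "k \<le> length a") auto

text \<open>The kernel of \<open>k_test k\<close> is a congruence: a short factor of
  \<open>a @ b\<close> lies in one side or straddles, and a straddling one consists of a suffix of
  \<open>a\<close> and a prefix of \<open>b\<close> of length at most \<open>k\<close>.\<close>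

lemma k_test_append:
  assumes "k_test k a = k_test k a'" "k_test k b = k_test k b'"
  shows "k_test k (a @ b) = k_test k (a' @ b')"
proof -
  have ta: "take k a = take k a'" "take k (rev a) = take k (rev a')"
    and tb: "take k b = take k b'" "take k (rev b) = take k (rev b')"
    and F: "\<And>x. length x \<le> k \<Longrightarrow> sublist x a \<longleftrightarrow> sublist x a'"
      "\<And>x. length x \<le> k \<Longrightarrow> sublist x b \<longleftrightarrow> sublist x b'"
    using assms by (auto simp: k_test_def set_eq_iff)
  have pre: "prefix x c \<longleftrightarrow> prefix x (take k c)" if l: "length x \<le> k" for x c :: "'a list"
  proof
    assume "prefix x c"
    then obtain z where "c = x @ z"
      by (auto simp: prefix_def)
    then have "take k c = x @ take (k - length x) z"
      using l by simp
    then show "prefix x (take k c)"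
      by simp
  next
    assume "prefix x (take k c)"
    then show "prefix x c"
      using prefix_prefix[of x "take k c" "drop k c"] by simp
  qed
  have pb: "prefix x b \<longleftrightarrow> prefix x b'" if "length x \<le> k" for x
    using pre[OF that] tb by metis
  have sa: "suffix x a \<longleftrightarrow> suffix x a'" if "length x \<le> k" for x
    using pre[of "rev x"] that ta by (metis length_rev suffix_to_prefix)
  have "sublist x (a @ b) \<longleftrightarrow> sublist x (a' @ b')" if x: "length x \<le> k" for x
  proof -
    have "x = x1 @ x2 \<and> suffix x1 a \<and> prefix x2 b \<longleftrightarrow> x = x1 @ x2 \<and> suffix x1 a' \<and> prefix x2 b'" for x1 x2
      using pb[of x2] sa[of x1] x by (cases "x = x1 @ x2") simp_all
    then show ?thesis
      by (simp only: sublist_append F[OF x])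
  qed
  moreover have "take k (a @ b) = take k (a' @ b')" "take k (rev (a @ b)) = take k (rev (a' @ b'))"
    unfolding rev_append take_append_take[of k a b] take_append_take[of k a' b']
      take_append_take[of k "rev b" "rev a"] take_append_take[of k "rev b'" "rev a'"] ta tb
    by (rule refl)+
  ultimately show ?thesis
    by (auto simp: k_test_def)
qed

lemma k_test_idem_length:
  assumes "k_test k (w @ w) = k_test k w" "w \<noteq> []"
  shows "k \<le> length w"
proof (rule ccontr)
  assume "\<not> k \<le> length w"
  moreover have "take k (w @ w) = take k w"
    using assms(1) unfolding k_test_def by (rule Pair_inject)
  then have "length (take k (w @ w)) = length (take k w)"
    by (rule arg_cong)
  ultimately show False
    using assms(2) by (cases w) (auto simp: min_def split: if_splits)
qed

text \<open>As \<open>k \<le> length w\<close>, a factor straddling the middle is a factor of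
  \<open>w @ w\<close>, and by hypothesis already of \<open>w\<close>.\<close>

lemma k_test_idem_factors:
  assumes "k_test k (w @ w) = k_test k w" "w \<noteq> []" "length x \<le> k"
  shows "sublist x ((p @ w) @ (w @ q)) \<longleftrightarrow> sublist x (p @ w) \<or> sublist x (w @ q)"
proof -
  have k: "k \<le> length w"
    using k_test_idem_length assms by blast
  have "sublist x (p @ w)" if x: "x = x1 @ x2" "suffix x1 (p @ w)" "prefix x2 (w @ q)" for x1 x2
  proof -
    have "suffix x1 w" "prefix x2 w"
      using x k assms(3) suffix_length_suffix[OF x(2) _, of w] prefix_length_prefix[OF x(3), of w]
      by (auto simp: suffix_def)
    then have "sublist x (w @ w)"
      using x(1) by (auto simp: sublist_append)
    then have "sublist x w"
      using assms(1,3) by (auto simp: k_test_def)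
    then show ?thesis
      by (auto simp: sublist_append)
  qed
  then show ?thesis
    by (simp only: sublist_append[of x "p @ w"]) blast
qed

text \<open>Prefixes and suffixes are those of the long word \<open>w\<close>, while factor sets are
  unions, which are idempotent and commutative.\<close>

lemma k_test_idem:
  assumes "k_test k (w @ w) = k_test k w" "w \<noteq> []"
  shows "k_test k ((w @ s @ w) @ (w @ s @ w)) = k_test k (w @ s @ w)"
    "k_test k ((w @ s @ w) @ (w @ t @ w)) = k_test k ((w @ t @ w) @ (w @ s @ w))"
proof -
  have k: "k \<le> length w"
    using k_test_idem_length assms by blast
  have F: "sublist x ((w @ s @ w) @ (w @ t @ w)) \<longleftrightarrow> sublist x (w @ s @ w) \<or> sublist x (w @ t @ w)"
    if "length x \<le> k" for x s t
    using k_test_idem_factors[OF assms that, of "w @ s" "t @ w"] by simp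
  show "k_test k ((w @ s @ w) @ (w @ s @ w)) = k_test k (w @ s @ w)"
    "k_test k ((w @ s @ w) @ (w @ t @ w)) = k_test k ((w @ t @ w) @ (w @ s @ w))"
    unfolding k_test_def using k F by (auto simp del: append_assoc)
qed

lemma finite_k_test: "finite A \<Longrightarrow> finite (k_test k ` words A)"
proof -
  assume "finite A"
  let ?B = "{x. set x \<subseteq> A \<and> length x \<le> k}"
  have B: "finite ?B"
    using \<open>finite A\<close> by (rule finite_lists_length_le)
  have "k_test k ` words A \<subseteq> ?B \<times> ?B \<times> Pow ?B"
    by (auto simp: k_test_def words_iff dest!: in_set_takeD set_mono_sublist) blast
  with B show ?thesis
    by (meson finite_SigmaI finite_Pow_iff finite_subset)
qed

section \<open>Free pro-V semigroups\<close>

locale free_pro_V =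
  fixes V :: "nat sgp set" and A :: "'a set"
  assumes pv: "pseudovariety V" and LSl: "LSl \<subseteq> V" and finA: "finite A" and neA: "A \<noteq> {}"
begin

abbreviation "I \<equiv> proV_index V A"
abbreviation "\<Omega> \<equiv> proV_carrier V A"
abbreviation "\<iota> \<equiv> proV_word V A"
abbreviation mul (infixl "\<odot>" 70) where "x \<odot> y \<equiv> x \<cdot>\<^bsub>proV V A\<^esub> y"

text \<open>The order of the inverse system in terms of kernels; \<open>refines_hom\<close> recovers
  the transition maps.\<close>

definition refines :: "nat sgp \<times> ('a list \<Rightarrow> nat) \<Rightarrow> nat sgp \<times> ('a list \<Rightarrow> nat) \<Rightarrow> bool" where
  "refines j i \<longleftrightarrow> (\<forall>v\<in>words A. \<forall>w\<in>words A. snd j v = snd j w \<longrightarrow> snd i v = snd i w)"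

lemmas pv_conj = pv[unfolded pseudovariety_def]

lemmas member_semigroup = bspec[OF conjunct1[OF pv_conj]]

lemmas V_subsemigroup = bspec[OF conjunct1[OF conjunct2[OF pv_conj]], THEN spec, THEN mp, OF _ conjI]

lemmas V_product = conjunct2[OF conjunct2[OF conjunct2[OF pv_conj]], THEN spec, THEN spec, THEN spec, THEN mp]

lemma index:
  assumes "i \<in> I"
  shows "is_semigroup (fst i)" "finite (carrier (fst i))" "snd i \<in> sgp_hom (free_sgp A) (fst i)"
    "snd i ` words A = carrier (fst i)"
proof -
  obtain S \<phi> where i: "i = (S, \<phi>)"
    by (cases i)
  have "S \<in> V" "\<phi> \<in> sgp_hom (free_sgp A) S" "\<phi> ` words A = carrier S"
    using assms unfolding i proV_index_def mem_Collect_eq case_prod_conv by blast+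
  then show "is_semigroup (fst i)" "finite (carrier (fst i))" "snd i \<in> sgp_hom (free_sgp A) (fst i)"
      "snd i ` words A = carrier (fst i)"
    using member_semigroup[of S] unfolding i fst_conv snd_conv by blast+
qed

lemmas index_append = free_hom_append[OF index(3)]

lemma index_closed: "i \<in> I \<Longrightarrow> w \<in> words A \<Longrightarrow> snd i w \<in> carrier (fst i)"
  by (rule free_hom_closed[OF index(3)])

lemma index_word:
  assumes "i \<in> I" "s \<in> carrier (fst i)"
  shows "\<exists>w\<in>words A. s = snd i w"
  using assms(2) unfolding index(4)[OF assms(1), symmetric] by (rule imageE) (rule bexI)

lemma index_of_hom:
  assumes "S \<in> V" "\<phi> \<in> sgp_hom (free_sgp A) S"
  shows "(S\<lparr>carrier := \<phi> ` words A\<rparr>, restrict \<phi> (words A)) \<in> I"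
proof -
  have "is_semigroup (S\<lparr>carrier := \<phi> ` words A\<rparr>)"
    by (rule is_semigroup_hom_image[OF conjunct1[OF member_semigroup[OF assms(1)]] assms(2) neA])
  moreover have "\<phi> ` words A \<subseteq> carrier S"
    using free_hom_closed[OF assms(2)] by blast
  ultimately have "S\<lparr>carrier := \<phi> ` words A\<rparr> \<in> V"
    by (intro V_subsemigroup[OF assms(1)])
  moreover have "restrict \<phi> (words A) \<in> sgp_hom (free_sgp A) (S\<lparr>carrier := \<phi> ` words A\<rparr>)"
    using free_hom_append[OF assms(2)] by (auto simp: sgp_hom_def words_append)
  ultimately show ?thesis
    by (auto simp: proV_index_def)
qed

lemma refines_hom:
  assumes "j \<in> I" "i \<in> I" "refines j i"
  shows "\<exists>f\<in>sgp_hom (fst j) (fst i). \<forall>w\<in>words A. f (snd j w) = snd i w"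
proof -
  define f where "f s = snd i (SOME w. w \<in> words A \<and> snd j w = s)" for s
  have f: "f (snd j w) = snd i w" if "w \<in> words A" for w
    using someI[of "\<lambda>v. v \<in> words A \<and> snd j v = snd j w" w] that assms(3)
    unfolding f_def refines_def by blast
  have "f x \<in> carrier (fst i)" if "x \<in> carrier (fst j)" for x
    using index_word[OF assms(1) that] f index_closed[OF assms(2)] by auto
  moreover have "f (x \<cdot>\<^bsub>fst j\<^esub> y) = f x \<cdot>\<^bsub>fst i\<^esub> f y" if xy: "x \<in> carrier (fst j)" "y \<in> carrier (fst j)" for x y
  proof -
    obtain v w where "v \<in> words A" "w \<in> words A" "x = snd j v" "y = snd j w"
      using index_word[OF assms(1) xy(1)] index_word[OF assms(1) xy(2)] by auto
    then show ?thesis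
      using f[of "v @ w"] f index_append[OF assms(1), of v w] index_append[OF assms(2), of v w]
      by (simp add: words_append)
  qed
  ultimately have "f \<in> sgp_hom (fst j) (fst i)"
    by (auto simp: sgp_hom_def)
  with f show ?thesis
    by (intro bexI[of _ f] ballI)
qed

text \<open>The place where \<open>LSl \<subseteq> V\<close> enters. One coordinate of a pseudoword
  thus determines the short prefixes, suffixes and factors of every word representing it
  there.\<close>

lemma k_test_index: "\<exists>j\<in>I. \<forall>v\<in>words A. \<forall>w\<in>words A. snd j v = snd j w \<longrightarrow> k_test k v = k_test k w"
proof -
  define rep where "rep s = (SOME w. w \<in> words A \<and> k_test k w = s)" for s
  have rep: "rep (k_test k w) \<in> words A" "k_test k (rep (k_test k w)) = k_test k w" if "w \<in> words A" for w
    using someI[of "\<lambda>v. v \<in> words A \<and> k_test k v = k_test k w" w] that unfolding rep_def by auto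
  define R where "R = \<lparr>carrier = k_test k ` words A, times = (\<lambda>s t. k_test k (rep s @ rep t))\<rparr>"
  have R: "carrier R = k_test k ` words A"
    by (simp add: R_def)
  have m: "k_test k v \<cdot>\<^bsub>R\<^esub> k_test k w = k_test k (v @ w)" if "v \<in> words A" "w \<in> words A" for v w
    using rep[OF that(1)] rep[OF that(2)] by (auto simp: R_def intro: k_test_append)
  have "is_semigroup R"
    unfolding is_semigroup_def R using words_nonempty[OF neA] by (auto simp: m words_append)
  moreover have "finite (carrier R)"
    unfolding R by (rule finite_k_test[OF finA])
  ultimately obtain T :: "nat sgp" and f where T: "is_semigroup T" "finite (carrier T)" "f \<in> sgp_iso R T"
    by (rule exE[OF nat_copy]) (auto intro: that)
  define \<phi> where "\<phi> w = f (k_test k w)" for w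
  have inj: "k_test k v = k_test k w" if "v \<in> words A" "w \<in> words A" "\<phi> v = \<phi> w" for v w
    using T(3) that by (auto simp: sgp_iso_def bij_betw_def \<phi>_def R inj_on_def)
  have hom: "\<phi> \<in> sgp_hom (free_sgp A) T"
    using T(3) by (auto simp: sgp_iso_def sgp_hom_def \<phi>_def R Pi_iff m[symmetric])
  have surj: "\<phi> ` words A = carrier T"
    using T(3) by (auto simp: sgp_iso_def bij_betw_def \<phi>_def R image_image)
  have "T \<in> LSl"
  proof (rule LSl_I[OF T(1,2) hom surj])
    fix w s t assume w: "w \<in> words A" "\<phi> (w @ w) = \<phi> w"
    then have kw: "k_test k (w @ w) = k_test k w" "w \<noteq> []"
      using inj[of "w @ w" w] by (auto simp: words_append) (simp add: words_iff)
    show "\<phi> ((w @ s @ w) @ (w @ s @ w)) = \<phi> (w @ s @ w) \<and>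
      \<phi> ((w @ s @ w) @ (w @ t @ w)) = \<phi> ((w @ t @ w) @ (w @ s @ w))"
      unfolding \<phi>_def by (intro conjI arg_cong[of _ _ f] k_test_idem[OF kw])
  qed
  then have "T \<in> V"
    using LSl by blast
  from index_of_hom[OF this hom] show ?thesis
  proof (rule bexI[rotated], intro ballI impI)
    fix v w assume *: "v \<in> words A" "w \<in> words A"
      "snd (T\<lparr>carrier := \<phi> ` words A\<rparr>, restrict \<phi> (words A)) v =
       snd (T\<lparr>carrier := \<phi> ` words A\<rparr>, restrict \<phi> (words A)) w"
    then have "\<phi> v = \<phi> w" by simp
    with * show "k_test k v = k_test k w" by (intro inj)
  qed
qed

lemma index_nonempty: "I \<noteq> {}"
  using k_test_index by blast

lemma refines_refl: "refines i i"
  by (simp add: refines_def)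

lemma refines_trans: "refines k j \<Longrightarrow> refines j i \<Longrightarrow> refines k i"
  unfolding refines_def by blast

lemma index_member: "i \<in> I \<Longrightarrow> fst i \<in> V"
  unfolding proV_index_def mem_Collect_eq case_prod_unfold by (rule conjunct1)

text \<open>The diagonal map into the product of the two quotients has a kernel contained in both
  kernels, and its image is again in \<open>V\<close>.\<close>

lemma index_directed:
  assumes "i \<in> I" "j \<in> I"
  shows "\<exists>k\<in>I. refines k i \<and> refines k j"
proof -
  define Q where "Q n = (if n = 0 then fst i else fst j)" for n :: nat
  define \<phi> where "\<phi> w = (\<lambda>n\<in>{0, 1 :: nat}. if n = 0 then snd i w else snd j w)" for w
  let ?R = "prod_sgp {0, 1} Q"
  have "is_semigroup ?R"
    by (rule is_semigroup_prod_sgp) (auto simp: Q_def index assms)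
  moreover have "finite (carrier ?R)"
    using index(2)[OF assms(1)] index(2)[OF assms(2)] by (auto simp: prod_sgp_def Q_def intro!: finite_PiE)
  ultimately obtain T :: "nat sgp" and f where T: "is_semigroup T" "finite (carrier T)" "f \<in> sgp_iso ?R T"
    by (rule exE[OF nat_copy]) (auto intro: that)
  have QV: "\<forall>n\<in>{0, 1}. Q n \<in> V"
    using index_member[OF assms(1)] index_member[OF assms(2)] by (simp add: Q_def)
  have "sgp_iso ?R T \<noteq> {}"
    using T(3) by (metis empty_iff)
  then have "T \<in> V"
    using QV T(1) by (intro V_product[of "{0, 1}" Q T] conjI finite.intros)
  have \<phi>R: "\<phi> w \<in> carrier ?R" if "w \<in> words A" for w
    using index_closed[OF assms(1) that] index_closed[OF assms(2) that] by (auto simp: \<phi>_def prod_sgp_def Q_def)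
  have \<phi>m: "\<phi> (v @ w) = \<phi> v \<cdot>\<^bsub>?R\<^esub> \<phi> w" if "v \<in> words A" "w \<in> words A" for v w
    using index_append[OF assms(1) that] index_append[OF assms(2) that] by (auto simp: \<phi>_def prod_sgp_def Q_def)
  let ?\<psi> = "\<lambda>w. f (\<phi> w)"
  have hom: "?\<psi> \<in> sgp_hom (free_sgp A) T"
    using T(3) \<phi>R by (auto simp: sgp_iso_def sgp_hom_def Pi_iff \<phi>m)
  have inj: "snd i v = snd i w \<and> snd j v = snd j w" if "v \<in> words A" "w \<in> words A" "?\<psi> v = ?\<psi> w" for v w
  proof -
    have "\<phi> v = \<phi> w"
      using T(3) that \<phi>R by (auto simp: sgp_iso_def bij_betw_def inj_on_def)
    from fun_cong[OF this, of 0] fun_cong[OF this, of 1] show ?thesis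
      by (simp add: \<phi>_def)
  qed
  let ?k = "(T\<lparr>carrier := ?\<psi> ` words A\<rparr>, restrict ?\<psi> (words A))"
  have "snd i v = snd i w \<and> snd j v = snd j w"
    if "v \<in> words A" "w \<in> words A" "snd ?k v = snd ?k w" for v w
    using inj[OF that(1,2)] that by simp
  then have "refines ?k i \<and> refines ?k j"
    unfolding refines_def by blast
  then show ?thesis
    using index_of_hom[OF \<open>T \<in> V\<close> hom] by (rule bexI)
qed

subsection \<open>Elements as limits of words along an ultrafilter\<close>

text \<open>The first component of \<open>p\<close> runs into every tail of the index set, so words
  chosen correctly for the quotient \<open>fst p\<close> alone converge in all coordinates; the
  second tends to infinity and controls lengths. One fixed choice makes limits compatible with
  concatenation.\<close>

definition U :: "((nat sgp \<times> ('a list \<Rightarrow> nat)) \<times> nat) filter" where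
  "U = (SOME U. is_ultrafilter U \<and> (\<forall>i\<in>I. \<forall>\<^sub>F p in U. fst p \<in> I \<and> refines (fst p) i) \<and>
     (\<forall>M. \<forall>\<^sub>F p in U. M \<le> snd p))"

lemma U: "is_ultrafilter U" "i \<in> I \<Longrightarrow> \<forall>\<^sub>F p in U. fst p \<in> I \<and> refines (fst p) i"
  "\<forall>\<^sub>F p in U. M \<le> snd p"
proof -
  let ?G = "\<lambda>i. principal {j \<in> I. refines j i}"
  let ?F = "INF i\<in>I. ?G i"
  \<comment> \<open>Directedness makes the tails a filter base, so their infimum is proper; its
    product with \<open>sequentially\<close> is then refined to an ultrafilter.\<close>
  have F: "eventually P ?F \<longleftrightarrow> (\<exists>i\<in>I. eventually P (?G i))" for P
  proof (rule eventually_INF_base[OF index_nonempty])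
    fix i j assume ij: "i \<in> I" "j \<in> I"
    obtain k where "k \<in> I" "refines k i" "refines k j"
      using index_directed[OF ij] by (elim bexE conjE)
    have "{l \<in> I. refines l k} \<subseteq> {l \<in> I. refines l i} \<inter> {l \<in> I. refines l j}"
    proof (intro subsetI IntI CollectI conjI)
      fix l assume "l \<in> {l \<in> I. refines l k}"
      then have l: "l \<in> I" "refines l k" by simp_all
      show "l \<in> I" "refines l i" "l \<in> I" "refines l j"
        by (fact l refines_trans[OF l(2) \<open>refines k i\<close>] refines_trans[OF l(2) \<open>refines k j\<close>])+
    qed
    then have "?G k \<le> inf (?G i) (?G j)"
      by (simp only: inf_principal principal_le_iff)
    then show "\<exists>k\<in>I. ?G k \<le> inf (?G i) (?G j)"
      using \<open>k \<in> I\<close> by (rule bexI)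
  qed
  have "?F \<noteq> bot"
  proof
    assume "?F = bot"
    then have "eventually (\<lambda>_. False) ?F"
      by simp
    then obtain i where "i \<in> I" "eventually (\<lambda>_. False) (?G i)"
      unfolding F by blast
    then show False
      using refines_refl[of i] by (cases i) (auto simp: eventually_principal)
  qed
  then have ne: "?F \<times>\<^sub>F sequentially \<noteq> bot"
    by (simp add: prod_filter_eq_bot)
  obtain W where W: "W \<le> ?F \<times>\<^sub>F sequentially" "is_ultrafilter W"
    using ex_ultrafilter_le[OF ne] by blast
  have fst_W: "\<forall>\<^sub>F p in W. fst p \<in> I \<and> refines (fst p) i" if "i \<in> I" for i
  proof -
    have "\<forall>\<^sub>F j in ?F. j \<in> I \<and> refines j i"
      unfolding F using that by (intro bexI[of _ i]) (auto simp: eventually_principal)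
    then have "\<forall>\<^sub>F (j, m) in ?F \<times>\<^sub>F sequentially. j \<in> I \<and> refines j i"
      by (simp add: eventually_prod1)
    from filter_leD[OF W(1) this] show ?thesis
      unfolding case_prod_beta .
  qed
  have snd_W: "\<forall>\<^sub>F p in W. M \<le> snd p" for M
  proof -
    have "\<forall>\<^sub>F (j, m) in ?F \<times>\<^sub>F sequentially. M \<le> m"
      by (rule eventually_prod2[OF \<open>?F \<noteq> bot\<close>, THEN iffD2, OF eventually_ge_at_top])
    from filter_leD[OF W(1) this] show ?thesis
      unfolding case_prod_beta .
  qed
  have "\<exists>U :: ((nat sgp \<times> ('a list \<Rightarrow> nat)) \<times> nat) filter. is_ultrafilter U \<and> (\<forall>i\<in>I. \<forall>\<^sub>F p in U. fst p \<in> I \<and> refines (fst p) i) \<and>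
     (\<forall>M. \<forall>\<^sub>F p in U. M \<le> snd p)"
    by (intro exI[of _ W] conjI ballI allI W(2) fst_W snd_W)
  note W' = someI_ex[OF this, folded U_def]
  show "is_ultrafilter U"
    by (rule conjunct1[OF W'])
  show "i \<in> I \<Longrightarrow> \<forall>\<^sub>F p in U. fst p \<in> I \<and> refines (fst p) i"
    by (rule bspec[OF conjunct1[OF conjunct2[OF W']]])
  show "\<forall>\<^sub>F p in U. M \<le> snd p"
    by (rule spec[OF conjunct2[OF conjunct2[OF W']]])
qed

lemmas U_ex = eventually_happens'[OF conjunct1[OF U(1)[unfolded is_ultrafilter_def]]]

lemma U_const: "\<forall>\<^sub>F p in U. P \<Longrightarrow> P"
  by (drule U_ex) (erule exE)

text \<open>Convergence along \<open>U\<close> in the product of discrete spaces; values of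
  \<open>w\<close> off a \<open>U\<close>-large set do not matter.\<close>

definition wlim :: "((nat sgp \<times> ('a list \<Rightarrow> nat)) \<times> nat \<Rightarrow> 'a list) \<Rightarrow>
    (nat sgp \<times> ('a list \<Rightarrow> nat) \<Rightarrow> nat) \<Rightarrow> bool" where
  "wlim w x \<longleftrightarrow> x \<in> \<Omega> \<and> (\<forall>\<^sub>F p in U. w p \<in> words A) \<and> (\<forall>i\<in>I. \<forall>\<^sub>F p in U. snd i (w p) = x i)"

lemma carrier_iff: "x \<in> \<Omega> \<longleftrightarrow> x \<in> (\<Pi>\<^sub>E i\<in>I. carrier (fst i)) \<and>
    (\<forall>j\<in>I. \<forall>i\<in>I. \<forall>f\<in>sgp_hom (fst j) (fst i).
      (\<forall>w\<in>words A. f (snd j w) = snd i w) \<longrightarrow> f (x j) = x i)"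
  by (simp add: proV_carrier_def case_prod_unfold)

lemma carrier_coord: "x \<in> \<Omega> \<Longrightarrow> i \<in> I \<Longrightarrow> x i \<in> carrier (fst i)"
  unfolding carrier_iff by (drule conjunct1) (rule PiE_mem)

lemma carrier_hom:
  assumes "x \<in> \<Omega>" "j \<in> I" "i \<in> I" "f \<in> sgp_hom (fst j) (fst i)" "\<And>w. w \<in> words A \<Longrightarrow> f (snd j w) = snd i w"
  shows "f (x j) = x i"
  using assms(1)[unfolded carrier_iff, THEN conjunct2] assms(2-5) by blast

lemma carrier_eqI:
  assumes "x \<in> \<Omega>" "y \<in> \<Omega>" "\<And>i. i \<in> I \<Longrightarrow> x i = y i"
  shows "x = y"
  using assms(1,2)[unfolded carrier_iff, THEN conjunct1] assms(3) by (rule PiE_ext)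

lemma carrier_word:
  assumes "x \<in> \<Omega>" "j \<in> I" "i \<in> I" "refines j i" "w \<in> words A" "snd j w = x j"
  shows "snd i w = x i"
proof -
  obtain f where f: "f \<in> sgp_hom (fst j) (fst i)" "\<forall>w\<in>words A. f (snd j w) = snd i w"
    using refines_hom[OF assms(2-4)] by (rule bexE)
  have "f (x j) = x i"
    by (rule carrier_hom[OF assms(1-3) f(1) bspec[OF f(2)]])
  then show ?thesis
    using bspec[OF f(2) assms(5)] assms(6) by simp
qed

lemma carrier_ex_word: "x \<in> \<Omega> \<Longrightarrow> j \<in> I \<Longrightarrow> \<exists>w\<in>words A. snd j w = x j"
  using index_word[of j "x j"] carrier_coord[of x j] by auto

lemma mul_coord: "i \<in> I \<Longrightarrow> (x \<odot> y) i = x i \<cdot>\<^bsub>fst i\<^esub> y i"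
  by (simp add: proV_def prod_sgp_def)

lemma carrier_proV: "carrier (proV V A) = \<Omega>"
  by (simp add: proV_def)

lemma mul_closed:
  assumes "x \<in> \<Omega>" "y \<in> \<Omega>"
  shows "x \<odot> y \<in> \<Omega>"
proof -
  have "x \<odot> y \<in> (\<Pi>\<^sub>E i\<in>I. carrier (fst i))"
    using semigroup_closed[OF index(1) carrier_coord[OF assms(1)] carrier_coord[OF assms(2)]]
    by (simp add: proV_def prod_sgp_def)
  moreover have "f ((x \<odot> y) j) = (x \<odot> y) i"
    if "j \<in> I" "i \<in> I" "f \<in> sgp_hom (fst j) (fst i)" "\<forall>w\<in>words A. f (snd j w) = snd i w" for i j f
    using carrier_hom[OF assms(1) that(1-3)] carrier_hom[OF assms(2) that(1-3)] that
      carrier_coord[OF assms(1)] carrier_coord[OF assms(2)]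
    by (simp add: mul_coord sgp_hom_def)
  ultimately show ?thesis
    unfolding carrier_iff by blast
qed

lemma mul_assoc: "x \<in> \<Omega> \<Longrightarrow> y \<in> \<Omega> \<Longrightarrow> z \<in> \<Omega> \<Longrightarrow> x \<odot> y \<odot> z = x \<odot> (y \<odot> z)"
  by (rule carrier_eqI) (auto simp: mul_closed mul_coord carrier_coord index semigroup_assoc)

lemma word_carrier: "w \<in> words A \<Longrightarrow> \<iota> w \<in> \<Omega>"
  unfolding carrier_iff by (simp add: proV_word_def index_closed)

lemma word_coord: "i \<in> I \<Longrightarrow> \<iota> w i = snd i w"
  by (simp add: proV_word_def)

text \<open>Compactness: limits exist in each finite coordinate, and they are compatible with the
  transition maps because the coordinates of each single word are.\<close>

lemma wlim_ex:
  assumes "\<forall>\<^sub>F p in U. w p \<in> words A"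
  shows "\<exists>x. wlim w x"
proof -
  have "\<exists>s\<in>carrier (fst i). \<forall>\<^sub>F p in U. snd i (w p) = s" if "i \<in> I" for i
  proof (rule ultrafilter_finite[OF U(1) index(2)[OF that]])
    show "\<forall>\<^sub>F p in U. snd i (w p) \<in> carrier (fst i)"
      using assms by eventually_elim (rule index_closed[OF that])
  qed
  then obtain x where x: "\<And>i. i \<in> I \<Longrightarrow> x i \<in> carrier (fst i) \<and> (\<forall>\<^sub>F p in U. snd i (w p) = x i)"
    by metis
  have "f (x j) = x i"
    if "j \<in> I" "i \<in> I" "\<forall>w\<in>words A. f (snd j w) = snd i w" for i j f
  proof -
    have "\<forall>\<^sub>F p in U. snd j (w p) = x j" "\<forall>\<^sub>F p in U. snd i (w p) = x i"
      using x that by blast+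
    with assms have "\<forall>\<^sub>F p in U. f (x j) = x i"
      by eventually_elim (use that(3) in auto)
    then show ?thesis by (rule U_const)
  qed
  then have "restrict x I \<in> \<Omega>"
    using x unfolding carrier_iff by simp
  then have "wlim w (restrict x I)"
    using x assms by (simp add: wlim_def)
  then show ?thesis
    by (rule exI[of "wlim w" "restrict x I"])
qed

lemma wlim_unique: "wlim w x \<Longrightarrow> wlim w y \<Longrightarrow> x = y"
proof (rule carrier_eqI)
  fix i assume "wlim w x" "wlim w y" "i \<in> I"
  then have "\<forall>\<^sub>F p in U. snd i (w p) = x i" "\<forall>\<^sub>F p in U. snd i (w p) = y i"
    by (auto simp: wlim_def)
  then have "\<forall>\<^sub>F p in U. x i = y i"
    by eventually_elim auto
  then show "x i = y i" by (rule U_const)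
qed (auto simp: wlim_def)

lemma wlim_cong:
  assumes "wlim w x" "\<forall>\<^sub>F p in U. w p = w' p"
  shows "wlim w' x"
  unfolding wlim_def
proof (intro conjI ballI)
  show "x \<in> \<Omega>"
    using assms(1) by (simp add: wlim_def)
  have "\<forall>\<^sub>F p in U. w p \<in> words A"
    using assms(1) by (simp add: wlim_def)
  then show "\<forall>\<^sub>F p in U. w' p \<in> words A"
    using assms(2) by eventually_elim simp
  fix i assume "i \<in> I"
  then have "\<forall>\<^sub>F p in U. snd i (w p) = x i"
    using assms(1) by (simp add: wlim_def)
  then show "\<forall>\<^sub>F p in U. snd i (w' p) = x i"
    using assms(2) by eventually_elim simp
qed

lemma wlim_append:
  assumes "wlim v x" "wlim w y"
  shows "wlim (\<lambda>p. v p @ w p) (x \<odot> y)"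
  unfolding wlim_def
proof (intro conjI ballI)
  have vw: "\<forall>\<^sub>F p in U. v p \<in> words A" "\<forall>\<^sub>F p in U. w p \<in> words A"
    using assms by (auto simp: wlim_def)
  show "x \<odot> y \<in> \<Omega>"
    using assms by (auto simp: wlim_def mul_closed)
  show "\<forall>\<^sub>F p in U. v p @ w p \<in> words A"
    using vw by eventually_elim (rule words_append)
  fix i assume i: "i \<in> I"
  then have "\<forall>\<^sub>F p in U. snd i (v p) = x i" "\<forall>\<^sub>F p in U. snd i (w p) = y i"
    using assms by (auto simp: wlim_def)
  with vw show "\<forall>\<^sub>F p in U. snd i (v p @ w p) = (x \<odot> y) i"
    by eventually_elim (simp add: mul_coord index_append i)
qed

lemma wlim_const: "w \<in> words A \<Longrightarrow> wlim (\<lambda>_. w) (\<iota> w)"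
  by (auto simp: wlim_def word_carrier word_coord)

text \<open>At \<open>p\<close> a word of \<open>L\<close> is chosen that agrees with
  \<open>x\<close> in the coordinate \<open>fst p\<close>; since \<open>fst p\<close> eventually
  refines any given index, agreement there follows.\<close>

lemma wlim_in:
  assumes "x \<in> \<Omega>" "L \<subseteq> words A" "\<And>j. j \<in> I \<Longrightarrow> \<exists>w\<in>L. snd j w = x j"
  shows "\<exists>w. (\<forall>p. w p \<in> L) \<and> wlim w x"
proof -
  define w where "w p = (SOME w. w \<in> L \<and> (fst p \<in> I \<longrightarrow> snd (fst p) w = x (fst p)))"
    for p :: "(nat sgp \<times> ('a list \<Rightarrow> nat)) \<times> nat"
  have ex: "\<exists>w. w \<in> L \<and> (j \<in> I \<longrightarrow> snd j w = x j)" for j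
    using assms(3) index_nonempty by blast
  have w: "w p \<in> L" "fst p \<in> I \<Longrightarrow> snd (fst p) (w p) = x (fst p)" for p
    using someI_ex[OF ex[of "fst p"]] unfolding w_def by auto
  have "\<forall>\<^sub>F p in U. snd i (w p) = x i" if "i \<in> I" for i
    using U(2)[OF that]
  proof eventually_elim
    case (elim p)
    then show ?case
      using carrier_word[OF assms(1), of "fst p" i "w p"] w[of p] assms(2) that by auto
  qed
  then have "wlim w x"
    using assms(1,2) w(1) by (auto simp: wlim_def intro!: always_eventually)
  with w(1) show ?thesis by blast
qed

lemma wlim_words: "x \<in> \<Omega> \<Longrightarrow> \<exists>w. (\<forall>p. w p \<in> words A) \<and> wlim w x"
  by (rule wlim_in) (auto intro: carrier_ex_word)

lemma wlim_coord: "wlim w x \<Longrightarrow> i \<in> I \<Longrightarrow> \<forall>\<^sub>F p in U. snd i (w p) = x i"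
  by (simp add: wlim_def)

lemma wlim_carrier: "wlim w x \<Longrightarrow> x \<in> \<Omega>"
  by (simp add: wlim_def)

text \<open>Compactness: an equation is solvable if it is solvable in every finite quotient.\<close>
lemma solve_factor:
  assumes "z \<in> \<Omega>" "y \<in> \<Omega>"
    and "\<And>j. j \<in> I \<Longrightarrow> \<exists>s\<in>words A. \<exists>t\<in>words A. z j = snd j s \<cdot>\<^bsub>fst j\<^esub> y j \<cdot>\<^bsub>fst j\<^esub> snd j t"
  shows "\<exists>s\<in>\<Omega>. \<exists>t\<in>\<Omega>. z = s \<odot> y \<odot> t"
proof -
  have "\<exists>s t. s \<in> words A \<and> t \<in> words A \<and> (j \<in> I \<longrightarrow> z j = snd j s \<cdot>\<^bsub>fst j\<^esub> y j \<cdot>\<^bsub>fst j\<^esub> snd j t)" for j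
    using assms(3)[of j] words_nonempty[OF neA] by blast
  then obtain s t where st: "\<And>j. s j \<in> words A" "\<And>j. t j \<in> words A"
    "\<And>j. j \<in> I \<Longrightarrow> z j = snd j (s j) \<cdot>\<^bsub>fst j\<^esub> y j \<cdot>\<^bsub>fst j\<^esub> snd j (t j)"
    by metis
  obtain a where a: "wlim (\<lambda>p. s (fst p)) a"
    using wlim_ex[of "\<lambda>p. s (fst p)"] st by auto
  obtain b where b: "wlim (\<lambda>p. t (fst p)) b"
    using wlim_ex[of "\<lambda>p. t (fst p)"] st by auto
  have "z = a \<odot> y \<odot> b"
  proof (rule carrier_eqI)
    show "z \<in> \<Omega>" "a \<odot> y \<odot> b \<in> \<Omega>"
      using assms a b by (auto simp: wlim_carrier mul_closed)
    fix i assume i: "i \<in> I"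
    from U(2)[OF i] wlim_coord[OF a i] wlim_coord[OF b i]
    have "\<forall>\<^sub>F p in U. z i = (a \<odot> y \<odot> b) i"
    proof eventually_elim
      case (elim p)
      then have j: "fst p \<in> I" "refines (fst p) i" by auto
      obtain v where v: "v \<in> words A" "snd (fst p) v = y (fst p)"
        using carrier_ex_word[OF assms(2) j(1)] by blast
      let ?w = "s (fst p) @ v @ t (fst p)"
      have w: "?w \<in> words A"
        using v st by (simp add: words_append)
      have app: "snd k ?w = snd k (s (fst p)) \<cdot>\<^bsub>fst k\<^esub> snd k v \<cdot>\<^bsub>fst k\<^esub> snd k (t (fst p))" if "k \<in> I" for k
        using index_append[OF that, of "s (fst p) @ v" "t (fst p)"] index_append[OF that, of "s (fst p)" v] v st
        by (simp add: words_append)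
      have "snd (fst p) ?w = z (fst p)"
        using app[OF j(1)] st(3)[OF j(1)] v by simp
      then have "z i = snd i ?w"
        using carrier_word[OF assms(1) j(1) i j(2) w] by simp
      also have "\<dots> = (a \<odot> y \<odot> b) i"
        using app[OF i] elim carrier_word[OF assms(2) j(1) i j(2) v] by (simp add: mul_coord i)
      finally show ?case .
    qed
    then show "z i = (a \<odot> y \<odot> b) i" by (rule U_const)
  qed
  with wlim_carrier[OF a] wlim_carrier[OF b] show ?thesis by blast
qed

end

section \<open>Stability and closures in free pro-V semigroups\<close>

text \<open>In the applications \<open>F\<close> and \<open>G\<close> are multiplications on
  opposite sides and \<open>\<pi>\<close> is a coordinate. By \<open>GF\<close> and commutation,
  powers of \<open>G\<close> undo powers of \<open>F\<close> on the orbit of \<open>x\<close>, so a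
  repetition in the finite image of \<open>\<pi>\<close> can be pulled back to the start of the
  orbit.\<close>

lemma orbit_return:
  assumes fin: "finite (\<pi> ` X)" and x: "x \<in> X"
    and F: "\<And>s. s \<in> X \<Longrightarrow> F s \<in> X" and G: "\<And>s. s \<in> X \<Longrightarrow> G s \<in> X"
    and FG: "\<And>s. s \<in> X \<Longrightarrow> F (G s) = G (F s)" and GF: "G (F x) = x"
    and cF: "\<And>s t. s \<in> X \<Longrightarrow> t \<in> X \<Longrightarrow> \<pi> s = \<pi> t \<Longrightarrow> \<pi> (F s) = \<pi> (F t)"
    and cG: "\<And>s t. s \<in> X \<Longrightarrow> t \<in> X \<Longrightarrow> \<pi> s = \<pi> t \<Longrightarrow> \<pi> (G s) = \<pi> (G t)"
  shows "\<exists>p>0. \<pi> ((F ^^ p) x) = \<pi> x"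
proof -
  have Fn: "(F ^^ n) s \<in> X" and Gn: "(G ^^ n) s \<in> X" if "s \<in> X" for n s
    using that F G by (induction n) auto
  have cGn: "\<pi> ((G ^^ n) s) = \<pi> ((G ^^ n) t)" if "s \<in> X" "t \<in> X" "\<pi> s = \<pi> t" for n s t
  proof (induction n)
    case (Suc n)
    show ?case
      using cG[OF Gn[OF that(1), of n] Gn[OF that(2), of n] Suc] by simp
  qed (use that in simp)
  have FGn: "F ((G ^^ n) s) = (G ^^ n) (F s)" if "s \<in> X" for n s
    by (induction n) (use FG Gn that in auto)
  have FnGn: "(F ^^ k) ((G ^^ n) s) = (G ^^ n) ((F ^^ k) s)" if "s \<in> X" for k n s
    by (induction k) (use FGn Fn that in auto)
  have inv: "(G ^^ n) ((F ^^ n) x) = x" for n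
  proof (induction n)
    case (Suc n)
    have "(G ^^ Suc n) ((F ^^ Suc n) x) = (G ^^ n) (G (F ((F ^^ n) x)))"
      by (simp add: funpow_swap1)
    also have "G (F ((F ^^ n) x)) = (F ^^ n) (G (F x))"
      using FnGn[of "F x" n 1] F x by (simp add: funpow_swap1)
    finally show ?case using GF Suc by simp
  qed simp
  have "\<not> inj (\<lambda>n. \<pi> ((F ^^ n) x))"
  proof
    assume "inj (\<lambda>n. \<pi> ((F ^^ n) x))"
    then have "infinite (range (\<lambda>n. \<pi> ((F ^^ n) x)))"
      by (rule range_inj_infinite)
    moreover have "range (\<lambda>n. \<pi> ((F ^^ n) x)) \<subseteq> \<pi> ` X"
      using Fn[OF x] by blast
    ultimately show False
      using fin finite_subset by blast
  qed
  then obtain m n where mn: "m < n" "\<pi> ((F ^^ m) x) = \<pi> ((F ^^ n) x)"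
    unfolding inj_def by (metis nat_neq_iff)
  have "\<pi> ((F ^^ (n - m)) x) = \<pi> ((F ^^ (n - m)) ((G ^^ m) ((F ^^ m) x)))"
    by (simp add: inv)
  also have "\<dots> = \<pi> ((G ^^ m) ((F ^^ (n - m)) ((F ^^ m) x)))"
    by (simp add: FnGn Fn x)
  also have "(F ^^ (n - m)) ((F ^^ m) x) = (F ^^ n) x"
    using mn(1) by (metis comp_apply funpow_add le_add_diff_inverse2 less_imp_le)
  also have "\<pi> ((G ^^ m) ((F ^^ n) x)) = \<pi> ((G ^^ m) ((F ^^ m) x))"
    by (rule cGn) (use mn Fn x in auto)
  finally show ?thesis
    using mn(1) inv by (intro exI[of _ "n - m"]) auto
qed

context free_pro_V
begin

subsection \<open>Stability\<close>

lemma coord_refines: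
  assumes "x \<in> \<Omega>" "y \<in> \<Omega>" "j \<in> I" "i \<in> I" "refines j i" "x j = y j"
  shows "x i = y i"
proof -
  obtain w where "w \<in> words A" "snd j w = x j"
    using carrier_ex_word[OF assms(1,3)] by blast
  then show ?thesis
    using carrier_word[OF assms(1,3-5), of w] carrier_word[OF assms(2-5), of w] assms(6) by simp
qed

text \<open>Compactness for a map acting coordinate by coordinate: solutions modulo \<open>j\<close>
  are represented by words, whose limit along \<open>U\<close> is a solution in all
  coordinates.\<close>

lemma solve:
  assumes z: "z \<in> \<Omega>" and f: "\<And>t. t \<in> \<Omega> \<Longrightarrow> f t \<in> \<Omega>"
    and cong: "\<And>i s t. i \<in> I \<Longrightarrow> s \<in> \<Omega> \<Longrightarrow> t \<in> \<Omega> \<Longrightarrow> s i = t i \<Longrightarrow> f s i = f t i"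
    and ex: "\<And>j. j \<in> I \<Longrightarrow> \<exists>t\<in>\<Omega>. f t j = z j"
  shows "\<exists>t\<in>\<Omega>. z = f t"
proof -
  have "\<exists>w. w \<in> words A \<and> (j \<in> I \<longrightarrow> f (\<iota> w) j = z j)" for j
  proof (cases "j \<in> I")
    case True
    then obtain t where t: "t \<in> \<Omega>" "f t j = z j"
      using ex by blast
    obtain w where w: "w \<in> words A" "snd j w = t j"
      using carrier_ex_word[OF t(1) True] by blast
    have "f (\<iota> w) j = f t j"
      by (rule cong) (use w t True in \<open>auto simp: word_carrier word_coord\<close>)
    with t w show ?thesis by auto
  qed (use words_nonempty[OF neA] in blast)
  then obtain w where w: "\<And>j. w j \<in> words A" "\<And>j. j \<in> I \<Longrightarrow> f (\<iota> (w j)) j = z j"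
    by metis
  obtain t where t: "wlim (\<lambda>p. w (fst p)) t"
    using wlim_ex[of "\<lambda>p. w (fst p)"] w(1) by auto
  have "z = f t"
  proof (rule carrier_eqI[OF z f[OF wlim_carrier[OF t]]])
    fix i assume i: "i \<in> I"
    from U(2)[OF i] wlim_coord[OF t i] have "\<forall>\<^sub>F p in U. z i = f t i"
    proof eventually_elim
      case (elim p)
      then have "f (\<iota> (w (fst p))) i = z i"
        using coord_refines[OF f[OF word_carrier[OF w(1)]] z _ i] w(2) by blast
      moreover have "f (\<iota> (w (fst p))) i = f t i"
        by (rule cong[OF i word_carrier[OF w(1)] wlim_carrier[OF t]]) (simp add: word_coord i elim)
      ultimately show ?case by simp
    qed
    then show "z i = f t i" by (rule U_const)
  qed
  with wlim_carrier[OF t] show ?thesis by blast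
qed

lemma finite_coord: "i \<in> I \<Longrightarrow> finite ((\<lambda>x. x i) ` \<Omega>)"
  by (rule finite_subset[OF _ index(2)]) (use carrier_coord in blast)

text \<open>Stability: in each finite coordinate the orbit of \<open>x\<close> under right
  multiplication by \<open>b\<close> returns to \<open>x\<close>, and \<open>solve\<close> merges
  these returns.\<close>

lemma stable_right:
  assumes "x \<in> \<Omega>" "a \<in> \<Omega>" "b \<in> \<Omega>" and eq: "a \<odot> (x \<odot> b) = x"
  shows "\<exists>c\<in>\<Omega>. x = x \<odot> (b \<odot> c)"
proof (rule solve)
  define B where "B n = ((\<lambda>s. s \<odot> b) ^^ n) b" for n
  have B: "B n \<in> \<Omega>" for n
    by (induction n) (auto simp: B_def assms mul_closed)
  have pow: "((\<lambda>s. s \<odot> b) ^^ Suc (Suc n)) x = x \<odot> (b \<odot> B n)" for n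
  proof (induction n)
    case (Suc n)
    have "((\<lambda>s. s \<odot> b) ^^ Suc (Suc (Suc n))) x = x \<odot> (b \<odot> B n) \<odot> b"
      using Suc by simp
    also have "\<dots> = x \<odot> (b \<odot> (B n \<odot> b))"
      using assms(1,3) B[of n] by (simp add: mul_assoc mul_closed)
    finally show ?case by (simp add: B_def)
  qed (use assms in \<open>simp add: B_def mul_assoc\<close>)
  fix j assume j: "j \<in> I"
  have "\<exists>p>0. ((\<lambda>s. s \<odot> b) ^^ p) x j = x j"
    by (rule orbit_return[where G = "\<lambda>s. a \<odot> s" and X = \<Omega>, OF finite_coord[OF j] assms(1)])
      (use assms in \<open>auto simp: mul_closed mul_assoc mul_coord j\<close>)
  then obtain p where p: "p > 0" "((\<lambda>s. s \<odot> b) ^^ p) x j = x j"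
    by blast
  have cong: "((\<lambda>s. s \<odot> b) ^^ n) s j = ((\<lambda>s. s \<odot> b) ^^ n) t j" if "s j = t j" for s t n
    by (induction n) (use that j in \<open>simp_all add: mul_coord\<close>)
  \<comment> \<open>The period is doubled to provide at least two factors \<open>b\<close>: one is
    kept apart, and \<open>B (p + p - 2)\<close> collects the others.\<close>
  have "((\<lambda>s. s \<odot> b) ^^ (p + p)) x j = x j"
    unfolding funpow_add comp_apply
    by (rule trans[OF cong[where s = "((\<lambda>s. s \<odot> b) ^^ p) x" and t = x, OF p(2)] p(2)])
  moreover have "p + p = Suc (Suc (p + p - 2))"
    using p(1) by simp
  ultimately have "(x \<odot> (b \<odot> B (p + p - 2))) j = x j"
    using pow[of "p + p - 2"] by simp
  with B show "\<exists>t\<in>\<Omega>. (x \<odot> (b \<odot> t)) j = x j"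
    by blast
qed (use assms in \<open>auto simp: mul_closed mul_coord\<close>)

lemma stable_left:
  assumes "x \<in> \<Omega>" "a \<in> \<Omega>" "b \<in> \<Omega>" and eq: "a \<odot> (x \<odot> b) = x"
  shows "\<exists>c\<in>\<Omega>. x = c \<odot> a \<odot> x"
proof (rule solve)
  define B where "B n = ((\<lambda>s. a \<odot> s) ^^ n) a" for n
  have B: "B n \<in> \<Omega>" for n
    by (induction n) (auto simp: B_def assms mul_closed)
  have pow: "((\<lambda>s. a \<odot> s) ^^ Suc (Suc n)) x = B n \<odot> a \<odot> x" for n
  proof (induction n)
    case (Suc n)
    have "((\<lambda>s. a \<odot> s) ^^ Suc (Suc (Suc n))) x = a \<odot> (B n \<odot> a \<odot> x)"
      using Suc by simp
    also have "\<dots> = a \<odot> B n \<odot> a \<odot> x"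
      using assms(1,2) B[of n] by (simp add: mul_assoc mul_closed)
    finally show ?case by (simp add: B_def)
  qed (use assms in \<open>simp add: B_def mul_assoc\<close>)
  fix j assume j: "j \<in> I"
  have "\<exists>p>0. ((\<lambda>s. a \<odot> s) ^^ p) x j = x j"
    by (rule orbit_return[where G = "\<lambda>s. s \<odot> b" and X = \<Omega>, OF finite_coord[OF j] assms(1)])
      (use assms in \<open>auto simp: mul_closed mul_assoc mul_coord j\<close>)
  then obtain p where p: "p > 0" "((\<lambda>s. a \<odot> s) ^^ p) x j = x j"
    by blast
  have cong: "((\<lambda>s. a \<odot> s) ^^ n) s j = ((\<lambda>s. a \<odot> s) ^^ n) t j" if "s j = t j" for s t n
    by (induction n) (use that j in \<open>simp_all add: mul_coord\<close>)
  have "((\<lambda>s. a \<odot> s) ^^ (p + p)) x j = x j"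
    unfolding funpow_add comp_apply
    by (rule trans[OF cong[where s = "((\<lambda>s. a \<odot> s) ^^ p) x" and t = x, OF p(2)] p(2)])
  moreover have "p + p = Suc (Suc (p + p - 2))"
    using p(1) by simp
  ultimately have "(B (p + p - 2) \<odot> a \<odot> x) j = x j"
    using pow[of "p + p - 2"] by simp
  with B show "\<exists>t\<in>\<Omega>. (t \<odot> a \<odot> x) j = x j"
    by blast
qed (use assms in \<open>auto simp: mul_closed mul_coord\<close>)

subsection \<open>Closures of languages\<close>

lemma topspace_proV: "topspace (proV_top V A) = \<Omega>"
proof -
  have "\<Omega> \<subseteq> (\<Pi>\<^sub>E i\<in>I. carrier (fst i))"
    by (rule subsetI) (simp only: carrier_iff)
  then show ?thesis
    by (simp add: proV_top_def Int_absorb1)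
qed

lemma continuous_coord:
  assumes "i \<in> I"
  shows "continuous_map (proV_top V A) (discrete_topology (carrier (fst i))) (\<lambda>x. x i)"
  unfolding proV_top_def
  by (rule continuous_map_from_subtopology)
    (use continuous_map_product_projection[OF assms, of "\<lambda>i. discrete_topology (carrier (fst i))"] in simp)

lemma closure_word:
  assumes "x \<in> proV_top V A closure_of (\<iota> ` L)" "j \<in> I"
  shows "\<exists>w\<in>L. snd j w = x j"
proof -
  have x: "x \<in> \<Omega>"
    using assms(1) by (simp add: in_closure_of topspace_proV)
  let ?T = "{y \<in> topspace (proV_top V A). y j \<in> {x j}}"
  have op: "openin (proV_top V A) ?T"
    by (rule openin_continuous_map_preimage[OF continuous_coord[OF assms(2)]])
      (use carrier_coord[OF x assms(2)] in simp)
  have xT: "x \<in> ?T"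
    using x by (simp add: topspace_proV)
  have "\<exists>y. y \<in> \<iota> ` L \<and> y \<in> ?T"
    by (rule assms(1)[unfolded in_closure_of, THEN conjunct2, THEN spec, THEN mp, OF conjI[OF xT op]])
  then obtain w where w: "w \<in> L" and y: "\<iota> w j = x j"
    by (elim exE conjE imageE) simp
  have "snd j w = x j"
    using y unfolding word_coord[OF assms(2)] .
  with w show ?thesis
    by (rule bexI[rotated])
qed

lemma finite_refinement:
  assumes "finite J" "J \<subseteq> I"
  shows "\<exists>k\<in>I. \<forall>i\<in>J. refines k i"
  using assms
proof (induction J rule: finite_induct)
  case empty
  then show ?case using index_nonempty by auto
next
  case (insert i J)
  then obtain k where k: "k \<in> I" "\<And>i. i \<in> J \<Longrightarrow> refines k i" "i \<in> I"
    by auto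
  obtain l where l: "l \<in> I" "refines l k" "refines l i"
    using index_directed[OF k(1,3)] by (elim bexE conjE)
  have "refines l m" if "m \<in> insert i J" for m
    using that l(3) refines_trans[OF l(2) k(2)] by (cases "m = i") simp_all
  with l(1) show ?case
    by (intro bexI[of _ l] ballI)
qed

text \<open>A basic neighbourhood restricts finitely many coordinates, and one index refines them
  all; so agreement in single coordinates suffices.\<close>

lemma in_closureI:
  assumes x: "x \<in> \<Omega>" and "L \<subseteq> words A" and ex: "\<And>j. j \<in> I \<Longrightarrow> \<exists>w\<in>L. snd j w = x j"
  shows "x \<in> proV_top V A closure_of (\<iota> ` L)"
  unfolding in_closure_of topspace_proV
proof (intro conjI allI impI x)
  fix T assume T: "x \<in> T \<and> openin (proV_top V A) T"
  then obtain W where W: "openin (product_topology (\<lambda>i. discrete_topology (carrier (fst i))) I) W" "T = W \<inter> \<Omega>"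
    by (auto simp: proV_top_def openin_subtopology)
  then obtain Z where Z: "finite {i \<in> I. Z i \<noteq> carrier (fst i)}" "x \<in> Pi\<^sub>E I Z" "Pi\<^sub>E I Z \<subseteq> W"
    using T unfolding openin_product_topology_alt by (auto dest!: bspec[of W])
  obtain k where k: "k \<in> I" "\<And>i. i \<in> I \<Longrightarrow> Z i \<noteq> carrier (fst i) \<Longrightarrow> refines k i"
    using finite_refinement[OF Z(1)] by auto
  obtain w where w: "w \<in> L" "snd k w = x k"
    using ex[OF k(1)] by blast
  then have wA: "w \<in> words A"
    using assms(2) by blast
  have "\<iota> w i \<in> Z i" if "i \<in> I" for i
  proof (cases "Z i = carrier (fst i)")
    case True
    then show ?thesis using that wA by (simp add: word_coord index_closed)
  next
    case False
    then have "snd i w = x i"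
      using carrier_word[OF x k(1) that k(2)[OF that False] wA w(2)] by simp
    then show ?thesis using that Z(2) by (auto simp: word_coord PiE_iff)
  qed
  then have "\<iota> w \<in> Pi\<^sub>E I Z"
    by (auto simp: proV_word_def)
  then show "\<exists>y. y \<in> \<iota> ` L \<and> y \<in> T"
    using Z(3) W(2) word_carrier[OF wA] w(1) by blast
qed

text \<open>The ultrafilter decides whether lengths reach \<open>M\<close>. If they fail to for some
  \<open>M\<close>, finitely many words remain, and one of them is taken almost everywhere.\<close>

lemma wlim_long_or_word:
  assumes "wlim w x"
  shows "(\<forall>M. \<forall>\<^sub>F p in U. M \<le> length (w p)) \<or> (\<exists>v\<in>words A. \<forall>\<^sub>F p in U. w p = v)"
proof (rule disjCI)
  assume "\<not> (\<exists>v\<in>words A. \<forall>\<^sub>F p in U. w p = v)"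
  then have no: "\<And>v. v \<in> words A \<Longrightarrow> \<not> (\<forall>\<^sub>F p in U. w p = v)"
    by blast
  show "\<forall>M. \<forall>\<^sub>F p in U. M \<le> length (w p)"
  proof (intro allI, rule ccontr)
    fix M assume "\<not> (\<forall>\<^sub>F p in U. M \<le> length (w p))"
    then have short: "\<forall>\<^sub>F p in U. \<not> M \<le> length (w p)"
      using U(1) unfolding is_ultrafilter_def by blast
    let ?B = "{v. set v \<subseteq> A \<and> length v \<le> M}"
    have wA: "\<forall>\<^sub>F p in U. w p \<in> words A"
      using assms by (simp add: wlim_def)
    with short have "\<forall>\<^sub>F p in U. w p \<in> ?B"
      by eventually_elim (auto simp: words_iff)
    then obtain v where v: "\<forall>\<^sub>F p in U. w p = v"
      using ultrafilter_finite[OF U(1) finite_lists_length_le[OF finA]] by blast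
    with wA have "\<forall>\<^sub>F p in U. v \<in> words A"
      by eventually_elim simp
    then have "v \<in> words A"
      by (rule U_const)
    with no v show False by blast
  qed
qed

lemma wlim_k_test:
  assumes "wlim w x" "wlim v x"
  shows "\<forall>\<^sub>F p in U. k_test k (w p) = k_test k (v p)"
proof -
  obtain j where j: "j \<in> I" "\<And>v w. v \<in> words A \<Longrightarrow> w \<in> words A \<Longrightarrow> snd j v = snd j w \<Longrightarrow> k_test k v = k_test k w"
    using k_test_index by blast
  have "\<forall>\<^sub>F p in U. w p \<in> words A" "\<forall>\<^sub>F p in U. v p \<in> words A"
    using assms by (auto simp: wlim_def)
  with wlim_coord[OF assms(1) j(1)] wlim_coord[OF assms(2) j(1)] show ?thesis
    by eventually_elim (auto intro: j(2))
qed

lemma k_test_short: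
  assumes "k_test k v = k_test k w" "length v < k"
  shows "w = v"
proof -
  have "take k v = take k w"
    using assms(1) unfolding k_test_def by (rule Pair_inject)
  then show ?thesis
    using assms(2) by (metis length_take min_less_iff_conj nat_neq_iff take_all_iff less_imp_le not_le min_def)
qed

text \<open>\<open>k_test (Suc (length v))\<close> separates \<open>v\<close> from all other words,
  in particular from all longer ones.\<close>

lemma wlim_long_not_word:
  assumes "wlim w x" "\<And>M. \<forall>\<^sub>F p in U. M \<le> length (w p)" "v \<in> words A"
  shows "x \<noteq> \<iota> v"
proof
  assume x: "x = \<iota> v"
  have "\<forall>\<^sub>F p in U. k_test (Suc (length v)) v = k_test (Suc (length v)) (w p)"
    by (rule wlim_k_test[OF _ assms(1)]) (use wlim_const[OF assms(3)] x in simp)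
  with assms(2)[of "Suc (length v)"] have "\<forall>\<^sub>F p in U. False"
    by eventually_elim (use k_test_short in fastforce)
  then show False by (rule U_const)
qed

subsection \<open>The J-order\<close>

text \<open>No identity is adjoined: \<open>below x x\<close> means that \<open>x\<close> is a
  two-sided multiple of itself, which is what turns membership in \<open>sgp_ideal\<close> into
  \<open>below\<close>.\<close>

definition below :: "(nat sgp \<times> ('a list \<Rightarrow> nat) \<Rightarrow> nat) \<Rightarrow> (nat sgp \<times> ('a list \<Rightarrow> nat) \<Rightarrow> nat) \<Rightarrow> bool" where
  "below x y \<longleftrightarrow> (\<exists>a\<in>\<Omega>. \<exists>b\<in>\<Omega>. x = a \<odot> y \<odot> b)"

lemma belowI: "a \<in> \<Omega> \<Longrightarrow> b \<in> \<Omega> \<Longrightarrow> x = a \<odot> y \<odot> b \<Longrightarrow> below x y"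
  by (auto simp: below_def)

lemma belowE: "below x y \<Longrightarrow> (\<And>a b. a \<in> \<Omega> \<Longrightarrow> b \<in> \<Omega> \<Longrightarrow> x = a \<odot> y \<odot> b \<Longrightarrow> P) \<Longrightarrow> P"
  by (auto simp: below_def)

lemma below_trans:
  assumes "below x y" "below y z" "z \<in> \<Omega>"
  shows "below x z"
proof -
  obtain a b where 1: "a \<in> \<Omega>" "b \<in> \<Omega>" "x = a \<odot> y \<odot> b"
    using assms(1) by (rule belowE)
  obtain c d where 2: "c \<in> \<Omega>" "d \<in> \<Omega>" "y = c \<odot> z \<odot> d"
    using assms(2) by (rule belowE)
  show ?thesis
    by (rule belowI[of "a \<odot> c" "d \<odot> b"]) (simp_all add: 1 2 assms(3) mul_closed mul_assoc)
qed

lemma ideal_cases: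
  assumes "y \<in> sgp_ideal (proV V A) x"
  obtains "y = x" | s where "s \<in> \<Omega>" "y = s \<odot> x" | t where "t \<in> \<Omega>" "y = x \<odot> t"
    | s t where "s \<in> \<Omega>" "t \<in> \<Omega>" "y = s \<odot> x \<odot> t"
  using assms unfolding sgp_ideal_def carrier_proV by blast

lemma ideal_below_lower:
  assumes "y \<in> sgp_ideal (proV V A) x" "below x x" "x \<in> \<Omega>"
  shows "below y x"
proof -
  obtain a b where ab: "a \<in> \<Omega>" "b \<in> \<Omega>" "x = a \<odot> x \<odot> b"
    using assms(2) by (rule belowE)
  from assms(1) show ?thesis
  proof (cases rule: ideal_cases)
    case (2 s)
    have "y = (s \<odot> a) \<odot> x \<odot> b"
      unfolding 2(2) by (subst ab(3)) (simp add: 2(1) ab(1,2) assms(3) mul_closed mul_assoc)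
    then show ?thesis
      by (rule belowI[rotated 2]) (simp_all add: 2 ab mul_closed)
  next
    case (3 t)
    have "y = a \<odot> x \<odot> (b \<odot> t)"
      unfolding 3(2) by (subst ab(3)) (simp add: 3(1) ab(1,2) assms(3) mul_closed mul_assoc)
    then show ?thesis
      by (rule belowI[rotated 2]) (simp_all add: 3 ab mul_closed)
  qed (use assms(2) belowI in blast)+
qed

lemma ideal_below_upper:
  assumes "x \<in> sgp_ideal (proV V A) y" "below x x" "y \<in> \<Omega>"
  shows "below x y"
proof -
  obtain a b where ab: "a \<in> \<Omega>" "b \<in> \<Omega>" "x = a \<odot> x \<odot> b"
    using assms(2) by (rule belowE)
  from assms(1) show ?thesis
  proof (cases rule: ideal_cases)
    case (2 s)
    have "a \<odot> x \<odot> b = (a \<odot> s) \<odot> y \<odot> b"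
      unfolding 2(2) by (simp add: 2(1) ab(1,2) assms(3) mul_closed mul_assoc)
    with ab(3) have "x = (a \<odot> s) \<odot> y \<odot> b"
      by (rule trans)
    then show ?thesis
      by (rule belowI[rotated 2]) (simp_all add: 2 ab mul_closed)
  next
    case (3 t)
    have "a \<odot> x \<odot> b = a \<odot> y \<odot> (t \<odot> b)"
      unfolding 3(2) by (simp add: 3(1) ab(1,2) assms(3) mul_closed mul_assoc)
    with ab(3) have "x = a \<odot> y \<odot> (t \<odot> b)"
      by (rule trans)
    then show ?thesis
      by (rule belowI[rotated 2]) (simp_all add: 3 ab mul_closed)
  qed (use assms(2) belowI in blast)+
qed

lemma below_ideal_subset:
  assumes "below x y" "y \<in> \<Omega>"
  shows "sgp_ideal (proV V A) x \<subseteq> sgp_ideal (proV V A) y"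
proof
  fix z assume z: "z \<in> sgp_ideal (proV V A) x"
  obtain a b where ab: "a \<in> \<Omega>" "b \<in> \<Omega>" "x = a \<odot> y \<odot> b"
    using assms(1) by (rule belowE)
  have "below z y"
    using z
  proof (cases rule: ideal_cases)
    case 1
    then show ?thesis using assms(1) by simp
  next
    case (2 s)
    show ?thesis
      by (rule belowI[of "s \<odot> a" b]) (simp_all add: 2 ab assms mul_closed mul_assoc)
  next
    case (3 t)
    show ?thesis
      by (rule belowI[of a "b \<odot> t"]) (simp_all add: 3 ab assms mul_closed mul_assoc)
  next
    case (4 s t)
    show ?thesis
      by (rule belowI[of "s \<odot> a" "b \<odot> t"]) (simp_all add: 4 ab assms mul_closed mul_assoc)
  qed
  then show "z \<in> sgp_ideal (proV V A) y"
    by (rule belowE) (auto simp: sgp_ideal_def carrier_proV)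
qed

text \<open>A maximal subgroup with identity \<open>e\<close> is the group of units of the local
  monoid at \<open>e\<close>. One-sided inverses \<open>c\<close> and \<open>d\<close> suffice,
  since \<open>e \<odot> c \<odot> e = d \<odot> e\<close> is a two-sided one.\<close>

lemma maximal_subgroup_units:
  assumes "maximal_subgroup (proV V A) H"
  shows "\<exists>e\<in>H. H \<subseteq> \<Omega> \<and> e \<odot> e = e \<and> (\<forall>y\<in>\<Omega>. \<forall>c\<in>\<Omega>. \<forall>d\<in>\<Omega>.
    e \<odot> y = y \<longrightarrow> y \<odot> e = y \<longrightarrow> y \<odot> c = e \<longrightarrow> d \<odot> y = e \<longrightarrow> y \<in> H)"
proof -
  have sub: "H \<subseteq> \<Omega>" and max: "\<And>K. is_subgroup (proV V A) K \<Longrightarrow> H \<subseteq> K \<Longrightarrow> K = H"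
    using assms unfolding maximal_subgroup_def is_subgroup_def carrier_proV by blast+
  obtain e where "group \<lparr>carrier = H, mult = (\<lambda>x y. x \<odot> y), one = e\<rparr>" (is "group ?G")
    using assms unfolding maximal_subgroup_def is_subgroup_def by blast
  then interpret G: group ?G .
  have e: "e \<in> H" and el: "\<And>x. x \<in> H \<Longrightarrow> e \<odot> x = x" and er: "\<And>x. x \<in> H \<Longrightarrow> x \<odot> e = x"
    using G.one_closed G.l_one G.r_one by simp_all
  have inv: "\<exists>y\<in>H. x \<odot> y = e \<and> y \<odot> x = e" if "x \<in> H" for x
    using G.inv_closed[of x] G.r_inv[of x] G.l_inv[of x] that by auto
  have e\<Omega>: "e \<in> \<Omega>" using e sub by blast
  have ee: "e \<odot> e = e" using el e by simp
  \<comment> \<open>\<open>K\<close> is this group of units; as a subgroup containing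
    \<open>H\<close> it equals \<open>H\<close> by maximality.\<close>
  define K where "K = {x \<in> \<Omega>. e \<odot> x = x \<and> x \<odot> e = x \<and> (\<exists>y\<in>\<Omega>. e \<odot> y = y \<and> y \<odot> e = y \<and> x \<odot> y = e \<and> y \<odot> x = e)}"
  have K1: "x \<in> \<Omega>" "e \<odot> x = x" "x \<odot> e = x" if "x \<in> K" for x
    using that by (auto simp: K_def)
  have Kmul: "x \<odot> y \<in> K" if xy: "x \<in> K" "y \<in> K" for x y
  proof -
    obtain x' where x': "x' \<in> \<Omega>" "e \<odot> x' = x'" "x' \<odot> e = x'" "x \<odot> x' = e" "x' \<odot> x = e"
      using xy(1) by (auto simp: K_def)
    obtain y' where y': "y' \<in> \<Omega>" "e \<odot> y' = y'" "y' \<odot> e = y'" "y \<odot> y' = e" "y' \<odot> y = e"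
      using xy(2) by (auto simp: K_def)
    note x = K1[OF xy(1)] and y = K1[OF xy(2)]
    have 1: "x \<odot> y \<odot> (y' \<odot> x') = x \<odot> (y \<odot> y' \<odot> x')"
      using x(1) y(1) x'(1) y'(1) by (simp add: mul_assoc mul_closed)
    have 2: "y' \<odot> x' \<odot> (x \<odot> y) = y' \<odot> (x' \<odot> x \<odot> y)"
      using x(1) y(1) x'(1) y'(1) by (simp add: mul_assoc mul_closed)
    have 3: "e \<odot> (x \<odot> y) = x \<odot> y" "x \<odot> y \<odot> e = x \<odot> y" "e \<odot> (y' \<odot> x') = y' \<odot> x'" "y' \<odot> x' \<odot> e = y' \<odot> x'"
      using mul_assoc[OF e\<Omega> x(1) y(1)] mul_assoc[OF x(1) y(1) e\<Omega>] mul_assoc[OF e\<Omega> y'(1) x'(1)]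
        mul_assoc[OF y'(1) x'(1) e\<Omega>] x y x' y' by simp_all
    show ?thesis
      unfolding K_def using 1 2 3 x y x' y' by (auto intro!: bexI[of _ "y' \<odot> x'"] mul_closed)
  qed
  have "group \<lparr>carrier = K, mult = (\<lambda>x y. x \<odot> y), one = e\<rparr>"
  proof (rule groupI, unfold partial_object.simps monoid.simps)
    fix x y z assume xyz: "x \<in> K" "y \<in> K" "z \<in> K"
    then show "x \<odot> y \<odot> z = x \<odot> (y \<odot> z)"
      by (intro mul_assoc K1)
  next
    fix x assume "x \<in> K"
    then show "\<exists>y\<in>K. y \<odot> x = e"
      unfolding K_def by blast
  next
    show "e \<in> K"
      unfolding K_def using e\<Omega> ee by blast
  qed (use Kmul K1 in auto)
  then have "is_subgroup (proV V A) K"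
    unfolding is_subgroup_def carrier_proV using K1(1) by blast
  moreover have "H \<subseteq> K"
  proof
    fix x assume x: "x \<in> H"
    obtain y where "y \<in> H" "x \<odot> y = e" "y \<odot> x = e"
      using inv[OF x] by blast
    then show "x \<in> K"
      unfolding K_def using sub el er x by blast
  qed
  ultimately have KH: "K = H"
    by (rule max)
  have "y \<in> H" if y: "y \<in> \<Omega>" "c \<in> \<Omega>" "d \<in> \<Omega>" "e \<odot> y = y" "y \<odot> e = y" "y \<odot> c = e" "d \<odot> y = e" for y c d
  proof -
    have "e \<odot> c \<odot> e = d \<odot> y \<odot> (c \<odot> e)"
      using y e\<Omega> by (simp add: mul_assoc mul_closed)
    also have "\<dots> = d \<odot> (y \<odot> c) \<odot> e"
      using y(1-3) e\<Omega> by (simp add: mul_assoc mul_closed)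
    also have "\<dots> = d \<odot> e"
      using y(3) e\<Omega> ee by (simp add: y(6) mul_assoc)
    finally have de: "e \<odot> c \<odot> e = d \<odot> e" .
    let ?z = "e \<odot> c \<odot> e"
    have z: "?z \<in> \<Omega>" "e \<odot> ?z = ?z" "?z \<odot> e = ?z"
      using mul_assoc[OF e\<Omega> e\<Omega> mul_closed[OF y(2) e\<Omega>]] mul_assoc[OF mul_closed[OF e\<Omega> y(2)] e\<Omega> e\<Omega>] y(2) e\<Omega> ee
      by (simp_all add: mul_closed mul_assoc)
    have "y \<odot> ?z = y \<odot> e \<odot> c \<odot> e"
      using y(1,2) e\<Omega> by (simp add: mul_assoc mul_closed)
    also have "\<dots> = e"
      by (simp only: y(5,6) ee)
    finally have 1: "y \<odot> ?z = e" .
    have "?z \<odot> y = d \<odot> (e \<odot> y)"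
      unfolding de using y(1,3) e\<Omega> by (intro mul_assoc)
    also have "\<dots> = e"
      by (simp only: y(4,7))
    finally have 2: "?z \<odot> y = e" .
    have "y \<in> K"
      unfolding K_def using y z 1 2 by blast
    then show ?thesis by (simp add: KH)
  qed
  then show ?thesis
    using e sub ee by blast
qed

end

section \<open>The J-class of a recurrent language\<close>

locale recurrent_language = free_pro_V +
  fixes L :: "'a list set"
  assumes L_words: "L \<subseteq> words A"
    and L_factor: "x \<in> L \<Longrightarrow> x = p @ y @ q \<Longrightarrow> y \<noteq> [] \<Longrightarrow> y \<in> L"
    and L_unbounded: "\<exists>w\<in>L. K \<le> length w"
    and L_recurrent: "x \<in> L \<Longrightarrow> \<exists>K. \<forall>w\<in>L. K \<le> length w \<longrightarrow> (\<exists>s t. w = s @ x @ t \<and> s \<noteq> [] \<and> t \<noteq> [])"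
    and L_connect: "x \<in> L \<Longrightarrow> y \<in> L \<Longrightarrow> \<exists>t. t \<noteq> [] \<and> x @ t @ y \<in> L"
begin

definition L_inf :: "(nat sgp \<times> ('a list \<Rightarrow> nat) \<Rightarrow> nat) set" where
  "L_inf = (proV_top V A closure_of (\<iota> ` L)) - \<iota> ` L"

lemma L_inf_carrier: "z \<in> L_inf \<Longrightarrow> z \<in> \<Omega>"
  by (simp add: L_inf_def in_closure_of topspace_proV)

text \<open>If the words of \<open>L\<close> were almost everywhere one word \<open>v\<close>, the
  limit would be the image of \<open>v\<close>, which is excluded from \<open>L_inf\<close>; so
  their lengths tend to infinity.\<close>

lemma L_inf_wlim:
  assumes "z \<in> L_inf"
  obtains w where "\<forall>p. w p \<in> L" "wlim w z" "\<forall>M. \<forall>\<^sub>F p in U. M \<le> length (w p)"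
proof -
  have cl: "z \<in> proV_top V A closure_of (\<iota> ` L)" and notL: "z \<notin> \<iota> ` L"
    using assms by (simp_all add: L_inf_def)
  obtain w where w: "\<And>p. w p \<in> L" "wlim w z"
    using wlim_in[OF L_inf_carrier[OF assms] L_words closure_word[OF cl]] by blast
  have "\<not> (\<exists>v\<in>words A. \<forall>\<^sub>F p in U. w p = v)"
  proof
    assume "\<exists>v\<in>words A. \<forall>\<^sub>F p in U. w p = v"
    then obtain v where v: "v \<in> words A" "\<forall>\<^sub>F p in U. w p = v" by blast
    have "z = \<iota> v"
      by (rule wlim_unique[OF wlim_cong[OF w(2) v(2)] wlim_const[OF v(1)]])
    moreover have "v \<in> L"
      using U_ex[OF v(2)] w(1) by auto
    ultimately show False
      using notL by blast
  qed
  then have "\<forall>M. \<forall>\<^sub>F p in U. M \<le> length (w p)"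
    using wlim_long_or_word[OF w(2)] by (elim disjE) simp_all
  with w show ?thesis by (intro that[of w]) simp_all
qed

lemma L_infI:
  assumes w: "wlim w z" and L: "\<forall>\<^sub>F p in U. w p \<in> L" and long: "\<And>M. \<forall>\<^sub>F p in U. M \<le> length (w p)"
  shows "z \<in> L_inf"
  unfolding L_inf_def
proof (intro DiffI notI)
  show "z \<in> proV_top V A closure_of (\<iota> ` L)"
  proof (rule in_closureI[OF wlim_carrier[OF w] L_words])
    fix j assume "j \<in> I"
    from L wlim_coord[OF w this] have "\<forall>\<^sub>F p in U. w p \<in> L \<and> snd j (w p) = z j"
      by eventually_elim simp
    from U_ex[OF this] show "\<exists>v\<in>L. snd j v = z j" by blast
  qed
  assume "z \<in> \<iota> ` L"
  then show False
    using wlim_long_not_word[OF w long] L_words by blast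
qed

lemma L_inf_nonempty: "\<exists>z. z \<in> L_inf"
proof -
  have "\<exists>w. \<forall>n. w n \<in> L \<and> n \<le> length (w n)"
    by (rule choice) (use L_unbounded in blast)
  then obtain w where w: "\<And>n. w n \<in> L" "\<And>n. n \<le> length (w n)"
    by blast
  \<comment> \<open>The second component of \<open>p\<close> tends to infinity along
    \<open>U\<close>, which makes the chosen words arbitrarily long.\<close>
  obtain z where z: "wlim (\<lambda>p. w (snd p)) z"
    using wlim_ex[of "\<lambda>p. w (snd p)"] subsetD[OF L_words w(1)] by auto
  have "\<forall>\<^sub>F p in U. M \<le> length (w (snd p))" for M
    using U(3)[of M] by eventually_elim (use w(2) order_trans in blast)
  then have "z \<in> L_inf"
    by (intro L_infI[OF z]) (simp_all add: w(1))
  then show ?thesis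
    by (intro exI)
qed

text \<open>In a finite quotient \<open>y\<close> is represented by some \<open>v\<close> in
  \<open>L\<close>, which by recurrence occurs, properly surrounded, in the long words approximating
  \<open>z\<close>; \<open>solve_factor\<close> passes to the limit. By symmetry all of
  \<open>L_inf\<close> lies in one J-class.\<close>

lemma L_inf_below:
  assumes z: "z \<in> L_inf" and y: "y \<in> L_inf"
  shows "below z y"
  unfolding below_def
proof (rule solve_factor[OF L_inf_carrier[OF z] L_inf_carrier[OF y]])
  fix j assume j: "j \<in> I"
  have "y \<in> proV_top V A closure_of (\<iota> ` L)"
    using y by (simp add: L_inf_def)
  from closure_word[OF this j] obtain v where v: "v \<in> L" "snd j v = y j"
    by (rule bexE)
  from L_recurrent[OF v(1)]
  obtain K where K: "\<forall>w\<in>L. K \<le> length w \<longrightarrow> (\<exists>s t. w = s @ v @ t \<and> s \<noteq> [] \<and> t \<noteq> [])"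
    by (rule exE)
  obtain w where w': "\<forall>p. w p \<in> L" "wlim w z" "\<forall>M. \<forall>\<^sub>F p in U. M \<le> length (w p)"
    by (rule L_inf_wlim[OF z])
  note w = spec[OF w'(1)] w'(2) spec[OF w'(3)]
  from wlim_coord[OF w(2) j] w(3)[of K] have "\<forall>\<^sub>F p in U. snd j (w p) = z j \<and> K \<le> length (w p)"
    by eventually_elim simp
  from U_ex[OF this] obtain p where p: "snd j (w p) = z j" "K \<le> length (w p)"
    by blast
  obtain s t where st: "w p = s @ v @ t" "s \<noteq> []" "t \<noteq> []"
    using K[THEN bspec, OF w(1), THEN mp, OF p(2)] by (elim exE conjE)
  have "w p \<in> words A" "v \<in> words A"
    using subsetD[OF L_words w(1)] subsetD[OF L_words v(1)] by simp_all
  then have A: "s \<in> words A" "t \<in> words A" "v \<in> words A"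
    using st by (simp_all add: words_iff)
  have "z j = snd j s \<cdot>\<^bsub>fst j\<^esub> y j \<cdot>\<^bsub>fst j\<^esub> snd j t"
    using p(1) st(1) v(2) index_append[OF j, of "s @ v" t] index_append[OF j, of s v] A
    by (simp add: words_append)
  then show "\<exists>s\<in>words A. \<exists>t\<in>words A. z j = snd j s \<cdot>\<^bsub>fst j\<^esub> y j \<cdot>\<^bsub>fst j\<^esub> snd j t"
    by (rule bexI[OF bexI[OF _ A(2)] A(1)])
qed

definition J_inf :: "(nat sgp \<times> ('a list \<Rightarrow> nat) \<Rightarrow> nat) set" where
  "J_inf = {x \<in> \<Omega>. \<exists>z\<in>L_inf. below x z \<and> below z x}"

lemma J_inf_carrier: "x \<in> J_inf \<Longrightarrow> x \<in> \<Omega>"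
  by (simp add: J_inf_def)

lemma L_inf_J_inf: "z \<in> L_inf \<Longrightarrow> z \<in> J_inf"
  using L_inf_carrier L_inf_below unfolding J_inf_def by blast

lemma J_inf_below:
  assumes "x \<in> J_inf" "y \<in> J_inf"
  shows "below x y"
proof -
  obtain z where z: "z \<in> L_inf" "below x z"
    using assms(1) unfolding J_inf_def by blast
  obtain z' where z': "z' \<in> L_inf" "below z' y"
    using assms(2) unfolding J_inf_def by blast
  have "below x z'"
    using below_trans[OF z(2) L_inf_below[OF z(1) z'(1)] L_inf_carrier[OF z'(1)]] .
  then show ?thesis
    by (rule below_trans[OF _ z'(2) J_inf_carrier[OF assms(2)]])
qed

lemma J_infI:
  assumes "y \<in> J_inf" "x \<in> \<Omega>" "below x y" "below y x"
  shows "x \<in> J_inf"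
proof -
  obtain z where z: "z \<in> L_inf" "below y z" "below z y"
    using assms(1) unfolding J_inf_def by blast
  have "below x z" "below z x"
    using below_trans[OF assms(3) z(2) L_inf_carrier[OF z(1)]] below_trans[OF z(3) assms(4,2)] by simp_all
  with z(1) assms(2) show ?thesis
    unfolding J_inf_def by blast
qed

text \<open>Stability: leaving the R-class of \<open>x\<close> by right multiplication means leaving
  the J-class.\<close>

lemma J_inf_right:
  assumes "x \<in> J_inf" "s \<in> \<Omega>" "x \<odot> s \<in> J_inf"
  shows "\<exists>c\<in>\<Omega>. x = x \<odot> s \<odot> c"
proof -
  note x = J_inf_carrier[OF assms(1)]
  obtain a b where ab: "a \<in> \<Omega>" "b \<in> \<Omega>" "x = a \<odot> (x \<odot> s) \<odot> b"
    using J_inf_below[OF assms(1,3)] by (rule belowE)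
  have "a \<odot> (x \<odot> (s \<odot> b)) = x"
    using ab x assms(2) by (simp add: mul_assoc mul_closed)
  then obtain c where "c \<in> \<Omega>" "x = x \<odot> (s \<odot> b \<odot> c)"
    using stable_right[OF x ab(1) mul_closed[OF assms(2) ab(2)]] by blast
  then show ?thesis
    using x assms(2) ab(2) by (intro bexI[of _ "b \<odot> c"]) (simp_all add: mul_assoc mul_closed)
qed

lemma J_inf_left:
  assumes "x \<in> J_inf" "s \<in> \<Omega>" "s \<odot> x \<in> J_inf"
  shows "\<exists>c\<in>\<Omega>. x = c \<odot> (s \<odot> x)"
proof -
  note x = J_inf_carrier[OF assms(1)]
  obtain a b where ab: "a \<in> \<Omega>" "b \<in> \<Omega>" "x = a \<odot> (s \<odot> x) \<odot> b"
    using J_inf_below[OF assms(1,3)] by (rule belowE)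
  have "a \<odot> s \<odot> (x \<odot> b) = x"
    using ab x assms(2) by (simp add: mul_assoc mul_closed)
  then obtain c where "c \<in> \<Omega>" "x = c \<odot> (a \<odot> s) \<odot> x"
    using stable_left[OF x mul_closed[OF ab(1) assms(2)] ab(2)] by blast
  then show ?thesis
    using x assms(2) ab(1) by (intro bexI[of _ "c \<odot> a"]) (simp_all add: mul_assoc mul_closed)
qed

lemma J_inf_eq:
  assumes "z \<in> L_inf"
  shows "J_inf = {y \<in> carrier (proV V A). sgp_ideal (proV V A) y = sgp_ideal (proV V A) z}"
proof (intro equalityI subsetI)
  fix y assume y: "y \<in> J_inf"
  have "sgp_ideal (proV V A) y = sgp_ideal (proV V A) z"
    using below_ideal_subset[OF J_inf_below[OF y L_inf_J_inf[OF assms]] L_inf_carrier[OF assms]]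
      below_ideal_subset[OF J_inf_below[OF L_inf_J_inf[OF assms] y] J_inf_carrier[OF y]] by (rule equalityI)
  then show "y \<in> {y \<in> carrier (proV V A). sgp_ideal (proV V A) y = sgp_ideal (proV V A) z}"
    using J_inf_carrier[OF y] by (simp add: carrier_proV)
next
  fix y assume "y \<in> {y \<in> carrier (proV V A). sgp_ideal (proV V A) y = sgp_ideal (proV V A) z}"
  then have y: "y \<in> \<Omega>" "sgp_ideal (proV V A) y = sgp_ideal (proV V A) z"
    by (simp_all add: carrier_proV)
  have "w \<in> sgp_ideal (proV V A) w" for w
    by (simp add: sgp_ideal_def)
  then have "y \<in> sgp_ideal (proV V A) z" "z \<in> sgp_ideal (proV V A) y"
    using y(2) by metis+
  then have "below y z" "below z y"
    using ideal_below_lower[OF _ L_inf_below[OF assms assms] L_inf_carrier[OF assms]]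
      ideal_below_upper[OF _ L_inf_below[OF assms assms] y(1)] by simp_all
  then show "y \<in> J_inf"
    using y(1) assms unfolding J_inf_def by blast
qed

text \<open>With connecting words \<open>s p\<close> such that \<open>w p @ s p @ w p\<close> is in
  \<open>L\<close>, the limit \<open>z \<odot> (t \<odot> z)\<close> is again in
  \<open>L_inf\<close>; stability on both sides then cancels it down to \<open>z\<close>.\<close>

lemma L_inf_regular:
  assumes z: "z \<in> L_inf"
  shows "\<exists>r\<in>\<Omega>. z = z \<odot> r \<odot> z"
proof -
  obtain w where w': "\<forall>p. w p \<in> L" "wlim w z" "\<forall>M. \<forall>\<^sub>F p in U. M \<le> length (w p)"
    by (rule L_inf_wlim[OF z])
  note w = spec[OF w'(1)] w'(2) spec[OF w'(3)]
  have "\<exists>s. \<forall>p. s p \<noteq> [] \<and> w p @ s p @ w p \<in> L"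
    by (rule choice) (use L_connect w(1) in blast)
  then obtain s where s: "\<And>p. s p \<noteq> []" "\<And>p. w p @ s p @ w p \<in> L"
    by blast
  have sA: "s p \<in> words A" for p
    using subsetD[OF L_words s(2)[of p]] s(1)[of p] by (simp add: words_iff)
  obtain t where t: "wlim s t"
    using wlim_ex[of s] sA by auto
  note tc = wlim_carrier[OF t] and zc = wlim_carrier[OF w(2)]
  have lim: "wlim (\<lambda>p. w p @ s p @ w p) (z \<odot> (t \<odot> z))"
    by (intro wlim_append w(2) t)
  have "\<forall>\<^sub>F p in U. M \<le> length (w p @ s p @ w p)" for M
    using w(3)[of M] by eventually_elim simp
  then have ztz: "z \<odot> (t \<odot> z) \<in> J_inf"
    by (intro L_inf_J_inf L_infI[OF lim]) (simp_all add: s(2))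
  obtain c where c: "c \<in> \<Omega>" "z = z \<odot> (t \<odot> z) \<odot> c"
    using J_inf_right[OF L_inf_J_inf[OF z] mul_closed[OF tc zc] ztz] by blast
  have "z \<odot> t \<odot> z \<in> J_inf"
    using ztz tc zc by (simp add: mul_assoc)
  then obtain d where d: "d \<in> \<Omega>" "z = d \<odot> (z \<odot> t \<odot> z)"
    using J_inf_left[OF L_inf_J_inf[OF z] mul_closed[OF zc tc]] by blast
  have "z \<odot> (t \<odot> d) \<odot> z = z \<odot> (t \<odot> d) \<odot> (z \<odot> (t \<odot> z) \<odot> c)"
    using c(2) by simp
  also have "\<dots> = z \<odot> (t \<odot> (d \<odot> (z \<odot> t \<odot> z))) \<odot> c"
    using tc zc c(1) d(1) by (simp add: mul_assoc mul_closed)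
  also have "\<dots> = z \<odot> (t \<odot> z) \<odot> c"
    by (simp only: d(2)[symmetric])
  also have "\<dots> = z"
    by (simp only: c(2)[symmetric])
  finally show ?thesis
    using tc d(1) by (intro bexI[of _ "t \<odot> d"]) (simp_all add: mul_closed)
qed

text \<open>Regularity is carried from \<open>z\<close> to \<open>x = c \<odot> z \<odot> d\<close>
  through \<open>z \<odot> d\<close>, which is R-related to \<open>z\<close> and L-related to
  \<open>x\<close>.\<close>

lemma J_inf_regular: "regular_class (proV V A) J_inf"
  unfolding regular_class_def carrier_proV
proof
  fix x assume xJ: "x \<in> J_inf"
  note x = J_inf_carrier[OF xJ]
  obtain z where z: "z \<in> L_inf" using L_inf_nonempty by blast
  note zJ = L_inf_J_inf[OF z]
  note zc = L_inf_carrier[OF z]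
  obtain r where r: "r \<in> \<Omega>" "z = z \<odot> r \<odot> z"
    using L_inf_regular[OF z] by blast
  obtain c d where cd: "c \<in> \<Omega>" "d \<in> \<Omega>" "x = c \<odot> z \<odot> d"
    using J_inf_below[OF xJ zJ] by (rule belowE)
  obtain a b where ab: "a \<in> \<Omega>" "b \<in> \<Omega>" "z = a \<odot> z \<odot> b"
    using L_inf_below[OF z z] by (rule belowE)
  obtain p q where pq: "p \<in> \<Omega>" "q \<in> \<Omega>" "z = p \<odot> x \<odot> q"
    using J_inf_below[OF zJ xJ] by (rule belowE)
  have "z \<odot> d = a \<odot> z \<odot> (b \<odot> d)"
    by (subst ab(3)) (simp add: ab(1,2) zc cd(2) mul_assoc mul_closed)
  then have "below (z \<odot> d) z"
    by (rule belowI[OF ab(1) mul_closed[OF ab(2) cd(2)]])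
  moreover have "p \<odot> x \<odot> q = (p \<odot> c) \<odot> (z \<odot> d) \<odot> q"
    unfolding cd(3) by (simp add: pq(1,2) cd(1,2) zc mul_assoc mul_closed)
  with pq(3) have "z = (p \<odot> c) \<odot> (z \<odot> d) \<odot> q"
    by (rule trans)
  then have "below z (z \<odot> d)"
    by (rule belowI[OF mul_closed[OF pq(1) cd(1)] pq(2)])
  ultimately have zd: "z \<odot> d \<in> J_inf"
    by (intro J_infI[OF zJ mul_closed[OF zc cd(2)]])
  obtain d' where d': "d' \<in> \<Omega>" "z = z \<odot> d \<odot> d'"
    using J_inf_right[OF zJ cd(2) zd] by blast
  have cx: "c \<odot> (z \<odot> d) = x"
    using cd(3) by (simp add: cd(1,2) zc mul_assoc)
  then obtain c' where c': "c' \<in> \<Omega>" "z \<odot> d = c' \<odot> x"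
    using J_inf_left[OF zd cd(1)] xJ by auto
  have "x \<odot> (d' \<odot> r \<odot> c') \<odot> x = x \<odot> (d' \<odot> r) \<odot> (c' \<odot> x)"
    using x d'(1) r(1) c'(1) by (simp add: mul_assoc mul_closed)
  also have "\<dots> = c \<odot> (z \<odot> d) \<odot> (d' \<odot> r) \<odot> (z \<odot> d)"
    by (simp only: cx c'(2)[symmetric])
  also have "\<dots> = c \<odot> (z \<odot> d \<odot> d' \<odot> r \<odot> z) \<odot> d"
    using zc cd(1,2) d'(1) r(1) by (simp add: mul_assoc mul_closed)
  also have "\<dots> = x"
    by (simp only: d'(2)[symmetric] r(2)[symmetric] cd(3))
  finally show "\<exists>s\<in>\<Omega>. x = x \<odot> s \<odot> x"
    using d'(1) r(1) c'(1) by (intro bexI[of _ "d' \<odot> r \<odot> c'"]) (simp_all add: mul_closed)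
qed

text \<open>Justifies the description in \<open>J_V\<close>: a J-class containing the nonempty
  \<open>L_inf\<close> is determined by any element of it.\<close>

lemma J_inf_unique:
  "(THE J. J \<in> J_classes (proV V A) \<and> regular_class (proV V A) J \<and>
    (proV_top V A closure_of (\<iota> ` L)) - \<iota> ` L \<subseteq> J) = J_inf"
  unfolding L_inf_def[symmetric]
proof (rule the_equality)
  obtain z where z: "z \<in> L_inf" using L_inf_nonempty by blast
  have zc: "z \<in> carrier (proV V A)"
    using L_inf_carrier[OF z] by (simp add: carrier_proV)
  show "J_inf \<in> J_classes (proV V A) \<and> regular_class (proV V A) J_inf \<and> L_inf \<subseteq> J_inf"
  proof (intro conjI J_inf_regular subsetI L_inf_J_inf)
    show "J_inf \<in> J_classes (proV V A)"
      unfolding J_classes_def J_inf_eq[OF z] using zc by blast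
  qed
  fix J assume J: "J \<in> J_classes (proV V A) \<and> regular_class (proV V A) J \<and> L_inf \<subseteq> J"
  then obtain x where x: "J = {y \<in> carrier (proV V A). sgp_ideal (proV V A) y = sgp_ideal (proV V A) x}"
    unfolding J_classes_def by blast
  have "z \<in> J"
    using J z by blast
  then have "sgp_ideal (proV V A) z = sgp_ideal (proV V A) x"
    unfolding x by simp
  then show "J = J_inf"
    unfolding x J_inf_eq[OF z] by simp
qed

end

text \<open>Only finitely many words have length at most \<open>m\<close>, so the ultrafilter
  selects one prefix and one suffix.\<close>

lemma (in free_pro_V) wlim_prefix:
  assumes "wlim w x" "\<And>M. \<forall>\<^sub>F p in U. M \<le> length (w p)"
  shows "\<exists>v. length v = m \<and> (\<forall>\<^sub>F p in U. prefix v (w p))"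
    and "\<exists>u. length u = m \<and> (\<forall>\<^sub>F p in U. suffix u (w p))"
proof -
  let ?B = "{v. set v \<subseteq> A \<and> length v \<le> m}"
  have wA: "\<forall>\<^sub>F p in U. w p \<in> words A"
    using assms(1) by (simp add: wlim_def)
  have "\<forall>\<^sub>F p in U. take m (w p) \<in> ?B"
    using wA by eventually_elim (auto simp: words_iff dest!: in_set_takeD)
  from ultrafilter_finite[OF U(1) finite_lists_length_le[OF finA] this]
  obtain v where v: "\<forall>\<^sub>F p in U. take m (w p) = v"
    by (rule bexE)
  have "\<forall>\<^sub>F p in U. length v = m"
    using v assms(2)[of m] by eventually_elim auto
  then have "length v = m"
    by (rule U_const)
  moreover have "\<forall>\<^sub>F p in U. prefix v (w p)"
    using v by eventually_elim (auto simp: take_is_prefix)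
  ultimately show "\<exists>v. length v = m \<and> (\<forall>\<^sub>F p in U. prefix v (w p))"
    by (intro exI conjI)
  have "\<forall>\<^sub>F p in U. take m (rev (w p)) \<in> ?B"
    using wA by eventually_elim (auto simp: words_iff dest!: in_set_takeD)
  from ultrafilter_finite[OF U(1) finite_lists_length_le[OF finA] this]
  obtain u where u: "\<forall>\<^sub>F p in U. take m (rev (w p)) = u"
    by (rule bexE)
  have "\<forall>\<^sub>F p in U. length (rev u) = m"
    using u assms(2)[of m] by eventually_elim auto
  then have "length (rev u) = m"
    by (rule U_const)
  moreover have "\<forall>\<^sub>F p in U. suffix (rev u) (w p)"
    using u by eventually_elim (auto simp: suffix_to_prefix take_is_prefix)
  ultimately show "\<exists>u. length u = m \<and> (\<forall>\<^sub>F p in U. suffix u (w p))"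
    by (intro exI conjI)
qed

section \<open>Synchronization by prefixes and suffixes of the idempotent\<close>

context recurrent_language
begin

text \<open>By idempotence \<open>w p @ w p\<close> also approximates \<open>e\<close>, and it
  contains \<open>u @ v\<close> across the middle. Since \<open>e\<close> is a factor of some
  \<open>z\<close> in \<open>L_inf\<close>, testing factors of length \<open>length (u @ v)\<close>
  transfers the occurrence to words of \<open>L\<close>.\<close>

lemma factor_in_L:
  assumes e: "e \<in> J_inf" "e \<odot> e = e" and w: "wlim w e"
    and u: "\<forall>\<^sub>F p in U. suffix u (w p)" "u \<noteq> []" and v: "\<forall>\<^sub>F p in U. prefix v (w p)"
  shows "u @ v \<in> L"
proof -
  obtain z where z: "z \<in> L_inf" using L_inf_nonempty by blast
  obtain y where y: "\<forall>p. y p \<in> L" "wlim y z" "\<forall>M. \<forall>\<^sub>F p in U. M \<le> length (y p)"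
    by (rule L_inf_wlim[OF z])
  obtain a b where ab: "a \<in> \<Omega>" "b \<in> \<Omega>" "z = a \<odot> e \<odot> b"
    using J_inf_below[OF L_inf_J_inf[OF z] e(1)] by (rule belowE)
  obtain wa where wa: "wlim wa a" using wlim_words[OF ab(1)] by blast
  obtain wb where wb: "wlim wb b" using wlim_words[OF ab(2)] by blast
  have "wlim (\<lambda>p. (wa p @ (w p @ w p)) @ wb p) z"
    using wlim_append[OF wlim_append[OF wa wlim_append[OF w w]] wb] ab(3) e(2) by simp
  from wlim_k_test[OF this y(2), of "length (u @ v)"] u(1) v
  have "\<forall>\<^sub>F p in U. sublist (u @ v) (y p)"
  proof eventually_elim
    case (elim p)
    then obtain s t where "w p = s @ u" "w p = v @ t"
      by (auto simp: suffix_def prefix_def)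
    then have "(wa p @ (w p @ w p)) @ wb p = (wa p @ s) @ (u @ v) @ (t @ wb p)"
      by (metis append_assoc)
    then have "sublist (u @ v) ((wa p @ (w p @ w p)) @ wb p)"
      by (metis sublist_appendI)
    then have "u @ v \<in> {x. length x \<le> length (u @ v) \<and> sublist x ((wa p @ (w p @ w p)) @ wb p)}"
      by blast
    also have "\<dots> = {x. length x \<le> length (u @ v) \<and> sublist x (y p)}"
      using elim(1) unfolding k_test_def prod.inject by blast
    finally show ?case by blast
  qed
  from U_ex[OF this] obtain p where "sublist (u @ v) (y p)"
    by (rule exE)
  then obtain s t where "y p = s @ (u @ v) @ t"
    by (auto simp: sublist_def)
  then show ?thesis
    using L_factor[OF spec[OF y(1)]] u(2) by blast
qed

text \<open>In the last property the coordinate \<open>j\<close> decides membership in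
  \<open>C\<close>. If counterexamples existed for all \<open>m\<close>, a diagonal limit
  \<open>x\<close> of them would share with \<open>e\<close> a left factor and a right factor from
  the J-class, hence be a unit of the local monoid at \<open>e\<close> and lie in
  \<open>H\<close>.\<close>

lemma sync_words:
  assumes H: "maximal_subgroup (proV V A) H" "H \<subseteq> J_inf"
  obtains u v :: "nat \<Rightarrow> 'a list" where "\<And>m. length (u m) = m" "\<And>m. length (v m) = m"
    "\<And>m m'. m \<le> m' \<Longrightarrow> suffix (u m) (u m')" "\<And>m m'. m \<le> m' \<Longrightarrow> prefix (v m) (v m')"
    "\<And>m. m > 0 \<Longrightarrow> u m @ v m \<in> L"
    "\<And>j C. j \<in> I \<Longrightarrow> (\<And>w. w \<in> words A \<Longrightarrow> snd j w \<in> snd j ` C \<Longrightarrow> w \<in> C) \<Longrightarrow>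
      (\<And>x. x \<in> H \<Longrightarrow> x j \<in> snd j ` C) \<Longrightarrow>
      \<exists>m>0. \<forall>w\<in>L. prefix (v m) w \<longrightarrow> suffix (u m) w \<longrightarrow> w \<in> C"
proof -
  obtain e where e: "e \<in> H" "H \<subseteq> \<Omega>" "e \<odot> e = e"
    and units: "\<forall>y\<in>\<Omega>. \<forall>c\<in>\<Omega>. \<forall>d\<in>\<Omega>. e \<odot> y = y \<longrightarrow> y \<odot> e = y \<longrightarrow> y \<odot> c = e \<longrightarrow> d \<odot> y = e \<longrightarrow> y \<in> H"
    using maximal_subgroup_units[OF H(1)] by (elim bexE conjE)
  have eJ: "e \<in> J_inf" and e\<Omega>: "e \<in> \<Omega>"
    using e H(2) by blast+
  obtain w where w: "\<And>p. w p \<in> words A" "wlim w e"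
    using wlim_words[OF e\<Omega>] by blast
  \<comment> \<open>An idempotent is not a word \<open>x\<close>: otherwise \<open>x\<close> and
    \<open>x @ x\<close> would represent the same element, and no \<open>k_test\<close> could tell
    them apart.\<close>
  have "\<not> (\<exists>x\<in>words A. \<forall>\<^sub>F p in U. w p = x)"
  proof
    assume "\<exists>x\<in>words A. \<forall>\<^sub>F p in U. w p = x"
    then obtain x where x: "x \<in> words A" "\<forall>\<^sub>F p in U. w p = x" by blast
    have "wlim (\<lambda>p. x) e"
      by (rule wlim_cong[OF w(2) x(2)])
    moreover from wlim_append[OF this this] have "wlim (\<lambda>p. x @ x) e"
      by (simp add: e(3))
    ultimately have "\<forall>\<^sub>F p in U. k_test (Suc (length x)) x = k_test (Suc (length x)) (x @ x)"
      by (rule wlim_k_test)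
    from k_test_short[OF U_const[OF this]] have "x @ x = x"
      by simp
    with x(1) show False
      by (simp add: words_iff)
  qed
  then have long: "\<forall>\<^sub>F p in U. M \<le> length (w p)" for M
    using wlim_long_or_word[OF w(2)] by (elim disjE) simp_all
  have "\<forall>m. \<exists>v. length v = m \<and> (\<forall>\<^sub>F p in U. prefix v (w p))"
    using wlim_prefix(1)[OF w(2) long] by (intro allI)
  from choice[OF this] obtain v where v: "\<And>m. length (v m) = m" "\<And>m. \<forall>\<^sub>F p in U. prefix (v m) (w p)"
    by blast
  have "\<forall>m. \<exists>u. length u = m \<and> (\<forall>\<^sub>F p in U. suffix u (w p))"
    using wlim_prefix(2)[OF w(2) long] by (intro allI)
  from choice[OF this] obtain u where u: "\<And>m. length (u m) = m" "\<And>m. \<forall>\<^sub>F p in U. suffix (u m) (w p)"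
    by blast
  have vm: "prefix (v m) (v m')" if "m \<le> m'" for m m'
  proof -
    from v(2)[of m] v(2)[of m'] have "\<forall>\<^sub>F p in U. prefix (v m) (v m')"
      by eventually_elim (use that v(1) in \<open>auto intro: prefix_length_prefix\<close>)
    then show ?thesis by (rule U_const)
  qed
  have um: "suffix (u m) (u m')" if "m \<le> m'" for m m'
  proof -
    from u(2)[of m] u(2)[of m'] have "\<forall>\<^sub>F p in U. suffix (u m) (u m')"
      by eventually_elim (use that u(1) in \<open>auto intro: suffix_length_suffix\<close>)
    then show ?thesis by (rule U_const)
  qed
  have uv: "u m @ v m \<in> L" if "m > 0" for m
    by (rule factor_in_L[OF eJ e(3) w(2) u(2) _ v(2)]) (use u(1)[of m] that in auto)
  have main: "\<exists>m>0. \<forall>w\<in>L. prefix (v m) w \<longrightarrow> suffix (u m) w \<longrightarrow> w \<in> C"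
    if j: "j \<in> I" and C: "\<And>w. w \<in> words A \<Longrightarrow> snd j w \<in> snd j ` C \<Longrightarrow> w \<in> C"
      and HC: "\<And>x. x \<in> H \<Longrightarrow> x j \<in> snd j ` C" for j C
  proof (rule ccontr)
    assume "\<not> ?thesis"
    then have "\<forall>m. \<exists>y. m > 0 \<longrightarrow> y \<in> L \<and> prefix (v m) y \<and> suffix (u m) y \<and> y \<notin> C"
      by blast
    from choice[OF this] obtain y where y: "\<And>m. m > 0 \<Longrightarrow> y m \<in> L"
      "\<And>m. m > 0 \<Longrightarrow> prefix (v m) (y m)" "\<And>m. m > 0 \<Longrightarrow> suffix (u m) (y m)" "\<And>m. m > 0 \<Longrightarrow> y m \<notin> C"
      by blast
    \<comment> \<open>The maximum \<open>M p\<close> is a diagonal length: the bound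
      \<open>snd p\<close> makes \<open>Q p\<close> finite, and staying below
      \<open>length (w p)\<close> keeps what remains after removing \<open>v (M p)\<close> or
      \<open>u (M p)\<close> nonempty.\<close>
    define Q where "Q p = {n. n \<le> snd p \<and> n < length (w p) \<and> prefix (v n) (w p) \<and> suffix (u n) (w p)}"
      for p
    define M where "M p = Max (Q p)" for p
    have fin: "finite (Q p)" for p
      by (rule finite_subset[of _ "{..snd p}"]) (auto simp: Q_def)
    have zero: "0 \<in> Q p" for p
      using w(1)[of p] u(1)[of 0] v(1)[of 0] by (simp add: Q_def words_iff)
    have "M p \<in> Q p" for p
      unfolding M_def by (rule Max_in[OF fin]) (use zero[of p] in blast)
    then have M: "M p < length (w p)" "prefix (v (M p)) (w p)" "suffix (u (M p)) (w p)" for p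
      by (simp_all add: Q_def)
    have M_ge: "\<forall>\<^sub>F p in U. n \<le> M p" for n
      using U(3)[of n] long[of "Suc n"] v(2)[of n] u(2)[of n]
    proof eventually_elim
      case (elim p)
      then have "n \<in> Q p"
        by (simp add: Q_def)
      then show ?case
        unfolding M_def by (intro Max_ge fin)
    qed
    \<comment> \<open>The successor makes the index positive and \<open>Y p\<close> longer than
      \<open>M p\<close>, so that remainders are nonempty here too.\<close>
    define Y where "Y p = y (Suc (M p))" for p
    have Y: "Y p \<in> L" "Y p \<notin> C" "prefix (v (M p)) (Y p)" "suffix (u (M p)) (Y p)" "M p < length (Y p)" for p
      using y[of "Suc (M p)"] prefix_order.trans[OF vm[of "M p" "Suc (M p)"]]
        suffix_order.trans[OF um[of "M p" "Suc (M p)"]] prefix_length_le[of "v (Suc (M p))"] v(1)[of "Suc (M p)"]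
      by (simp_all add: Y_def Suc_le_eq)
    have split: "\<exists>s t. s \<in> words A \<and> t \<in> words A \<and> x = v (M p) @ s \<and> x = t @ u (M p)"
      if x: "x \<in> words A" "prefix (v (M p)) x" "suffix (u (M p)) x" "M p < length x" for x p
    proof -
      obtain s where s: "x = v (M p) @ s"
        using x(2) unfolding prefix_def by (rule exE)
      obtain t where t: "x = t @ u (M p)"
        using x(3) unfolding suffix_def by (rule exE)
      note st = s t
      have "length x = M p + length s" "length x = length t + M p"
        using arg_cong[OF st(1), of length] arg_cong[OF st(2), of length] by (simp_all add: u v)
      moreover have "set s \<subseteq> set x" "set t \<subseteq> set x"
        using arg_cong[OF st(1), of set] arg_cong[OF st(2), of set] by auto
      ultimately have "s \<in> words A" "t \<in> words A"
        using x(1,4) by (auto simp: words_iff)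
      with st show ?thesis by blast
    qed
    have "\<forall>p. \<exists>s. s \<in> words A \<and> (\<exists>t. t \<in> words A \<and> w p = v (M p) @ s \<and> w p = t @ u (M p))"
      using split[OF w(1) M(2,3,1)] by blast
    from choice[OF this] obtain s where s: "\<And>p. s p \<in> words A"
      and "\<forall>p. \<exists>t. t \<in> words A \<and> w p = v (M p) @ s p \<and> w p = t @ u (M p)" by blast
    from choice[OF this(2)] obtain t where t: "\<And>p. t p \<in> words A"
      and st: "\<And>p. w p = v (M p) @ s p" "\<And>p. w p = t p @ u (M p)" by blast
    have "\<forall>p. \<exists>s. s \<in> words A \<and> (\<exists>t. t \<in> words A \<and> Y p = v (M p) @ s \<and> Y p = t @ u (M p))"
      using split[OF subsetD[OF L_words Y(1)] Y(3-5)] by blast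
    from choice[OF this] obtain s' where s': "\<And>p. s' p \<in> words A"
      and "\<forall>p. \<exists>t. t \<in> words A \<and> Y p = v (M p) @ s' p \<and> Y p = t @ u (M p)" by blast
    from choice[OF this(2)] obtain t' where t': "\<And>p. t' p \<in> words A"
      and st': "\<And>p. Y p = v (M p) @ s' p" "\<And>p. Y p = t' p @ u (M p)" by blast
    have uvL: "u m \<in> L" "v m \<in> L" if "m > 0" for m
      using L_factor[OF uv[OF that], of "[]" "u m" "v m"] L_factor[OF uv[OF that], of "u m" "v m" "[]"]
        u(1)[of m] v(1)[of m] that by fastforce+
    have vL: "\<forall>\<^sub>F p in U. v (M p) \<in> L" and uL: "\<forall>\<^sub>F p in U. u (M p) \<in> L"
      using M_ge[of 1] by (eventually_elim, simp add: uvL)+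
    have lims: "\<exists>x. wlim f x" if "\<forall>\<^sub>F p in U. f p \<in> L" for f
      by (rule wlim_ex[OF eventually_mono[OF that subsetD[OF L_words]]])
    have lims': "\<exists>x. wlim f x" if "\<And>p. f p \<in> words A" for f
      by (rule wlim_ex[OF always_eventually]) (use that in simp)
    obtain V where V: "wlim (\<lambda>p. v (M p)) V" using lims[OF vL] by (rule exE)
    obtain W where W: "wlim (\<lambda>p. u (M p)) W" using lims[OF uL] by (rule exE)
    obtain S where S: "wlim s S" using lims'[OF s] by (rule exE)
    obtain T where T: "wlim t T" using lims'[OF t] by (rule exE)
    obtain S' where S': "wlim s' S'" using lims'[OF s'] by (rule exE)
    obtain T' where T': "wlim t' T'" using lims'[OF t'] by (rule exE)
    obtain x where x: "wlim Y x" using lims[of Y] Y(1) by auto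
    note car = wlim_carrier[OF V] wlim_carrier[OF W] wlim_carrier[OF S] wlim_carrier[OF T]
      wlim_carrier[OF S'] wlim_carrier[OF T'] wlim_carrier[OF x]
    \<comment> \<open>\<open>w p\<close> and \<open>Y p\<close> share the prefix
      \<open>v (M p)\<close> and the suffix \<open>u (M p)\<close>, so \<open>e\<close> and
      \<open>x\<close> share the factors \<open>V\<close> and \<open>W\<close>; these lie in
      \<open>L_inf\<close> because \<open>M p\<close> tends to infinity.\<close>
    have eq: "e = V \<odot> S" "e = T \<odot> W" "x = V \<odot> S'" "x = T' \<odot> W"
      by (rule wlim_unique[OF w(2) wlim_append[OF V S, folded st(1)]]
        wlim_unique[OF w(2) wlim_append[OF T W, folded st(2)]]
        wlim_unique[OF x wlim_append[OF V S', folded st'(1)]]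
        wlim_unique[OF x wlim_append[OF T' W, folded st'(2)]])+
    have "V \<in> L_inf"
      by (rule L_infI[OF V vL]) (simp add: v(1) M_ge)
    then have VJ: "V \<in> J_inf" by (rule L_inf_J_inf)
    have "W \<in> L_inf"
      by (rule L_infI[OF W uL]) (simp add: u(1) M_ge)
    then have WJ: "W \<in> J_inf" by (rule L_inf_J_inf)
    have "\<forall>\<^sub>F p in U. n \<le> length (Y p)" for n
      using M_ge[of n] by eventually_elim (use Y(5) less_imp_le order_trans in blast)
    then have "x \<in> L_inf"
      by (intro L_infI[OF x]) (simp_all add: Y(1))
    then have xJ: "x \<in> J_inf" by (rule L_inf_J_inf)
    \<comment> \<open>By stability \<open>V\<close> is R-related to \<open>e\<close>, so
      \<open>e\<close> acts as a left identity on \<open>V\<close> and then on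
      \<open>x\<close>.\<close>
    obtain c where c: "c \<in> \<Omega>" "V = V \<odot> S \<odot> c"
      using J_inf_right[OF VJ car(3)] eJ eq(1) by auto
    have "e \<odot> V = e \<odot> (e \<odot> c)"
      using c(2) unfolding eq(1)[symmetric] by simp
    also have "\<dots> = e \<odot> c"
      using mul_assoc[OF e\<Omega> e\<Omega> c(1)] e(3) by simp
    also have "\<dots> = V"
      using c(2) unfolding eq(1)[symmetric] by simp
    finally have eV: "e \<odot> V = V" .
    obtain d where d: "d \<in> \<Omega>" "W = d \<odot> (T \<odot> W)"
      using J_inf_left[OF WJ car(4)] eJ eq(2) by auto
    have "W \<odot> e = d \<odot> e \<odot> e"
      using d(2) unfolding eq(2)[symmetric] by simp
    also have "\<dots> = d \<odot> e"
      using mul_assoc[OF d(1) e\<Omega> e\<Omega>] e(3) by simp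
    also have "\<dots> = W"
      using d(2) unfolding eq(2)[symmetric] by simp
    finally have We: "W \<odot> e = W" .
    have ex: "e \<odot> x = x"
      using mul_assoc[OF e\<Omega> car(1,5)] by (simp only: eq(3) eV)
    have xe: "x \<odot> e = x"
      using mul_assoc[OF car(6,2) e\<Omega>] by (simp only: eq(4) We)
    obtain c' where c': "c' \<in> \<Omega>" "e = e \<odot> x \<odot> c'"
      using J_inf_right[OF eJ car(7)] xJ ex by auto
    obtain d' where d': "d' \<in> \<Omega>" "e = d' \<odot> (x \<odot> e)"
      using J_inf_left[OF eJ car(7)] xJ xe by auto
    have "x \<in> H"
      using units car(7) c' d' ex xe by metis
    then have xC: "x j \<in> snd j ` C"
      by (rule HC)
    obtain p where "snd j (Y p) = x j"
      using U_ex[OF wlim_coord[OF x j]] by (rule exE)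
    then have "Y p \<in> C"
      using C[OF subsetD[OF L_words Y(1)[of p]]] xC by simp
    with Y(2) show False by blast
  qed
  show ?thesis
    by (rule that[OF u(1) v(1) um vm uv main])
qed

end

section \<open>Continuous extensions of homomorphisms\<close>

text \<open>Coordinate \<open>j\<close> of the extension is the coordinate of \<open>x\<close> at
  the quotient \<open>j\<close> composed with \<open>\<phi>\<close>, and there \<open>x\<close> is
  represented by a word.\<close>

lemma proV_ext_coord:
  assumes "free_pro_V V A" "free_pro_V V B" and \<phi>: "\<phi> \<in> sgp_hom (free_sgp B) (free_sgp A)"
    and x: "x \<in> proV_carrier V B" and j: "j \<in> proV_index V A"
  shows "\<exists>w\<in>words B. snd j (\<phi> w) = proV_ext V B A \<phi> x j"
proof -
  interpret a: free_pro_V V A by fact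
  interpret b: free_pro_V V B by fact
  \<comment> \<open>The candidate \<open>g\<close> below reads off the coordinates
    \<open>pull j\<close>; the rest verifies that it is the map described by
    \<open>proV_ext\<close>.\<close>
  define pull where "pull j = ((fst j)\<lparr>carrier := (\<lambda>w. snd j (\<phi> w)) ` words B\<rparr>,
    restrict (\<lambda>w. snd j (\<phi> w)) (words B))" for j :: "nat sgp \<times> ('a list \<Rightarrow> nat)"
  have \<phi>A: "\<phi> w \<in> words A" if "w \<in> words B" for w
    by (rule free_hom_closed[OF \<phi> that])
  have hom: "(\<lambda>w. snd j (\<phi> w)) \<in> sgp_hom (free_sgp B) (fst j)" if "j \<in> a.I" for j
  proof -
    have "snd j (\<phi> (v @ w)) = snd j (\<phi> v) \<cdot>\<^bsub>fst j\<^esub> snd j (\<phi> w)" if "v \<in> words B" "w \<in> words B" for v w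
      using free_hom_append[OF \<phi> that] a.index_append[OF \<open>j \<in> a.I\<close> \<phi>A[OF that(1)] \<phi>A[OF that(2)]] by simp
    then show ?thesis
      using a.index_closed[OF that \<phi>A] by (simp add: sgp_hom_def Pi_iff)
  qed
  have pull: "pull j \<in> b.I" if "j \<in> a.I" for j
    unfolding pull_def by (rule b.index_of_hom[OF a.index_member[OF that] hom[OF that]])
  have pull_carrier: "carrier (fst (pull j)) = (\<lambda>w. snd j (\<phi> w)) ` words B"
    and pull_snd: "w \<in> words B \<Longrightarrow> snd (pull j) w = snd j (\<phi> w)"
    and pull_times: "s \<cdot>\<^bsub>fst (pull j)\<^esub> t = s \<cdot>\<^bsub>fst j\<^esub> t" for j w s t
    by (simp_all add: pull_def)
  have pull_word: "\<exists>w\<in>words B. snd j (\<phi> w) = x (pull j)" if "x \<in> b.\<Omega>" "j \<in> a.I" for x j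
    using b.carrier_ex_word[OF that(1) pull[OF that(2)]] pull_snd by auto
  define g where "g = restrict (\<lambda>x. \<lambda>j\<in>a.I. x (pull j)) b.\<Omega>"
  have g_coord: "g x j = x (pull j)" if "x \<in> b.\<Omega>" "j \<in> a.I" for x j
    using that by (simp add: g_def)
  have g_closed: "g x \<in> a.\<Omega>" if x: "x \<in> b.\<Omega>" for x
    unfolding a.carrier_iff
  proof (intro conjI ballI impI)
    have "x (pull j) \<in> carrier (fst j)" if j: "j \<in> a.I" for j
    proof -
      obtain w where w: "w \<in> words B" "snd j (\<phi> w) = x (pull j)"
        using pull_word[OF x j] by (rule bexE)
      show ?thesis
        using a.index_closed[OF j \<phi>A[OF w(1)]] w(2) by simp
    qed
    then have "\<forall>j\<in>a.I. x (pull j) \<in> carrier (fst j)"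
      by (rule ballI)
    moreover have "g x = (\<lambda>j\<in>a.I. x (pull j))"
      using x by (simp add: g_def)
    ultimately show "g x \<in> (\<Pi>\<^sub>E i\<in>a.I. carrier (fst i))"
      by (simp only: restrict_PiE_iff)
    fix i j f assume ij: "j \<in> a.I" "i \<in> a.I" "f \<in> sgp_hom (fst j) (fst i)"
      and f: "\<forall>w\<in>words A. f (snd j w) = snd i w"
    obtain k where k: "k \<in> b.I" "b.refines k (pull i)" "b.refines k (pull j)"
      using b.index_directed[OF pull[OF ij(2)] pull[OF ij(1)]] by (elim bexE conjE)
    obtain w where w: "w \<in> words B" "snd k w = x k"
      using b.carrier_ex_word[OF x k(1)] by (rule bexE)
    have "snd (pull i) w = x (pull i)" "snd (pull j) w = x (pull j)"
      by (rule b.carrier_word[OF x k(1) pull[OF ij(2)] k(2) w], rule b.carrier_word[OF x k(1) pull[OF ij(1)] k(3) w])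
    then show "f (g x j) = g x i"
      using bspec[OF f \<phi>A[OF w(1)]] by (simp add: g_coord x ij pull_snd w(1))
  qed
  have g_hom: "g \<in> sgp_hom (proV V B) (proV V A)"
  proof -
    have "g (x \<cdot>\<^bsub>proV V B\<^esub> y) = g x \<cdot>\<^bsub>proV V A\<^esub> g y" if xy: "x \<in> b.\<Omega>" "y \<in> b.\<Omega>" for x y
    proof (rule a.carrier_eqI[OF g_closed[OF b.mul_closed[OF xy]] a.mul_closed[OF g_closed[OF xy(1)] g_closed[OF xy(2)]]])
      fix j assume j: "j \<in> a.I"
      show "g (x \<cdot>\<^bsub>proV V B\<^esub> y) j = (g x \<cdot>\<^bsub>proV V A\<^esub> g y) j"
        unfolding a.mul_coord[OF j] g_coord[OF b.mul_closed[OF xy] j] g_coord[OF xy(1) j] g_coord[OF xy(2) j]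
          b.mul_coord[OF pull[OF j]] pull_times by (rule refl)
    qed
    then show ?thesis
      using g_closed by (simp add: sgp_hom_def a.carrier_proV b.carrier_proV Pi_iff)
  qed
  have g_word: "g (proV_word V B w) = proV_word V A (\<phi> w)" if w: "w \<in> words B" for w
  proof (rule a.carrier_eqI[OF g_closed[OF b.word_carrier[OF w]] a.word_carrier[OF \<phi>A[OF w]]])
    fix j assume j: "j \<in> a.I"
    show "g (proV_word V B w) j = proV_word V A (\<phi> w) j"
      unfolding g_coord[OF b.word_carrier[OF w] j] b.word_coord[OF pull[OF j]] a.word_coord[OF j] pull_snd[OF w]
      by (rule refl)
  qed
  have g_cont: "continuous_map (proV_top V B) (proV_top V A) g"
    unfolding proV_top_def[of V A] continuous_map_in_subtopology continuous_map_componentwise b.topspace_proV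
  proof (intro conjI ballI)
    show "g ` b.\<Omega> \<subseteq> extensional a.I"
      by (auto simp: g_def)
    show "g \<in> b.\<Omega> \<rightarrow> a.\<Omega>"
      using g_closed by blast
    fix j assume j: "j \<in> a.I"
    have sub: "carrier (fst (pull j)) \<subseteq> carrier (fst j)"
      using pull_carrier a.index_closed[OF j \<phi>A] by auto
    have "continuous_map (discrete_topology (carrier (fst (pull j)))) (discrete_topology (carrier (fst j))) (\<lambda>s. s)"
      using sub by (simp add: Pi_iff subset_iff)
    from continuous_map_compose[OF b.continuous_coord[OF pull[OF j]] this]
    have "continuous_map (proV_top V B) (discrete_topology (carrier (fst j))) (\<lambda>x. x (pull j))"
      by (simp add: comp_def)
    then show "continuous_map (proV_top V B) (discrete_topology (carrier (fst j))) (\<lambda>x. g x j)"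
      by (rule continuous_map_eq) (simp add: b.topspace_proV g_coord j)
  qed
  have "proV_ext V B A \<phi> = g"
    unfolding proV_ext_def
  proof (rule the_equality)
    show "g \<in> extensional (proV_carrier V B) \<and> g \<in> sgp_hom (proV V B) (proV V A) \<and>
      continuous_map (proV_top V B) (proV_top V A) g \<and> (\<forall>w\<in>words B. g (proV_word V B w) = proV_word V A (\<phi> w))"
      using g_hom g_cont g_word by (simp add: g_def)
    fix f assume f: "f \<in> extensional (proV_carrier V B) \<and> f \<in> sgp_hom (proV V B) (proV V A) \<and>
      continuous_map (proV_top V B) (proV_top V A) f \<and> (\<forall>w\<in>words B. f (proV_word V B w) = proV_word V A (\<phi> w))"
    \<comment> \<open>Uniqueness: continuous maps into a Hausdorff space that agree on the dense set
      of words are equal.\<close>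
    have haus: "Hausdorff_space (proV_top V A)"
      unfolding proV_top_def by (intro Hausdorff_space_subtopology) (simp add: Hausdorff_space_product_topology)
    have f_cont: "continuous_map (proV_top V B) (proV_top V A) f"
      and f_word: "\<forall>w\<in>words B. f (proV_word V B w) = proV_word V A (\<phi> w)"
      using f by simp_all
    have fg: "f y = g y" if "y \<in> proV_word V B ` words B" for y
      using that by (rule imageE) (simp add: f_word g_word)
    have "f x = g x" if "x \<in> b.\<Omega>" for x
      by (rule forall_in_closure_of_eq[OF b.in_closureI[OF that subset_refl b.carrier_ex_word[OF that]]
        haus f_cont g_cont fg])
    then show "f = g"
      using f by (intro extensionalityI[of f b.\<Omega> g]) (simp_all add: g_def)
  qed
  then show ?thesis
    using pull_word[OF x j] g_coord[OF x j] by simp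
qed

section \<open>Recognizability of saturating sequences\<close>

theorem theorem10p13:
  fixes A :: "nat \<Rightarrow> 'a set" and \<sigma> :: "nat \<Rightarrow> 'a list \<Rightarrow> 'a list" and V :: "nat sgp set"
  assumes "directive_sequence A \<sigma>" and "primitive A \<sigma>" and "encoding A \<sigma>"
    and "pseudovariety V" and "LSl \<subseteq> V"
    and "\<And>n. V_recognizable V (A 0) (seq_comp \<sigma> 0 n ` words (A n))"
    and "saturating V A \<sigma>" and "eventually_recognizable A \<sigma>"
  shows "recognizable A \<sigma>"
proof -
  interpret primitive_sequence A \<sigma>
    by standard (fact assms)+
  have fp: "free_pro_V V (A n)" for n
    by standard (use assms fin ne in auto)
  interpret P: free_pro_V V "A 0"
    by (rule fp)
  interpret R: recurrent_language V "A 0" L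
  proof
    show "L \<subseteq> words (A 0)" by (rule lang_words)
    show "y \<in> L" if "x \<in> L" "x = p @ y @ q" "y \<noteq> []" for x p y q
      by (rule lang_factor[OF that])
  qed (rule lang_unbounded lang_uniformly_recurrent lang_two; assumption)+
  obtain H where H: "maximal_subgroup (proV V (A 0)) H" "H \<subseteq> J_V V A \<sigma>" "H \<subseteq> Im_V V A \<sigma>"
    using assms(7) unfolding saturating_def by (elim exE conjE)
  have "J_V V A \<sigma> = R.J_inf"
    unfolding J_V_def Let_def by (rule R.J_inf_unique)
  with H(2) have HJ: "H \<subseteq> R.J_inf"
    by simp
  show ?thesis
  proof (rule R.sync_words[OF H(1) HJ])
    fix u v :: "nat \<Rightarrow> 'a list"
    assume len: "\<And>m. length (u m) = m" "\<And>m. length (v m) = m"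
      and nest: "\<And>m m'. m \<le> m' \<Longrightarrow> suffix (u m) (u m')" "\<And>m m'. m \<le> m' \<Longrightarrow> prefix (v m) (v m')"
      and uvL: "\<And>m. m > 0 \<Longrightarrow> u m @ v m \<in> L"
      and sync: "\<And>j C. j \<in> P.I \<Longrightarrow> (\<And>w. w \<in> words (A 0) \<Longrightarrow> snd j w \<in> snd j ` C \<Longrightarrow> w \<in> C) \<Longrightarrow>
        (\<And>x. x \<in> H \<Longrightarrow> x j \<in> snd j ` C) \<Longrightarrow>
        \<exists>m>0. \<forall>w\<in>L. prefix (v m) w \<longrightarrow> suffix (u m) w \<longrightarrow> w \<in> C"
    have im: "\<exists>m. \<forall>w\<in>L. prefix (v (Suc m)) w \<longrightarrow> suffix (u (Suc m)) w \<longrightarrow> w \<in> seq_comp \<sigma> 0 n ` words (A n)" for n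
    proof -
      let ?C = "seq_comp \<sigma> 0 n ` words (A n)"
      obtain S \<phi> where S: "S \<in> V" "\<phi> \<in> sgp_hom (free_sgp (A 0)) S" "?C = {w \<in> words (A 0). \<phi> w \<in> \<phi> ` ?C}"
        using assms(6)[of n] unfolding V_recognizable_def by (elim conjE bexE)
      \<comment> \<open>The recognizing homomorphism, made onto, becomes the single coordinate that
        decides membership in \<open>?C\<close>.\<close>
      define j where "j = (S\<lparr>carrier := \<phi> ` words (A 0)\<rparr>, restrict \<phi> (words (A 0)))"
      have j: "j \<in> P.I"
        unfolding j_def by (rule P.index_of_hom[OF S(1,2)])
      have sj: "snd j w = \<phi> w" if "w \<in> words (A 0)" for w
        using that by (simp add: j_def)
      have CA: "w \<in> words (A 0)" if "w \<in> ?C" for w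
        using that S(3) by blast
      have img: "snd j ` ?C = \<phi> ` ?C"
        by (rule image_cong[OF refl]) (use sj CA in blast)
      have "\<exists>m>0. \<forall>w\<in>L. prefix (v m) w \<longrightarrow> suffix (u m) w \<longrightarrow> w \<in> ?C"
      proof (rule sync[OF j])
        show "w \<in> ?C" if "w \<in> words (A 0)" "snd j w \<in> snd j ` ?C" for w
          using that S(3) unfolding img sj[OF that(1)] by blast
        fix x assume "x \<in> H"
        then have "x \<in> proV_ext V (A n) (A 0) (seq_comp \<sigma> 0 n) ` proV_carrier V (A n)"
          using H(3) unfolding Im_V_def by blast
        then obtain x' where x': "x' \<in> proV_carrier V (A n)" "x = proV_ext V (A n) (A 0) (seq_comp \<sigma> 0 n) x'"
          by (rule imageE)
        obtain w where "w \<in> words (A n)" "snd j (seq_comp \<sigma> 0 n w) = x j"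
          using proV_ext_coord[OF fp fp comp_hom x'(1) j] x'(2) by auto
        then show "x j \<in> snd j ` ?C"
          by (metis imageI)
      qed
      then obtain m where m: "m > 0" "\<forall>w\<in>L. prefix (v m) w \<longrightarrow> suffix (u m) w \<longrightarrow> w \<in> ?C"
        by (elim exE conjE)
      then show ?thesis
        by (intro exI[of _ "m - 1"]) simp
    qed
    \<comment> \<open>The shift of indices by one provides the nonempty words that the locale
      demands, as \<open>length (u m) = m\<close>.\<close>
    have "synchronizing_sequence A \<sigma> (\<lambda>m. u (Suc m)) (\<lambda>m. v (Suc m))"
    proof
      show "encoding A \<sigma>" by fact
      show "u (Suc m) \<noteq> []" "v (Suc m) \<noteq> []" for m
        using len[of "Suc m"] by auto
    qed (use len uvL nest im in auto)
    then show ?thesis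
      by (rule synchronizing_sequence.recognizable)
  qed
qed

end
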